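(* Let $G$ be a finite simple graph and let $M$ be the cycle matroid of $G$. Then the following conditions are equivalent: (a) $M$ is a Freiman matroid. (b) $G$ contains at most one cycle. (c) $F(I_M)$ is a polynomial ring.
   Context: $K$ is a field. The cycle matroid of a finite simple graph $G$ with edges $E(G)=\{e_1,\ldots,e_m\}$ is the matroid with ground set $E(G)$ whose bases are the edge sets $E(F)$ of the spanning forests $F$ of $G$, where a spanning forest is a maximal acyclic subgraph of $G$. The matroidal ideal of $M$ is the ideal $I_M\subset K[x_1,\ldots,x_m]$ generated by the monomials $u_F=\prod_{e_i\in E(F)}x_i$, with $F$ a spanning forest of $G$. The fiber cone of an ideal $I$ is $F(I)=\bigoplus_{k\ge 0}I^k/\mathfrak m I^k$, where $\mathfrak m=(x_1,\ldots,x_m)$, and $\ell(I)=\dim F(I)$ (Krull dimension) is its analytic spread; $F(I_M)$ is called the base ring of $M$. $M$ is a Freiman matroid if $I_M$ is a Freiman ideal, i.e. $\mu(I_M^2)=\ell(I_M)\mu(I_M)-\binom{\ell(I_M)}{2}$, where $\mu$ denotes the minimal number of generators. *)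

theory Defs
  imports
    "HOL-Library.Poly_Mapping"
    "HOL-Library.Extended_Nat"
    "HOL-Algebra.QuotRing"
    "HOL-Algebra.Ideal_Product"
begin

section \<open>Finite simple graphs, forests and the cycle matroid\<close>

type_synonym 'v graph = "'v set \<times> 'v set set"

abbreviation verts :: "'v graph \<Rightarrow> 'v set" where
  "verts G \<equiv> fst G"

abbreviation edges :: "'v graph \<Rightarrow> 'v set set" where
  "edges G \<equiv> snd G"

definition simple_graph :: "'v graph \<Rightarrow> bool" where
  "simple_graph G \<longleftrightarrow> (\<forall>e\<in>edges G. e \<subseteq> verts G \<and> card e = 2)"

definition finite_simple_graph :: "'v graph \<Rightarrow> bool" where
  "finite_simple_graph G \<longleftrightarrow> simple_graph G \<and> finite (verts G)"

definition subgraph :: "'v graph \<Rightarrow> 'v graph \<Rightarrow> bool" where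
  "subgraph H G \<longleftrightarrow> simple_graph H \<and> verts H \<subseteq> verts G \<and> edges H \<subseteq> edges G"

text \<open>
  The cycle through pairwise distinct vertices \<open>v\<^sub>0, \<dots>, v\<^sub>n\<^sub>-\<^sub>1\<close> with \<open>n \<ge> 3\<close>. A cycle is this
  graph, so that different starting points and orientations of \<open>vs\<close> give the same cycle.
\<close>

definition cycle_graph :: "'v graph \<Rightarrow> bool" where
  "cycle_graph C \<longleftrightarrow> (\<exists>vs. distinct vs \<and> 3 \<le> length vs \<and> verts C = set vs \<and>
     edges C = {{vs ! i, vs ! (Suc i mod length vs)} | i. i < length vs})"

definition cycle_in :: "'v graph \<Rightarrow> 'v graph \<Rightarrow> bool" where
  "cycle_in C G \<longleftrightarrow> cycle_graph C \<and> subgraph C G"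

definition acyclic_graph :: "'v graph \<Rightarrow> bool" where
  "acyclic_graph G \<longleftrightarrow> (\<nexists>C. cycle_in C G)"

definition spanning_forest :: "'v graph \<Rightarrow> 'v graph \<Rightarrow> bool" where
  "spanning_forest F G \<longleftrightarrow> subgraph F G \<and> acyclic_graph F \<and>
     (\<forall>H. subgraph H G \<and> acyclic_graph H \<and> subgraph F H \<longrightarrow> H = F)"

text \<open>A matroid is given by its ground set and its set of bases.\<close>

type_synonym 'e matroid = "'e set \<times> 'e set set"

definition cycle_matroid :: "'v graph \<Rightarrow> 'v set matroid" where
  "cycle_matroid G = (edges G, {edges F | F. spanning_forest F G})"


section \<open>Polynomial rings\<close>

text \<open>
  An element of \<open>('x \<Rightarrow>\<^sub>0 nat) \<Rightarrow>\<^sub>0 'k\<close> is a polynomial with variables from the type \<open>'x\<close>;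
  the ring \<open>mpoly_ring X\<close> consists of those that involve only variables from the set \<open>X\<close>.
\<close>

type_synonym ('x, 'k) mpoly = "('x \<Rightarrow>\<^sub>0 nat) \<Rightarrow>\<^sub>0 'k"

definition mpoly_ring :: "'x set \<Rightarrow> ('x, 'k::field) mpoly ring" where
  "mpoly_ring X = \<lparr>carrier = {p. \<forall>t\<in>Poly_Mapping.keys p. Poly_Mapping.keys t \<subseteq> X},
     mult = (*), one = 1, zero = 0, add = (+)\<rparr>"

definition poly_const :: "'k::field \<Rightarrow> ('x, 'k) mpoly" where
  "poly_const c = Poly_Mapping.single 0 c"

definition poly_var :: "'x \<Rightarrow> ('x, 'k::field) mpoly" where
  "poly_var x = Poly_Mapping.single (Poly_Mapping.single x 1) 1"

text \<open>The ideal \<open>\<mm>\<close> generated by the variables.\<close>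

definition var_ideal :: "'x set \<Rightarrow> ('x, 'k::field) mpoly set" where
  "var_ideal X = genideal (mpoly_ring X) (poly_var ` X)"


section \<open>Ideals, Krull dimension and the fiber cone\<close>

primrec ideal_power :: "('a, 'b) ring_scheme \<Rightarrow> 'a set \<Rightarrow> nat \<Rightarrow> 'a set" where
  "ideal_power R I 0 = carrier R"
| "ideal_power R I (Suc k) = ideal_prod R (ideal_power R I k) I"

definition min_gens :: "('a, 'b) ring_scheme \<Rightarrow> 'a set \<Rightarrow> nat" where
  "min_gens R I = (LEAST n. \<exists>A. A \<subseteq> carrier R \<and> finite A \<and> card A = n \<and> genideal R A = I)"

text \<open>The supremum of the lengths \<open>n\<close> of chains of prime ideals \<open>P\<^sub>0 \<subset> \<dots> \<subset> P\<^sub>n\<close>.\<close>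

definition krull_dim :: "('a, 'b) ring_scheme \<Rightarrow> enat" where
  "krull_dim R = Sup {enat n | n. \<exists>P :: nat \<Rightarrow> 'a set.
     (\<forall>i\<le>n. primeideal (P i) R) \<and> (\<forall>i<n. P i \<subset> P (Suc i))}"

text \<open>
  The graded ring \<open>\<Oplus>\<^sub>k I\<^sup>k / \<mm>I\<^sup>k\<close>. An element is a finitely supported family \<open>f\<close> in which \<open>f k\<close>
  is a coset \<open>\<mm>I\<^sup>k + a\<close> with \<open>a \<in> I\<^sup>k\<close>. The additive group of the \<open>k\<close>-th component is a subgroup of
  that of \<open>R/\<mm>I\<^sup>k\<close>. The product of the homogeneous elements \<open>\<mm>I\<^sup>i + a\<close> and \<open>\<mm>I\<^sup>j + b\<close> is
  \<open>\<mm>I\<^sup>i\<^sup>+\<^sup>j + ab\<close>, which is the value of \<open>rcoset_mult R (\<mm>I\<^sup>i\<^sup>+\<^sup>j)\<close> on these two cosets.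
\<close>

definition mI_power :: "('a, 'b) ring_scheme \<Rightarrow> 'a set \<Rightarrow> 'a set \<Rightarrow> nat \<Rightarrow> 'a set" where
  "mI_power R m I k = ideal_prod R m (ideal_power R I k)"

definition fiber_cone :: "('a, 'b) ring_scheme \<Rightarrow> 'a set \<Rightarrow> 'a set \<Rightarrow> (nat \<Rightarrow> 'a set) ring" where
  "fiber_cone R m I =
    \<lparr>carrier = {f. (\<forall>k. \<exists>a\<in>ideal_power R I k. f k = a_r_coset R (mI_power R m I k) a) \<and>
                  finite {k. f k \<noteq> mI_power R m I k}},
     mult = (\<lambda>f g k. finsum (R Quot (mI_power R m I k))
              (\<lambda>i. rcoset_mult R (mI_power R m I k) (f i) (g (k - i))) {..k}),
     one = (\<lambda>k. if k = 0 then a_r_coset R (mI_power R m I k) \<one>\<^bsub>R\<^esub> else mI_power R m I k),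
     zero = (\<lambda>k. mI_power R m I k),
     add = (\<lambda>f g k. f k \<oplus>\<^bsub>R Quot (mI_power R m I k)\<^esub> g k)\<rparr>"

text \<open>The fiber cone of an ideal \<open>I\<close> of \<open>K[X]\<close>, and its structure map as a \<open>K\<close>-algebra.\<close>

definition poly_fiber_cone ::
    "'x set \<Rightarrow> ('x, 'k::field) mpoly set \<Rightarrow> (nat \<Rightarrow> ('x, 'k) mpoly set) ring" where
  "poly_fiber_cone X I = fiber_cone (mpoly_ring X) (var_ideal X) I"

definition fiber_const ::
    "'x set \<Rightarrow> ('x, 'k::field) mpoly set \<Rightarrow> 'k \<Rightarrow> (nat \<Rightarrow> ('x, 'k) mpoly set)" where
  "fiber_const X I c = (\<lambda>k. if k = 0
     then a_r_coset (mpoly_ring X) (mI_power (mpoly_ring X) (var_ideal X) I k) (poly_const c)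
     else mI_power (mpoly_ring X) (var_ideal X) I k)"

definition analytic_spread :: "'x set \<Rightarrow> ('x, 'k::field) mpoly set \<Rightarrow> enat" where
  "analytic_spread X I = krull_dim (poly_fiber_cone X I)"

text \<open>
  The equation is read over the integers, and includes that the analytic spread is finite.
\<close>

definition freiman_ideal :: "'x set \<Rightarrow> ('x, 'k::field) mpoly set \<Rightarrow> bool" where
  "freiman_ideal X I \<longleftrightarrow> (\<exists>l::nat. analytic_spread X I = enat l \<and>
     int (min_gens (mpoly_ring X) (ideal_power (mpoly_ring X) I 2)) =
     int l * int (min_gens (mpoly_ring X) I) - int (l choose 2))"

text \<open>
  The \<open>K\<close>-algebra \<open>A\<close> with structure map \<open>\<phi>\<close> is isomorphic as a \<open>K\<close>-algebra to a polynomial ring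
  over \<open>K\<close> in finitely many variables.
\<close>

definition is_polynomial_algebra :: "('k::field \<Rightarrow> 'a) \<Rightarrow> ('a, 'b) ring_scheme \<Rightarrow> bool" where
  "is_polynomial_algebra \<phi> A \<longleftrightarrow> (\<exists>n::nat. \<exists>h\<in>ring_iso (mpoly_ring {..<n}) A.
     \<forall>c. h (poly_const c) = \<phi> c)"


section \<open>The ideal of a matroid\<close>

definition matroidal_ideal :: "'e matroid \<Rightarrow> ('e, 'k::field) mpoly set" where
  "matroidal_ideal M = genideal (mpoly_ring (fst M)) {\<Prod>e\<in>B. poly_var e | B. B \<in> snd M}"

text \<open>The field \<open>K\<close> is passed as a type argument.\<close>

definition freiman_matroid :: "'k::field itself \<Rightarrow> 'e matroid \<Rightarrow> bool" where
  "freiman_matroid K M \<longleftrightarrow> freiman_ideal (fst M) (matroidal_ideal M :: ('e, 'k) mpoly set)"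

definition base_ring_polynomial :: "'k::field itself \<Rightarrow> 'e matroid \<Rightarrow> bool" where
  "base_ring_polynomial K M \<longleftrightarrow>
     is_polynomial_algebra (fiber_const (fst M) (matroidal_ideal M :: ('e, 'k) mpoly set))
       (poly_fiber_cone (fst M) (matroidal_ideal M))"

end

theory Submission
  imports Defs "HOL-Library.Product_Plus"
begin

text \<open>
  Let \<open>S\<close> be the set of exponent vectors of the monomials \<open>u\<^sub>F\<close>. They have the same degree, so
  \<open>I\<^sup>k\<close> is the direct sum of \<open>\<mm>I\<^sup>k\<close> and the span of the \<open>k\<close>-fold sums of \<open>S\<close>, and the fiber
  cone is the monoid algebra \<open>T\<close> of the pairs \<open>(k, w)\<close> with \<open>w\<close> a \<open>k\<close>-fold sum of \<open>S\<close>
  (\<open>to_fiber_iso\<close>). Moreover \<open>\<mu>(I\<^sup>k)\<close> is the number of \<open>k\<close>-fold sums, by looking at components of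
  lowest degree. The three conditions become statements about \<open>\<mu> = |S|\<close>, the number \<open>|2S|\<close> of sums
  of two elements of \<open>S\<close>, and \<open>\<ell> = dim T\<close>.

  If \<open>G\<close> has at most one cycle, its bases are \<open>E(G)\<close> alone, or the sets \<open>E(G) - {e}\<close> with \<open>e\<close> on the
  cycle. In both cases distinct multisets of bases that have the same size have distinct exponent
  sums, so \<open>T\<close> is a polynomial ring in \<open>\<mu>\<close> variables, \<open>\<ell> = \<mu>\<close>, and \<open>|2S| = \<mu>(\<mu> + 1)/2\<close>, which is the
  Freiman equation.

  If \<open>G\<close> has two cycles, the aim is a subset of \<open>S\<close> with \<open>r\<close> elements that spans \<open>S\<close> rationally and
  satisfies \<open>|2S| > r\<mu> - r(r - 1)/2\<close> (\<open>two_cycles_surplus\<close>). The inequality for six suitable bases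
  is an explicit computation, in which these bases satisfy only one linear relation and this relation
  has degree 3 (\<open>hexagon_surplus\<close>). It survives the addition of further exponent
  vectors one at a time, because a 0/1 vector is a vertex of the convex hull of any set of 0/1
  vectors that contains it; this is the argument of Freiman's inequality (\<open>surplus_spanned_insert\<close>).
  Since \<open>T\<close> is algebraic over the subalgebra of a spanning set, \<open>\<ell> \<le> r\<close>; and \<open>x\<mu> - x(x - 1)/2\<close> is
  increasing for \<open>x \<le> \<mu>\<close>, so the Freiman equation fails. If \<open>T\<close> were a polynomial ring in \<open>n\<close>
  variables, then \<open>n = \<ell> \<le> r\<close>, whereas the \<open>\<mu>\<close> generators of \<open>T\<close> in degree 1 force \<open>\<mu> \<le> n\<close>
  (\<open>card_le_of_polynomial\<close>); hence \<open>r = \<mu>\<close>, which contradicts \<open>|2S| \<le> \<mu>(\<mu> + 1)/2\<close>.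

  Krull dimensions are bounded from above by counting monomials. The count gives a polynomial
  relation between any \<open>r + 1\<close> elements, and such relations exclude a chain of \<open>r + 2\<close> prime ideals by the
  description of dimension due to Coquand and Lombardi.
\<close>

section \<open>Homogeneous linear systems\<close>

abbreviation lookup where "lookup \<equiv> Poly_Mapping.lookup"
abbreviation keys where "keys \<equiv> Poly_Mapping.keys"
abbreviation single where "single \<equiv> Poly_Mapping.single"

text \<open>
  By Gaussian elimination. Every comparison of dimensions below is an application of this lemma, with
  the unknowns indexed by the larger set.
\<close>
lemma underdetermined_system:
  fixes M :: "'a \<Rightarrow> 'b \<Rightarrow> 'k::field"
  assumes "finite B" "finite A" "card B < card A"
  shows "\<exists>c. (\<exists>a\<in>A. c a \<noteq> 0) \<and> (\<forall>b\<in>B. (\<Sum>a\<in>A. c a * M a b) = 0)"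
  using assms
proof (induction B arbitrary: A M rule: finite_induct)
  case empty
  then obtain a where "a \<in> A" by fastforce
  then show ?case by (intro exI[of _ "\<lambda>_. 1"]) auto
next
  case (insert b B)
  show ?case
  proof (cases "\<forall>a\<in>A. M a b = 0")
    case True
    obtain c where c: "\<exists>a\<in>A. c a \<noteq> 0" "\<forall>b\<in>B. (\<Sum>a\<in>A. c a * M a b) = 0"
      using insert.IH[of A M] insert.prems insert.hyps by auto
    then show ?thesis using True by (intro exI[of _ c]) auto
  next
    case False
    then obtain a0 where a0: "a0 \<in> A" "M a0 b \<noteq> 0" by blast
    define A' where "A' = A - {a0}"
    define M' where "M' = (\<lambda>a x. M a x - M a b / M a0 b * M a0 x)"
    have A': "finite A'" "A = insert a0 A'" "a0 \<notin> A'"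
      using a0 insert.prems by (auto simp: A'_def)
    have "card B < card A'"
      using insert.prems insert.hyps A' by simp
    then obtain c where c: "\<exists>a\<in>A'. c a \<noteq> 0" "\<forall>x\<in>B. (\<Sum>a\<in>A'. c a * M' a x) = 0"
      using insert.IH[of A' M'] A' by auto
    define t where "t = - (\<Sum>a\<in>A'. c a * M a b) / M a0 b"
    define d where "d = c(a0 := t)"
    have sum_d: "(\<Sum>a\<in>A. d a * M a x) = t * M a0 x + (\<Sum>a\<in>A'. c a * M a x)" for x
    proof -
      have "(\<Sum>a\<in>A'. d a * M a x) = (\<Sum>a\<in>A'. c a * M a x)"
        using A' by (intro sum.cong) (auto simp: d_def)
      then show ?thesis using A' by (simp add: d_def)
    qed
    have "(\<Sum>a\<in>A. d a * M a b) = 0"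
      using a0 by (simp add: sum_d t_def)
    moreover have "(\<Sum>a\<in>A. d a * M a x) = 0" if "x \<in> B" for x
    proof -
      have "0 = (\<Sum>a\<in>A'. c a * M' a x)" using c that by auto
      also have "\<dots> = (\<Sum>a\<in>A'. c a * M a x) - (\<Sum>a\<in>A'. c a * M a b) * (M a0 x / M a0 b)"
        unfolding M'_def
        by (simp add: sum_distrib_right sum_divide_distrib right_diff_distrib sum_subtractf mult.assoc)
      finally show ?thesis by (simp add: sum_d t_def)
    qed
    moreover have "\<exists>a\<in>A. d a \<noteq> 0" using c(1) A' by (auto simp: d_def)
    ultimately show ?thesis by blast
  qed
qed

section \<open>Monoid rings\<close>

text \<open>
  The monoid ring of a submonoid of an additive monoid. Both the polynomial rings \<open>K[X]\<close> and the
  toric ring that describes the fiber cone have this form.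
\<close>
definition monoid_ring :: "'m::comm_monoid_add set \<Rightarrow> ('m \<Rightarrow>\<^sub>0 'k::field) ring" where
  "monoid_ring \<Gamma> = \<lparr>carrier = {p. keys p \<subseteq> \<Gamma>}, mult = (*), one = 1, zero = 0, add = (+)\<rparr>"

definition submonoid :: "'m::comm_monoid_add set \<Rightarrow> bool" where
  "submonoid \<Gamma> \<longleftrightarrow> 0 \<in> \<Gamma> \<and> (\<forall>a\<in>\<Gamma>. \<forall>b\<in>\<Gamma>. a + b \<in> \<Gamma>)"

lemma monoid_ring_simps [simp]:
  "carrier (monoid_ring \<Gamma>) = {p. keys p \<subseteq> \<Gamma>}"
  "x \<otimes>\<^bsub>monoid_ring \<Gamma>\<^esub> y = x * y" "\<one>\<^bsub>monoid_ring \<Gamma>\<^esub> = 1"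
  "\<zero>\<^bsub>monoid_ring \<Gamma>\<^esub> = 0" "x \<oplus>\<^bsub>monoid_ring \<Gamma>\<^esub> y = x + y"
  by (simp_all add: monoid_ring_def)

lemma mpoly_ring_eq_monoid_ring: "mpoly_ring X = monoid_ring {t. keys t \<subseteq> X}"
  by (auto simp: mpoly_ring_def monoid_ring_def)

lemma submonoid_vars: "submonoid {t :: 'x \<Rightarrow>\<^sub>0 nat. keys t \<subseteq> X}"
  unfolding submonoid_def using keys_add by fastforce

lemma keys_mult_submonoid:
  assumes "submonoid \<Gamma>" "keys p \<subseteq> \<Gamma>" "keys q \<subseteq> \<Gamma>"
  shows "keys (p * q) \<subseteq> \<Gamma>"
  using keys_mult[of p q] assms unfolding submonoid_def by blast

lemma keys_add_subset: "keys p \<subseteq> A \<Longrightarrow> keys q \<subseteq> A \<Longrightarrow> keys (p + q) \<subseteq> A"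
  using keys_add[of p q] by blast

lemma keys_uminus: "keys (- p :: 'm \<Rightarrow>\<^sub>0 'k::ab_group_add) = keys p"
  by (auto simp: in_keys_iff)

lemma keys_diff_subset:
  "keys p \<subseteq> A \<Longrightarrow> keys q \<subseteq> A \<Longrightarrow> keys (p - q :: 'm \<Rightarrow>\<^sub>0 'k::ab_group_add) \<subseteq> A"
  using keys_add_subset[of p A "- q"] by (simp add: keys_uminus)

lemma keys_sum_subset: "(\<And>i. i \<in> I \<Longrightarrow> keys (f i) \<subseteq> A) \<Longrightarrow> keys (sum f I) \<subseteq> A"
  by (induction I rule: infinite_finite_induct) (simp_all add: keys_add_subset)

lemma keys_power_submonoid:
  assumes "submonoid \<Gamma>" "keys p \<subseteq> \<Gamma>"
  shows "keys (p ^ n) \<subseteq> \<Gamma>"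
proof (induction n)
  case 0 then show ?case using assms by (auto simp: submonoid_def)
next
  case (Suc n) then show ?case using keys_mult_submonoid[OF assms] by simp
qed

lemma cring_monoid_ring:
  assumes "submonoid \<Gamma>"
  shows "cring (monoid_ring \<Gamma> :: ('m::comm_monoid_add \<Rightarrow>\<^sub>0 'k::field) ring)"
proof (rule cringI)
  show "abelian_group (monoid_ring \<Gamma> :: ('m \<Rightarrow>\<^sub>0 'k) ring)"
  proof (rule abelian_groupI)
    fix x :: "'m \<Rightarrow>\<^sub>0 'k" assume "x \<in> carrier (monoid_ring \<Gamma>)"
    then show "\<exists>y\<in>carrier (monoid_ring \<Gamma>). y \<oplus>\<^bsub>monoid_ring \<Gamma>\<^esub> x = \<zero>\<^bsub>monoid_ring \<Gamma>\<^esub>"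
      by (intro bexI[of _ "- x"]) (auto simp: keys_uminus)
  qed (simp_all add: keys_add_subset algebra_simps)
  show "comm_monoid (monoid_ring \<Gamma> :: ('m \<Rightarrow>\<^sub>0 'k) ring)"
    by (rule comm_monoidI)
      (use assms in \<open>simp_all add: keys_mult_submonoid algebra_simps submonoid_def\<close>)
qed (auto simp: algebra_simps)

lemma additive_sum_closed:
  assumes "ideal J (monoid_ring \<Gamma>)" "\<And>i. i \<in> A \<Longrightarrow> f i \<in> J"
  shows "sum f A \<in> J"
proof -
  interpret ideal J "monoid_ring \<Gamma>" by fact
  have "x + y \<in> J" if "x \<in> J" "y \<in> J" for x y
    using additive_subgroup.a_closed[OF is_additive_subgroup that] by simp
  moreover have "0 \<in> J" using additive_subgroup.zero_closed[OF is_additive_subgroup] by simp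
  ultimately show ?thesis
    using assms(2) by (induction A rule: infinite_finite_induct) auto
qed

lemma poly_mapping_sum_single:
  fixes p :: "'m \<Rightarrow>\<^sub>0 'k::comm_monoid_add"
  assumes "keys p \<subseteq> A" "finite A"
  shows "p = (\<Sum>t\<in>A. single t (lookup p t))"
proof (rule poly_mapping_eqI)
  fix k
  have "lookup (\<Sum>t\<in>A. single t (lookup p t)) k = (\<Sum>t\<in>A. if t = k then lookup p t else 0)"
    by (auto simp: lookup_sum lookup_single when_def intro!: sum.cong)
  also have "\<dots> = lookup p k"
    using assms by (auto simp: in_keys_iff)
  finally show "lookup p k = lookup (\<Sum>t\<in>A. single t (lookup p t)) k" by simp
qed

lemma poly_mapping_split:
  fixes p :: "'m \<Rightarrow>\<^sub>0 'k::ab_group_add"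
  shows "\<exists>q. keys q \<subseteq> keys p \<inter> A \<and> keys (p - q) \<subseteq> keys p - A"
proof -
  let ?q = "\<Sum>t\<in>keys p \<inter> A. single t (lookup p t)"
  have lookup_q: "lookup ?q k = (if k \<in> A then lookup p k else 0)" for k
  proof -
    have "lookup ?q k = (\<Sum>t\<in>keys p \<inter> A. if t = k then lookup p t else 0)"
      by (auto simp: lookup_sum lookup_single when_def intro!: sum.cong)
    then show ?thesis by (auto simp: in_keys_iff)
  qed
  have "keys ?q \<subseteq> keys p \<inter> A" "keys (p - ?q) \<subseteq> keys p - A"
    by (auto simp: in_keys_iff lookup_minus lookup_q split: if_splits)
  then show ?thesis by blast
qed

section \<open>Bounds for the Krull dimension\<close>

lemma krull_dim_ge_chain:
  assumes "\<And>i. i \<le> n \<Longrightarrow> primeideal (P i) R" "\<And>i. i < n \<Longrightarrow> P i \<subset> P (Suc i)"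
  shows "enat n \<le> krull_dim R"
  unfolding krull_dim_def using assms by (intro Sup_upper) blast

lemma primeideal_vimage:
  assumes h: "h \<in> ring_hom R S" and R: "cring R" and P: "primeideal P S"
  shows "primeideal {x \<in> carrier R. h x \<in> P} R"
proof -
  interpret S: primeideal P S by fact
  interpret R: cring R by fact
  interpret H: ring_hom_cring R S h
    by (intro ring_hom_cring.intro ring_hom_cring_axioms.intro R S.is_cring h)
  have "ideal {x \<in> carrier R. h x \<in> P} R"
  proof (rule idealI)
    show "ring R" by (rule R.ring_axioms)
    show "subgroup {x \<in> carrier R. h x \<in> P} (add_monoid R)"
      by (rule R.add.subgroupI)
        (auto simp: S.a_closed a_inv_def[symmetric] intro!: exI[of _ "\<zero>\<^bsub>R\<^esub>"])
  qed (auto simp: S.I_l_closed S.I_r_closed)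
  then show ?thesis
  proof (rule primeidealI[OF _ R])
    show "carrier R \<noteq> {x \<in> carrier R. h x \<in> P}"
    proof
      assume "carrier R = {x \<in> carrier R. h x \<in> P}"
      then have "h \<one>\<^bsub>R\<^esub> \<in> P" using R.one_closed by blast
      then show False using S.I_notcarr S.one_imp_carrier by auto
    qed
    show "a \<in> {x \<in> carrier R. h x \<in> P} \<or> b \<in> {x \<in> carrier R. h x \<in> P}"
      if "a \<in> carrier R" "b \<in> carrier R" "a \<otimes>\<^bsub>R\<^esub> b \<in> {x \<in> carrier R. h x \<in> P}" for a b
      using that S.I_prime[of "h a" "h b"] by auto
  qed
qed

lemma krull_dim_le_of_surj:
  assumes h: "h \<in> ring_hom R S" and surj: "h ` carrier R = carrier S" and R: "cring R"
  shows "krull_dim S \<le> krull_dim R"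
  unfolding krull_dim_def[of S]
proof (rule Sup_least)
  fix d assume "d \<in> {enat n |n. \<exists>P. (\<forall>i\<le>n. primeideal (P i) S) \<and> (\<forall>i<n. P i \<subset> P (Suc i))}"
  then obtain n P where d: "d = enat n" and P: "\<And>i. i \<le> n \<Longrightarrow> primeideal (P i) S"
    "\<And>i. i < n \<Longrightarrow> P i \<subset> P (Suc i)" by blast
  let ?Q = "\<lambda>i. {x \<in> carrier R. h x \<in> P i}"
  have "?Q i \<subset> ?Q (Suc i)" if "i < n" for i
  proof -
    have "P i \<subset> P (Suc i)" using P(2) that by blast
    then obtain y where y: "y \<in> P (Suc i)" "y \<notin> P i" by blast
    have "ideal (P (Suc i)) S" using P(1)[of "Suc i"] that by (simp add: primeideal.axioms(1))
    then have "y \<in> carrier S" using y by (simp add: ideal.Icarr)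
    then have "y \<in> h ` carrier R" using surj by simp
    then obtain x where "x \<in> carrier R" "h x = y" by (auto simp: image_iff)
    then show ?thesis using y \<open>P i \<subset> P (Suc i)\<close> by (intro psubsetI) auto
  qed
  then show "d \<le> krull_dim R"
    unfolding d using primeideal_vimage[OF h R P(1)] by (intro krull_dim_ge_chain[of n ?Q]) blast+
qed

lemma krull_dim_iso:
  assumes h: "h \<in> ring_iso R S" and R: "cring R" and S: "cring S"
  shows "krull_dim S = krull_dim R"
proof (rule antisym)
  have hom: "h \<in> ring_hom R S" and bij: "bij_betw h (carrier R) (carrier S)"
    using h by (auto simp: ring_iso_def)
  show "krull_dim S \<le> krull_dim R"
    using krull_dim_le_of_surj[OF hom _ R] bij by (simp add: bij_betw_def)
  have g: "inv_into (carrier R) h \<in> ring_iso S R"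
    using ring_iso_set_sym[OF cring.axioms(1)[OF R] h] .
  then show "krull_dim R \<le> krull_dim S"
    by (intro krull_dim_le_of_surj[OF _ _ S]) (auto simp: ring_iso_def bij_betw_def)
qed

text \<open>
  The iterated boundary monoids of Coquand and Lombardi: \<open>collapse A [x\<^sub>0, \<dots>, x\<^sub>r]\<close> consists of the
  elements \<open>x\<^sub>0\<^bsup>m\<^sub>0\<^esup>(\<dots> x\<^sub>r\<^bsup>m\<^sub>r\<^esup>(c + a\<^sub>r x\<^sub>r) \<dots> + a\<^sub>0 x\<^sub>0)\<close>. If all sequences of length \<open>r + 1\<close> have 0 in
  this set, the dimension is at most \<open>r\<close>. Here \<open>c\<close> is a nonzero constant instead of 1, which avoids
  a normalization of the relations.
\<close>
primrec collapse :: "('m::comm_monoid_add \<Rightarrow>\<^sub>0 'k::field) set \<Rightarrow> ('m \<Rightarrow>\<^sub>0 'k) list \<Rightarrow> ('m \<Rightarrow>\<^sub>0 'k) set" where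
  "collapse A [] = {single 0 k | k. k \<noteq> 0}"
| "collapse A (x # xs) = {x ^ m * (c + a * x) | m c a. c \<in> collapse A xs \<and> a \<in> A}"

lemma collapse_subset:
  assumes "submonoid \<Gamma>" "c \<in> collapse {p. keys p \<subseteq> \<Gamma>} xs" "\<forall>x\<in>set xs. keys x \<subseteq> \<Gamma>"
  shows "keys c \<subseteq> \<Gamma>"
  using assms(2,3)
proof (induction xs arbitrary: c)
  case Nil
  then show ?case using assms(1) by (auto simp: submonoid_def)
next
  case (Cons x xs)
  then obtain m c' a where c: "c = x ^ m * (c' + a * x)"
      "c' \<in> collapse {p. keys p \<subseteq> \<Gamma>} xs" "keys a \<subseteq> \<Gamma>" by auto
  have "keys c' \<subseteq> \<Gamma>" "keys x \<subseteq> \<Gamma>" using Cons c(2) by auto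
  then show ?case
    unfolding c(1) using c(3) assms(1)
    by (intro keys_mult_submonoid keys_power_submonoid keys_add_subset)
qed

text \<open>
  Dividing by \<open>x\<^sub>0\<^bsup>m\<^sub>0\<^esup>\<close>, which is not in \<open>P\<^sub>0\<close>, and then dropping the multiple of \<open>x\<^sub>0\<close>, which is in
  \<open>P\<^sub>1\<close>, moves the element one step up in the chain. At the top a nonzero constant is left.
\<close>
lemma collapse_not_in_prime_chain:
  fixes P :: "nat \<Rightarrow> ('m::comm_monoid_add \<Rightarrow>\<^sub>0 'k::field) set"
  assumes \<Gamma>: "submonoid \<Gamma>"
    and "\<And>i. i \<le> length xs \<Longrightarrow> primeideal (P i) (monoid_ring \<Gamma>)"
    and "\<And>i. i < length xs \<Longrightarrow> P i \<subset> P (Suc i)"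
    and "\<And>i. i < length xs \<Longrightarrow> xs ! i \<in> P (Suc i) - P i"
    and "c \<in> collapse {p. keys p \<subseteq> \<Gamma>} xs" "c \<in> P 0"
  shows False
  using assms(2-)
proof (induction xs arbitrary: P c)
  case Nil
  then interpret P: primeideal "P 0" "monoid_ring \<Gamma>" by simp
  obtain k where k: "c = single 0 k" "k \<noteq> 0" using Nil by auto
  have "single 0 (1 / k) * c \<in> P 0"
    using P.I_l_closed[OF Nil.prems(5), of "single 0 (1 / k)"] \<Gamma>
    by (auto simp: submonoid_def)
  then have "1 \<in> P 0" using k by (simp add: mult_single)
  then show False using P.I_notcarr P.one_imp_carrier by simp
next
  case (Cons x xs)
  interpret P: primeideal "P 0" "monoid_ring \<Gamma>" using Cons.prems(1)[of 0] by simp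
  interpret Q: primeideal "P 1" "monoid_ring \<Gamma>" using Cons.prems(1)[of 1] by simp
  have P01: "P 0 \<subset> P 1" using Cons.prems(2)[of 0] by simp
  obtain m c' a where c: "c = x ^ m * (c' + a * x)" "c' \<in> collapse {p. keys p \<subseteq> \<Gamma>} xs" "keys a \<subseteq> \<Gamma>"
    using Cons.prems(4) by auto
  have carr: "keys y \<subseteq> \<Gamma>" if "y \<in> set (x # xs)" for y
  proof -
    obtain i where i: "i < length (x # xs)" "y = (x # xs) ! i"
      using \<open>y \<in> set (x # xs)\<close> by (metis in_set_conv_nth)
    then have "y \<in> P (Suc i)" using Cons.prems(3) by auto
    moreover have "ideal (P (Suc i)) (monoid_ring \<Gamma>)"
      using Cons.prems(1)[of "Suc i"] i by (simp add: primeideal.axioms(1))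
    ultimately show ?thesis using ideal.Icarr by fastforce
  qed
  have x: "x \<in> P 1" "x \<notin> P 0" "keys x \<subseteq> \<Gamma>" using Cons.prems(3)[of 0] carr by auto
  have c': "keys c' \<subseteq> \<Gamma>" using collapse_subset[OF \<Gamma> c(2)] carr by auto
  have "c' + a * x \<in> P 0"
    using Cons.prems(5) unfolding c(1)
  proof (induction m)
    case 0 then show ?case by simp
  next
    case (Suc m)
    have "keys (x ^ m * (c' + a * x)) \<subseteq> \<Gamma>"
      using x c' c(3) \<Gamma> by (intro keys_mult_submonoid keys_power_submonoid keys_add_subset)
    then have "x ^ m * (c' + a * x) \<in> P 0"
      using P.I_prime[of x "x ^ m * (c' + a * x)"] x Suc.prems by (auto simp: mult.assoc)
    then show ?case by (rule Suc.IH)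
  qed
  then have 1: "c' + a * x \<in> P 1" using P01 by blast
  have 2: "a * x \<in> P 1" using Q.I_l_closed[of x a] x c(3) by simp
  have "c' \<in> P 1"
  proof -
    have "single 0 (- 1) * (a * x) \<in> P 1"
      using Q.I_l_closed[OF 2, of "single 0 (- 1)"] \<Gamma> by (auto simp: submonoid_def)
    then have "(c' + a * x) + single 0 (- 1) * (a * x) \<in> P 1"
      using additive_subgroup.a_closed[OF Q.is_additive_subgroup 1] by simp
    then show ?thesis by (simp add: single_uminus)
  qed
  show False
  proof (rule Cons.IH[of "\<lambda>i. P (Suc i)" c'])
    show "c' \<in> P (Suc 0)" using \<open>c' \<in> P 1\<close> by simp
    show "c' \<in> collapse {p. keys p \<subseteq> \<Gamma>} xs" by (rule c(2))
    show "primeideal (P (Suc i)) (monoid_ring \<Gamma>)" if "i \<le> length xs" for i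
      using Cons.prems(1)[of "Suc i"] that by simp
    show "P (Suc i) \<subset> P (Suc (Suc i))" "xs ! i \<in> P (Suc (Suc i)) - P (Suc i)" if "i < length xs" for i
      using Cons.prems(2)[of "Suc i"] Cons.prems(3)[of "Suc i"] that by simp_all
  qed
qed

primrec power_product :: "'r::comm_monoid_mult list \<Rightarrow> nat list \<Rightarrow> 'r" where
  "power_product [] as = 1"
| "power_product (x # xs) as = x ^ hd as * power_product xs (tl as)"

lemma keys_power_product:
  assumes "submonoid \<Gamma>" "\<forall>x\<in>set xs. keys x \<subseteq> \<Gamma>"
  shows "keys (power_product xs as) \<subseteq> \<Gamma>"
  using assms(2)
proof (induction xs arbitrary: as)
  case Nil then show ?case using assms by (auto simp: submonoid_def)
next
  case (Cons x xs)
  then show ?case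
    by (simp add: keys_mult_submonoid[OF assms(1)] keys_power_submonoid[OF assms(1)])
qed

text \<open>
  A polynomial expression with a nonzero coefficient is rewritten along its lexicographically
  smallest term: the lowest power of the first element is factored out, the terms in which this power
  is exact are an expression in the remaining elements, and the others keep a factor \<open>x\<close>.
\<close>
lemma relation_in_collapse:
  fixes c :: "nat list \<Rightarrow> 'k::field"
  assumes \<Gamma>: "submonoid \<Gamma>" and "\<forall>x\<in>set xs. keys x \<subseteq> \<Gamma>"
    and "finite E" "\<forall>as\<in>E. length as = length xs" "as0 \<in> E" "c as0 \<noteq> 0"
  shows "(\<Sum>as\<in>E. single 0 (c as) * power_product xs as) \<in> collapse {p. keys p \<subseteq> \<Gamma>} xs"
  using assms(2-)
proof (induction xs arbitrary: E c as0)
  case Nil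
  then have "E = {[]}" by auto
  then show ?case using Nil by auto
next
  case (Cons x xs)
  define E' where "E' = {as\<in>E. c as \<noteq> 0}"
  \<comment> \<open>the lowest exponent of the first element in a term that occurs\<close>
  define m where "m = Min (hd ` E')"
  have E': "finite E'" "as0 \<in> E'" using Cons.prems by (auto simp: E'_def)
  have len: "length as = Suc (length xs)" if "as \<in> E'" for as
    using that Cons.prems by (auto simp: E'_def)
  have m_le: "m \<le> hd as" if "as \<in> E'" for as
    using that E' by (auto simp: m_def)
  have "m \<in> hd ` E'" unfolding m_def using E' by (intro Min_in) auto
  then obtain as1 where as1: "as1 \<in> E'" "hd as1 = m" by auto
  define E1 where "E1 = {as\<in>E'. hd as = m}"
  define E2 where "E2 = {as\<in>E'. hd as \<noteq> m}"
  let ?t = "\<lambda>as. single 0 (c as) * power_product (x # xs) as"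
  have inj: "inj_on tl E1"
  proof (rule inj_onI)
    fix as bs assume "as \<in> E1" "bs \<in> E1" "tl as = tl bs"
    then show "as = bs" using len[of as] len[of bs]
      by (cases as; cases bs) (auto simp: E1_def)
  qed
  have cons_tl: "m # tl as = as" if "as \<in> E1" for as
    using that len[of as] by (cases as) (auto simp: E1_def)
  let ?c1 = "(\<Sum>bs\<in>tl ` E1. single 0 (c (m # bs)) * power_product xs bs)"
  let ?a = "(\<Sum>as\<in>E2. single 0 (c as) * (x ^ (hd as - m - 1) * power_product xs (tl as)))"
  have "(\<Sum>as\<in>E. ?t as) = (\<Sum>as\<in>E'. ?t as)"
    using Cons.prems by (intro sum.mono_neutral_right) (auto simp: E'_def)
  also have "\<dots> = (\<Sum>as\<in>E1. ?t as) + (\<Sum>as\<in>E2. ?t as)"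
    using E' by (subst sum.union_disjoint[symmetric]) (auto simp: E1_def E2_def intro!: sum.cong)
  also have "(\<Sum>as\<in>E1. ?t as) = x ^ m * ?c1"
    using inj by (auto simp: sum.reindex sum_distrib_left cons_tl E1_def mult_ac intro!: sum.cong)
  also have "(\<Sum>as\<in>E2. ?t as) = x ^ m * (?a * x)"
  proof -
    have "?t as = x ^ m * (single 0 (c as) * (x ^ (hd as - m - 1) * power_product xs (tl as)) * x)"
      if "as \<in> E2" for as
    proof -
      have "m < hd as" using m_le[of as] that by (auto simp: E2_def)
      then have "hd as = m + (hd as - m - 1) + 1" by simp
      then have "x ^ hd as = x ^ m * x ^ (hd as - m - 1) * x"
        by (metis power_add power_one_right)
      then show ?thesis by (simp add: mult_ac)
    qed
    then show ?thesis by (simp add: sum_distrib_left sum_distrib_right)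
  qed
  finally have "(\<Sum>as\<in>E. ?t as) = x ^ m * (?c1 + ?a * x)"
    by (simp add: distrib_left)
  moreover have "?c1 \<in> collapse {p. keys p \<subseteq> \<Gamma>} xs"
  proof (rule Cons.IH)
    show "tl as1 \<in> tl ` E1" "c (m # tl as1) \<noteq> 0"
      using as1 cons_tl[of as1] by (auto simp: E1_def E'_def)
    show "finite (tl ` E1)" "\<forall>as\<in>tl ` E1. length as = length xs" "\<forall>x\<in>set xs. keys x \<subseteq> \<Gamma>"
      using E' len Cons.prems by (auto simp: E1_def)
  qed
  moreover have "keys ?a \<subseteq> \<Gamma>"
  proof (rule keys_sum_subset)
    fix as
    have "keys (single 0 (c as)) \<subseteq> \<Gamma>" using \<Gamma> by (auto simp: submonoid_def)
    then show "keys (single 0 (c as) * (x ^ (hd as - m - 1) * power_product xs (tl as))) \<subseteq> \<Gamma>"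
      using Cons.prems(1) \<Gamma>
      by (intro keys_mult_submonoid keys_power_submonoid keys_power_product) auto
  qed
  ultimately show ?case by auto
qed

lemma keys_weight_power_product:
  assumes wt: "wt 0 = (0::nat)" "\<And>a b. wt (a + b) = wt a + wt b"
    and "\<forall>x\<in>set xs. \<forall>t\<in>keys x. wt t \<le> D" "\<forall>a\<in>set as. a \<le> N" "length as = length xs"
    and "t \<in> keys (power_product xs as)"
  shows "wt t \<le> length xs * (N * D)"
  using assms(3-)
proof (induction xs arbitrary: as t)
  case Nil
  then show ?case by (simp add: wt)
next
  case (Cons x xs)
  obtain a as' where as: "as = a # as'" using Cons.prems by (cases as) auto
  have pow: "wt u \<le> n * D" if "u \<in> keys (x ^ n)" for u n
    using that
  proof (induction n arbitrary: u)
    case 0 then show ?case by (simp add: wt)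
  next
    case (Suc n)
    then obtain v w where "u = v + w" "v \<in> keys x" "w \<in> keys (x ^ n)"
      using keys_mult[of x "x ^ n"] by auto
    then show ?case using Suc.IH[of w] Cons.prems(1) by (auto simp: wt intro: add_mono)
  qed
  obtain v w where t: "t = v + w" "v \<in> keys (x ^ a)" "w \<in> keys (power_product xs as')"
    using Cons.prems(4) keys_mult[of "x ^ a" "power_product xs as'"] by (auto simp: as)
  have "wt v \<le> a * D" using pow t by blast
  also have "\<dots> \<le> N * D" using Cons.prems as by simp
  finally show ?case using Cons.IH[of as' w] Cons.prems t as by (auto simp: wt)
qed

text \<open>
  The power products of \<open>r + 1\<close> elements with exponents at most \<open>N\<close> are \<open>(N + 1)\<^bsup>r + 1\<^esup>\<close> in number,
  and lie in the span of \<open>O(N\<^sup>r)\<close> elements of \<open>\<Gamma>\<close>.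
\<close>
lemma algebraic_relation_of_growth:
  fixes \<Gamma> :: "'m::comm_monoid_add set" and xs :: "('m \<Rightarrow>\<^sub>0 'k::field) list"
  assumes \<Gamma>: "submonoid \<Gamma>" and wt: "wt 0 = (0::nat)" "\<And>a b. wt (a + b) = wt a + wt b"
    and growth: "\<And>L. finite {t\<in>\<Gamma>. wt t \<le> L}" "\<And>L. card {t\<in>\<Gamma>. wt t \<le> L} \<le> (C * (L + 1)) ^ r"
    and xs: "\<forall>x\<in>set xs. keys x \<subseteq> \<Gamma>" "length xs = Suc r"
  shows "0 \<in> collapse {p. keys p \<subseteq> \<Gamma>} xs"
proof -
  have "finite (wt ` (\<Union>x\<in>set xs. keys x))" by simp
  then obtain D where D: "\<forall>d\<in>wt ` (\<Union>x\<in>set xs. keys x). d \<le> D"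
    using finite_nat_set_iff_bounded_le by auto
  define Q where "Q = C * (Suc r * D + 1)"
  \<comment> \<open>Then \<open>(C(L + 1))\<^sup>r \<le> Q\<^sup>r(N + 1)\<^sup>r < (N + 1)\<^bsup>r + 1\<^esup>\<close>.\<close>
  define N where "N = Q ^ r"
  define L where "L = Suc r * (N * D)"
  define E where "E = {as. set as \<subseteq> {..N} \<and> length as = Suc r}"
  define B where "B = {t\<in>\<Gamma>. wt t \<le> L}"
  have E: "finite E" "card E = (N + 1) ^ Suc r"
    by (simp_all only: E_def finite_lists_length_eq finite_atMost card_lists_length_eq card_atMost Suc_eq_plus1)
  have "card B \<le> (C * (L + 1)) ^ r" unfolding B_def by (rule growth)
  also have "C * (L + 1) \<le> Q * (N + 1)"
    unfolding L_def Q_def by (simp add: algebra_simps)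
  then have "(C * (L + 1)) ^ r \<le> (Q * (N + 1)) ^ r" by (rule power_mono) simp
  also have "\<dots> = N * (N + 1) ^ r" by (simp only: power_mult_distrib N_def)
  also have "\<dots> < (N + 1) ^ Suc r" by simp
  finally have "card B < card E" using E by simp
  moreover have "finite B" unfolding B_def by (rule growth)
  ultimately obtain c where c: "\<exists>as\<in>E. c as \<noteq> 0"
      "\<forall>t\<in>B. (\<Sum>as\<in>E. c as * lookup (power_product xs as) t) = 0"
    using underdetermined_system[of B E "\<lambda>as t. lookup (power_product xs as) t"] E by blast
  then obtain as0 where "as0 \<in> E" "c as0 \<noteq> 0" by blast
  then have "(\<Sum>as\<in>E. single 0 (c as) * power_product xs as) \<in> collapse {p. keys p \<subseteq> \<Gamma>} xs"
    using E xs by (intro relation_in_collapse[OF \<Gamma>]) (auto simp: E_def)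
  moreover have "(\<Sum>as\<in>E. single 0 (c as) * power_product xs as) = 0"
  proof (rule poly_mapping_eqI)
    fix t
    have scale: "lookup (single 0 k * p) t = k * lookup p t" for k and p :: "'m \<Rightarrow>\<^sub>0 'k"
      by (simp add: mult_map_scale_conv_mult[symmetric] Poly_Mapping.map.rep_eq when_def)
    have *: "lookup (\<Sum>as\<in>E. single 0 (c as) * power_product xs as) t
        = (\<Sum>as\<in>E. c as * lookup (power_product xs as) t)"
      by (simp add: lookup_sum scale)
    show "lookup (\<Sum>as\<in>E. single 0 (c as) * power_product xs as) t = lookup 0 t"
    proof (cases "t \<in> B")
      case True then show ?thesis using c * by simp
    next
      case False
      have "lookup (power_product xs as) t = 0" if "as \<in> E" for as
      proof (rule ccontr)
        assume "lookup (power_product xs as) t \<noteq> 0"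
        then have t: "t \<in> keys (power_product xs as)" by (simp add: in_keys_iff)
        then have "t \<in> \<Gamma>" using keys_power_product[OF \<Gamma> xs(1)] by blast
        moreover have "wt t \<le> L"
          unfolding L_def xs(2)[symmetric]
        proof (rule keys_weight_power_product[OF wt _ _ _ t])
          show "\<forall>x\<in>set xs. \<forall>t\<in>keys x. wt t \<le> D" using D by auto
          show "\<forall>a\<in>set as. a \<le> N" "length as = length xs" using that xs by (auto simp: E_def)
        qed
        ultimately show False using False by (simp add: B_def)
      qed
      then show ?thesis unfolding * by simp
    qed
  qed
  ultimately show ?thesis by simp
qed

lemma krull_dim_le_of_growth:
  fixes \<Gamma> :: "'m::comm_monoid_add set"
  assumes \<Gamma>: "submonoid \<Gamma>" and wt: "wt 0 = (0::nat)" "\<And>a b. wt (a + b) = wt a + wt b"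
    and growth: "\<And>L. finite {t\<in>\<Gamma>. wt t \<le> L}" "\<And>L. card {t\<in>\<Gamma>. wt t \<le> L} \<le> (C * (L + 1)) ^ r"
  shows "krull_dim (monoid_ring \<Gamma> :: ('m \<Rightarrow>\<^sub>0 'k::field) ring) \<le> enat r"
  unfolding krull_dim_def
proof (rule Sup_least, clarify)
  fix n and P :: "nat \<Rightarrow> ('m \<Rightarrow>\<^sub>0 'k) set"
  assume P: "\<forall>i\<le>n. primeideal (P i) (monoid_ring \<Gamma>)" "\<forall>i<n. P i \<subset> P (Suc i)"
  show "enat n \<le> enat r"
  proof (rule ccontr)
    assume "\<not> enat n \<le> enat r"
    then have n: "Suc r \<le> n" by simp
    define xs where "xs = map (\<lambda>i. SOME x. x \<in> P (Suc i) - P i) [0..<Suc r]"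
    have xs: "xs ! i \<in> P (Suc i) - P i" if "i < Suc r" for i
    proof -
      have "P i \<subset> P (Suc i)" using P n that by auto
      then have "\<exists>x. x \<in> P (Suc i) - P i" by blast
      then have "(SOME x. x \<in> P (Suc i) - P i) \<in> P (Suc i) - P i" by (rule someI_ex)
      moreover have "xs ! i = (SOME x. x \<in> P (Suc i) - P i)"
        using that unfolding xs_def by (subst nth_map) (simp_all del: upt_Suc)
      ultimately show ?thesis by metis
    qed
    have len: "length xs = Suc r" by (simp add: xs_def)
    have carr: "\<forall>x\<in>set xs. keys x \<subseteq> \<Gamma>"
    proof
      fix x assume "x \<in> set xs"
      then obtain i where i: "i < Suc r" "x = xs ! i" using len by (metis in_set_conv_nth)
      have "ideal (P (Suc i)) (monoid_ring \<Gamma>)"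
        using P(1) n i by (simp add: primeideal.axioms(1))
      then show "keys x \<subseteq> \<Gamma>" using xs[OF i(1)] i(2) ideal.Icarr by fastforce
    qed
    have "0 \<in> collapse {p. keys p \<subseteq> \<Gamma>} xs"
      by (rule algebraic_relation_of_growth[OF \<Gamma> wt growth carr len])
    moreover have "0 \<in> P 0"
    proof -
      have "additive_subgroup (P 0) (monoid_ring \<Gamma>)"
        using P(1) by (simp add: primeideal.axioms(1) ideal.axioms(1))
      then show ?thesis using additive_subgroup.zero_closed by fastforce
    qed
    ultimately show False
      using P n xs by (intro collapse_not_in_prime_chain[OF \<Gamma>, of xs P 0]) (auto simp: len)
  qed
qed

section \<open>Monomial ideals and their minimal numbers of generators\<close>

lemma split_off_variable:
  assumes "x \<in> keys t"
  shows "t = single x 1 + (t - single x (1::nat))"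
  using assms
  by (intro poly_mapping_eqI) (auto simp: lookup_add lookup_minus lookup_single when_def in_keys_iff)

lemma keys_nat_add: "keys (a + b :: 'x \<Rightarrow>\<^sub>0 nat) = keys a \<union> keys b"
  by (auto simp: in_keys_iff lookup_add)

text \<open>
  The ideal generated by the monomials with exponents in \<open>A\<close>, described through the monomials that
  occur in its elements.
\<close>
definition monomial_ideal :: "'x set \<Rightarrow> ('x \<Rightarrow>\<^sub>0 nat) set \<Rightarrow> ('x, 'k::field) mpoly set" where
  "monomial_ideal X A = {p. \<forall>t\<in>keys p. keys t \<subseteq> X \<and> (\<exists>a\<in>A. \<exists>u. t = a + u)}"

lemma mpoly_ring_simps [simp]:
  "carrier (mpoly_ring X) = {p. \<forall>t\<in>keys p. keys t \<subseteq> X}"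
  "x \<otimes>\<^bsub>mpoly_ring X\<^esub> y = x * y" "\<one>\<^bsub>mpoly_ring X\<^esub> = 1"
  "\<zero>\<^bsub>mpoly_ring X\<^esub> = 0" "x \<oplus>\<^bsub>mpoly_ring X\<^esub> y = x + y"
  by (simp_all add: mpoly_ring_def)

lemma cring_mpoly_ring: "cring (mpoly_ring X)"
  unfolding mpoly_ring_eq_monoid_ring by (rule cring_monoid_ring[OF submonoid_vars])

lemma a_inv_mpoly_ring:
  assumes "x \<in> carrier (mpoly_ring X)"
  shows "\<ominus>\<^bsub>mpoly_ring X\<^esub> x = - x"
proof -
  interpret cring "mpoly_ring X" by (rule cring_mpoly_ring)
  show ?thesis
    using assms by (intro minus_equality[of "- x" x]) (auto simp: keys_uminus)
qed

lemma ideal_monomial_ideal: "ideal (monomial_ideal X A :: ('x, 'k::field) mpoly set) (mpoly_ring X)"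
proof -
  let ?I = "monomial_ideal X A :: ('x, 'k) mpoly set" and ?R = "mpoly_ring X :: ('x, 'k) mpoly ring"
  interpret cring ?R by (rule cring_mpoly_ring)
  have mult: "x * a \<in> ?I"
    if a: "a \<in> ?I" and x: "x \<in> carrier ?R" for a x
    unfolding monomial_ideal_def
  proof (clarify)
    fix t assume "t \<in> keys (x * a)"
    then obtain v w where "t = v + w" "v \<in> keys x" "w \<in> keys a" using keys_mult[of x a] by blast
    moreover from this obtain b u where "b \<in> A" "w = b + u" "keys w \<subseteq> X"
      using a by (force simp: monomial_ideal_def)
    ultimately show "keys t \<subseteq> X \<and> (\<exists>a\<in>A. \<exists>u. t = a + u)"
      using x by (auto simp: keys_nat_add intro!: bexI[of _ b] exI[of _ "v + u"] simp: add_ac)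
  qed
  show ?thesis
  proof (rule idealI)
    show "ring ?R" by (rule ring_axioms)
    show "subgroup ?I (add_monoid ?R)"
    proof (rule add.subgroupI)
      show sub: "?I \<subseteq> carrier ?R"
        by (auto simp: monomial_ideal_def)
      have "0 \<in> ?I" by (simp add: monomial_ideal_def)
      then show "?I \<noteq> {}" by blast
      show "\<ominus>\<^bsub>?R\<^esub> a \<in> ?I" if "a \<in> ?I" for a
        using that a_inv_mpoly_ring[OF subsetD[OF sub that]]
        by (simp only: monomial_ideal_def keys_uminus mem_Collect_eq)
      show "a \<oplus>\<^bsub>?R\<^esub> b \<in> ?I"
        if "a \<in> ?I" "b \<in> ?I" for a b
        using that keys_add[of a b] by (auto simp: monomial_ideal_def)
    qed
  qed (use mult in \<open>auto simp: mult.commute\<close>)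
qed

lemma genideal_monomials:
  fixes X :: "'x set"
  assumes "A \<subseteq> {t. keys t \<subseteq> X}"
  shows "genideal (mpoly_ring X) ((\<lambda>a. single a (1::'k::field)) ` A) = monomial_ideal X A"
proof
  interpret cring "mpoly_ring X :: ('x, 'k) mpoly ring" by (rule cring_mpoly_ring)
  let ?G = "(\<lambda>a. single a (1::'k)) ` A"
  have G: "?G \<subseteq> carrier (mpoly_ring X)" using assms by auto
  show "genideal (mpoly_ring X) ?G \<subseteq> monomial_ideal X A"
    using assms
    by (intro genideal_minimal ideal_monomial_ideal)
      (force simp: monomial_ideal_def intro: exI[of _ 0])
  interpret I: ideal "genideal (mpoly_ring X) ?G" "mpoly_ring X" by (rule genideal_ideal[OF G])
  show "monomial_ideal X A \<subseteq> genideal (mpoly_ring X) ?G"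
  proof
    fix p :: "('x, 'k) mpoly" assume p: "p \<in> monomial_ideal X A"
    have "single t (lookup p t) \<in> genideal (mpoly_ring X) ?G" if t: "t \<in> keys p" for t
    proof -
      obtain a u where a: "a \<in> A" "t = a + u" "keys t \<subseteq> X"
        using p t by (force simp: monomial_ideal_def)
      have "single a 1 \<in> genideal (mpoly_ring X) ?G" using genideal_self[OF G] a by blast
      then have "single u (lookup p t) * single a 1 \<in> genideal (mpoly_ring X) ?G"
        using I.I_l_closed[of "single a 1" "single u (lookup p t)"] a by (auto simp: keys_nat_add)
      then show ?thesis by (simp add: mult_single a add.commute)
    qed
    then have "(\<Sum>t\<in>keys p. single t (lookup p t)) \<in> genideal (mpoly_ring X) ?G"
      using I.ideal_axioms unfolding mpoly_ring_eq_monoid_ring by (rule_tac additive_sum_closed)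
    then show "p \<in> genideal (mpoly_ring X) ?G"
      using poly_mapping_sum_single[of p "keys p"] by simp
  qed
qed

lemma ideal_prod_monomial_ideal:
  fixes X :: "'x set"
  assumes "A \<subseteq> {t. keys t \<subseteq> X}" "B \<subseteq> {t. keys t \<subseteq> X}"
  shows "ideal_prod (mpoly_ring X) (monomial_ideal X A) (monomial_ideal X B)
    = (monomial_ideal X {a + b | a b. a \<in> A \<and> b \<in> B} :: ('x, 'k::field) mpoly set)"
    (is "?L = monomial_ideal X ?AB")
proof
  interpret cring "mpoly_ring X :: ('x, 'k) mpoly ring" by (rule cring_mpoly_ring)
  interpret M: ideal "monomial_ideal X ?AB :: ('x, 'k) mpoly set" "mpoly_ring X"
    by (rule ideal_monomial_ideal)
  show "?L \<subseteq> monomial_ideal X ?AB"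
  proof
    fix p assume "p \<in> ?L"
    then show "p \<in> monomial_ideal X ?AB"
    proof induction
      case (prod i j)
      show ?case
        unfolding monomial_ideal_def
      proof (clarify)
        fix t assume "t \<in> keys (i \<otimes>\<^bsub>mpoly_ring X\<^esub> j)"
        then obtain v w where t: "t = v + w" "v \<in> keys i" "w \<in> keys j"
          using keys_mult[of i j] by auto
        obtain a u where a: "a \<in> A" "v = a + u" "keys v \<subseteq> X"
          using prod t by (force simp: monomial_ideal_def)
        obtain b u' where b: "b \<in> B" "w = b + u'" "keys w \<subseteq> X"
          using prod t by (force simp: monomial_ideal_def)
        have "t = (a + b) + (u + u')" using a b t by (simp add: add_ac)
        moreover have "a + b \<in> ?AB" using a b by blast
        moreover have "keys t \<subseteq> X" using a b t by (simp add: keys_nat_add)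
        ultimately show "keys t \<subseteq> X \<and> (\<exists>a\<in>?AB. \<exists>u. t = a + u)" by blast
      qed
    next
      case (sum s1 s2)
      then show ?case using additive_subgroup.a_closed[OF M.is_additive_subgroup] by blast
    qed
  qed
  have I: "ideal ?L (mpoly_ring X)"
    by (intro ideal_prod_is_ideal ideal_monomial_ideal)
  have "(\<lambda>t. single t 1) ` ?AB \<subseteq> ?L"
  proof clarify
    fix a b assume "a \<in> A" "b \<in> B"
    then have "single a 1 \<in> monomial_ideal X A" "single b 1 \<in> monomial_ideal X B"
      using assms by (force simp: monomial_ideal_def intro: exI[of _ 0])+
    from ideal_prod.prod[OF this, of "mpoly_ring X"]
    show "single (a + b) 1 \<in> ?L" by (simp add: mult_single)
  qed
  from genideal_minimal[OF I this]
  show "monomial_ideal X ?AB \<subseteq> ?L"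
    using assms by (subst (asm) genideal_monomials) (fastforce simp: keys_nat_add)+
qed

primrec fold_sums :: "'m::comm_monoid_add set \<Rightarrow> nat \<Rightarrow> 'm set" where
  "fold_sums S 0 = {0}"
| "fold_sums S (Suc k) = {w + s | w s. w \<in> fold_sums S k \<and> s \<in> S}"

lemma fold_sums_2: "fold_sums S 2 = {s + t | s t. s \<in> S \<and> t \<in> S}"
  by (auto simp: numeral_2_eq_2)

lemma fold_sums_vars:
  "S \<subseteq> {t :: 'x \<Rightarrow>\<^sub>0 nat. keys t \<subseteq> X} \<Longrightarrow> fold_sums S k \<subseteq> {t. keys t \<subseteq> X}"
proof (induction k)
  case (Suc k)
  then show ?case by (fastforce simp: keys_nat_add)
qed simp

lemma fold_sums_add:
  "v \<in> fold_sums S i \<Longrightarrow> w \<in> fold_sums S j \<Longrightarrow> v + w \<in> fold_sums S (i + j)"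
proof (induction j arbitrary: w)
  case (Suc j)
  then obtain w' s where w: "w = w' + s" "w' \<in> fold_sums S j" "s \<in> S" by auto
  then have "v + w' \<in> fold_sums S (i + j)" using Suc by blast
  then show ?case using w by (auto simp: add.assoc[symmetric])
qed auto

lemma finite_fold_sums: "finite S \<Longrightarrow> finite (fold_sums S k)"
  by (induction k) (auto intro: finite_image_set2)

lemma ideal_power_monomial_ideal:
  assumes "S \<subseteq> {t. keys t \<subseteq> X}"
  shows "ideal_power (mpoly_ring X) (monomial_ideal X S) k = monomial_ideal X (fold_sums S k)"
  by (induction k)
    (auto simp: ideal_prod_monomial_ideal fold_sums_vars assms, auto simp: monomial_ideal_def)

lemma var_ideal_eq: "var_ideal X = monomial_ideal X ((\<lambda>x. single x 1) ` X)"
  unfolding var_ideal_def poly_var_def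
  using genideal_monomials[of "(\<lambda>x. single x 1) ` X" X] by (simp add: image_image image_subset_iff)

definition weight :: "'x set \<Rightarrow> ('x \<Rightarrow>\<^sub>0 nat) \<Rightarrow> nat" where
  "weight X t = (\<Sum>x\<in>X. lookup t x)"

lemma weight_0 [simp]: "weight X 0 = 0" and weight_add: "weight X (s + t) = weight X s + weight X t"
  by (simp_all add: weight_def lookup_add sum.distrib)

lemma weight_single: "finite X \<Longrightarrow> x \<in> X \<Longrightarrow> weight X (single x n) = n"
  by (simp add: weight_def lookup_single when_def)

lemma weight_eq_0: "finite X \<Longrightarrow> keys t \<subseteq> X \<Longrightarrow> weight X t = 0 \<Longrightarrow> t = 0"
  by (rule poly_mapping_eqI) (auto simp: weight_def in_keys_iff)

lemma weight_fold_sums: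
  "(\<And>s. s \<in> S \<Longrightarrow> weight X s = d) \<Longrightarrow> w \<in> fold_sums S k \<Longrightarrow> weight X w = k * d"
  by (induction k arbitrary: w) (auto simp: weight_add)

lemma lookup_single_0_mult:
  "lookup (single 0 c * p :: 'm::monoid_add \<Rightarrow>\<^sub>0 'k::semiring_0) t = c * lookup p t"
  by (simp add: mult_map_scale_conv_mult[symmetric] Poly_Mapping.map.rep_eq when_def)

text \<open>
  In lowest degree, multiplication by a polynomial is multiplication by its constant term.
\<close>
lemma lookup_mult_lowest_weight:
  fixes p q :: "('x, 'k::field) mpoly"
  assumes X: "finite X" and p: "\<forall>t\<in>keys p. keys t \<subseteq> X"
    and q: "\<forall>t\<in>keys q. keys t \<subseteq> X \<and> d \<le> weight X t" and t: "weight X t = d"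
  shows "lookup (p * q) t = lookup p 0 * lookup q t"
proof -
  define r where "r = p - single 0 (lookup p 0)"
  have r: "r = p - single 0 (lookup p 0)" by (simp add: r_def)
  have "t \<notin> keys (r * q)"
  proof
    assume "t \<in> keys (r * q)"
    then obtain v w where v: "t = v + w" "v \<in> keys r" "w \<in> keys q" using keys_mult[of r q] by blast
    then have "weight X v = 0" using q t by (auto simp: weight_add)
    moreover have "v \<noteq> 0" "v \<in> keys p"
      using v(2) by (auto simp: r in_keys_iff lookup_minus lookup_single when_def split: if_splits)
    ultimately show False using weight_eq_0[OF X, of v] p by blast
  qed
  moreover have "p * q = single 0 (lookup p 0) * q + r * q"
    by (simp add: r algebra_simps)
  ultimately show ?thesis by (simp add: lookup_add lookup_single_0_mult in_keys_iff)
qed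

text \<open>
  The components of degree \<open>d\<close> of any generators span the component of degree \<open>d\<close> of the ideal,
  and the monomials of \<open>A\<close> are linearly independent in it.
\<close>
theorem min_gens_monomial_ideal:
  fixes A :: "('x \<Rightarrow>\<^sub>0 nat) set"
  assumes X: "finite X" and A: "finite A" "A \<subseteq> {t. keys t \<subseteq> X}" and d: "\<And>a. a \<in> A \<Longrightarrow> weight X a = d"
  shows "min_gens (mpoly_ring X) (monomial_ideal X A :: ('x, 'k::field) mpoly set) = card A"
  unfolding min_gens_def
proof (rule Least_equality)
  let ?G = "(\<lambda>a. single a (1::'k)) ` A"
  have "card ?G = card A" 
    by (rule card_image, rule inj_onI, drule arg_cong[where f = keys]) simp
  then show "\<exists>G. G \<subseteq> carrier (mpoly_ring X) \<and> finite G \<and> card G = card A \<and>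
      genideal (mpoly_ring X) G = (monomial_ideal X A :: ('x, 'k) mpoly set)"
    using A by (intro exI[of _ ?G]) (auto simp: genideal_monomials)
next
  fix n assume "\<exists>G. G \<subseteq> carrier (mpoly_ring X) \<and> finite G \<and> card G = n \<and>
      genideal (mpoly_ring X) G = (monomial_ideal X A :: ('x, 'k) mpoly set)"
  then obtain G :: "('x, 'k) mpoly set" where G: "G \<subseteq> carrier (mpoly_ring X)" "finite G" "card G = n"
    "genideal (mpoly_ring X) G = monomial_ideal X A" by blast
  interpret cring "mpoly_ring X :: ('x, 'k) mpoly ring" by (rule cring_mpoly_ring)
  \<comment> \<open>the polynomials without terms of degree below \<open>d\<close> whose component of degree \<open>d\<close> is in the span of those of \<open>G\<close>\<close>
  define J :: "('x, 'k) mpoly set" where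
    "J = {p. (\<forall>t\<in>keys p. keys t \<subseteq> X \<and> d \<le> weight X t) \<and>
             (\<exists>c. \<forall>t. weight X t = d \<longrightarrow> lookup p t = (\<Sum>g\<in>G. c g * lookup g t))}"
  have sub: "J \<subseteq> carrier (mpoly_ring X)" by (auto simp: J_def)
  have mult: "x * p \<in> J" if p: "p \<in> J" and x: "x \<in> carrier (mpoly_ring X)" for x p
  proof -
    have x': "\<forall>t\<in>keys x. keys t \<subseteq> X" using x by simp
    have p': "\<forall>t\<in>keys p. keys t \<subseteq> X \<and> d \<le> weight X t" using p by (simp add: J_def)
    obtain c where c: "\<And>t. weight X t = d \<Longrightarrow> lookup p t = (\<Sum>g\<in>G. c g * lookup g t)"
      using p by (auto simp: J_def)
    have "lookup (x * p) t = (\<Sum>g\<in>G. (lookup x 0 * c g) * lookup g t)" if "weight X t = d" for t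
      using lookup_mult_lowest_weight[OF X x' p' that] c[OF that]
      by (simp add: sum_distrib_left mult.assoc)
    moreover have "keys t \<subseteq> X \<and> d \<le> weight X t" if "t \<in> keys (x * p)" for t
    proof -
      obtain v w where "t = v + w" "v \<in> keys x" "w \<in> keys p"
        using keys_mult[of x p] \<open>t \<in> keys (x * p)\<close> by blast
      then show ?thesis using x' p' by (auto simp: keys_nat_add weight_add intro: trans_le_add2)
    qed
    ultimately show ?thesis
      unfolding J_def by (intro CollectI conjI exI[of _ "\<lambda>g. lookup x 0 * c g"]) auto
  qed
  have "ideal J (mpoly_ring X)"
  proof (rule idealI)
    show "ring (mpoly_ring X :: ('x, 'k) mpoly ring)" by (rule ring_axioms)
    show "subgroup J (add_monoid (mpoly_ring X))"
    proof (rule add.subgroupI)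
      show "J \<subseteq> carrier (mpoly_ring X)" by (rule sub)
      have "0 \<in> J" by (auto simp: J_def intro: exI[of _ "\<lambda>_. 0"])
      then show "J \<noteq> {}" by blast
      show "\<ominus>\<^bsub>mpoly_ring X\<^esub> a \<in> J" if "a \<in> J" for a
      proof -
        have "single 0 (- 1) * a \<in> J" by (rule mult[OF that]) auto
        then show ?thesis
          using a_inv_mpoly_ring[OF subsetD[OF sub that]] by (simp add: single_uminus)
      qed
      show "a \<oplus>\<^bsub>mpoly_ring X\<^esub> b \<in> J" if ab: "a \<in> J" "b \<in> J" for a b
      proof -
        obtain c c' where "\<And>t. weight X t = d \<Longrightarrow> lookup a t = (\<Sum>g\<in>G. c g * lookup g t)"
           "\<And>t. weight X t = d \<Longrightarrow> lookup b t = (\<Sum>g\<in>G. c' g * lookup g t)"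
          using ab by (auto simp: J_def)
        then have "\<forall>t. weight X t = d \<longrightarrow> lookup (a + b) t = (\<Sum>g\<in>G. (c g + c' g) * lookup g t)"
          by (simp add: lookup_add sum.distrib distrib_right)
        then have "\<exists>c. \<forall>t. weight X t = d \<longrightarrow> lookup (a + b) t = (\<Sum>g\<in>G. c g * lookup g t)"
          by (intro exI[of _ "\<lambda>g. c g + c' g"])
        moreover have "\<forall>t\<in>keys (a + b). keys t \<subseteq> X \<and> d \<le> weight X t"
          using ab keys_add[of a b] unfolding J_def by blast
        ultimately show ?thesis by (simp add: J_def)
      qed
    qed
  qed (use mult in \<open>auto simp: mult.commute\<close>)
  moreover have "G \<subseteq> J"
  proof
    fix g assume g: "g \<in> G"
    have "g \<in> monomial_ideal X A" using genideal_self[OF G(1)] g G(4) by blast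
    then have "\<forall>t\<in>keys g. keys t \<subseteq> X \<and> d \<le> weight X t"
      using d by (force simp: monomial_ideal_def weight_add)
    moreover have "lookup g t = (\<Sum>h\<in>G. (if h = g then 1 else 0) * lookup h t)" for t
      using g G(2) by (simp add: if_distrib[of "\<lambda>x. x * _"] cong: if_cong)
    ultimately show "g \<in> J"
      unfolding J_def by (intro CollectI conjI exI[of _ "\<lambda>h. if h = g then 1 else 0"]) auto
  qed
  ultimately have JA: "monomial_ideal X A \<subseteq> J"
    using genideal_minimal[of J G] G(4) by simp
  have "\<exists>c. \<forall>t. weight X t = d \<longrightarrow> lookup (single a (1::'k)) t = (\<Sum>g\<in>G. c g * lookup g t)" if "a \<in> A" for a
  proof -
    have "single a 1 \<in> (monomial_ideal X A :: ('x, 'k) mpoly set)"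
      using that A by (force simp: monomial_ideal_def intro: exI[of _ 0])
    then show ?thesis using JA by (auto simp: J_def)
  qed
  then obtain c where c: "\<And>a t. a \<in> A \<Longrightarrow> weight X t = d \<Longrightarrow>
      lookup (single a (1::'k)) t = (\<Sum>g\<in>G. c a g * lookup g t)" by metis
  show "card A \<le> n"
  proof (rule ccontr)
    assume "\<not> card A \<le> n"
    then obtain e where e: "\<exists>a\<in>A. e a \<noteq> 0" "\<forall>g\<in>G. (\<Sum>a\<in>A. e a * c a g) = 0"
      using underdetermined_system[of G A c] A G by auto
    then obtain a' where a': "a' \<in> A" "e a' \<noteq> 0" by blast
    have "e a' = (\<Sum>a\<in>A. e a * lookup (single a (1::'k)) a')"
      using a' A by (simp add: lookup_single when_def if_distrib[of "\<lambda>x. _ * x"] cong: if_cong)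
    also have "\<dots> = (\<Sum>a\<in>A. \<Sum>g\<in>G. e a * c a g * lookup g a')"
      using c d a' by (simp add: sum_distrib_left mult.assoc)
    also have "\<dots> = (\<Sum>g\<in>G. (\<Sum>a\<in>A. e a * c a g) * lookup g a')"
      by (subst sum.swap) (simp add: sum_distrib_right)
    also have "\<dots> = 0" using e by simp
    finally show False using a' by simp
  qed
qed

section \<open>The fiber cone as a monoid ring\<close>

text \<open>
  Monoid rings over \<open>nat \<times> 'm\<close> are graded by the first coordinate.
\<close>
definition component :: "nat \<Rightarrow> (nat \<times> 'm \<Rightarrow>\<^sub>0 'k::zero) \<Rightarrow> ('m \<Rightarrow>\<^sub>0 'k)" where
  "component k p = Poly_Mapping.map_key (Pair k) p"

lemma lookup_component [simp]: "lookup (component k p) t = lookup p (k, t)"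
  by (simp add: component_def Poly_Mapping.map_key.rep_eq inj_on_def)

lemma keys_component: "keys (component k p) = {t. (k, t) \<in> keys p}"
  by (auto simp: in_keys_iff)

lemma component_0 [simp]: "component k 0 = 0"
  by (rule poly_mapping_eqI) simp

lemma component_add: "component k (p + q) = component k p + component k q"
  by (rule poly_mapping_eqI) (simp add: lookup_add)

lemma component_sum: "component k (sum f A) = (\<Sum>a\<in>A. component k (f a))"
  by (rule poly_mapping_eqI) (simp add: lookup_sum)

lemma component_single: "component k (single a c) = (if fst a = k then single (snd a) c else 0)"
  by (rule poly_mapping_eqI) (auto simp: lookup_single when_def prod_eq_iff)

lemma component_eqI: "(\<And>k. component k p = component k q) \<Longrightarrow> p = q"
  by (rule poly_mapping_eqI) (metis lookup_component surj_pair)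

lemma component_mult:
  fixes p q :: "nat \<times> 'm::comm_monoid_add \<Rightarrow>\<^sub>0 'k::comm_semiring_1"
  shows "component k (p * q) = (\<Sum>i\<le>k. component i p * component (k - i) q)"
proof -
  let ?P = "\<lambda>a. single a (lookup p a)" and ?Q = "\<lambda>b. single b (lookup q b)"
  have single: "component k (?P a * ?Q b) = (\<Sum>i\<le>k. component i (?P a) * component (k - i) (?Q b))" for a b
  proof -
    have "(\<Sum>i\<le>k. component i (?P a) * component (k - i) (?Q b)) =
        (\<Sum>i\<le>k. if i = fst a then component (fst a) (?P a) * component (k - fst a) (?Q b) else 0)"
      by (intro sum.cong) (auto simp: component_single)
    also have "\<dots> = component k (?P a * ?Q b)"
      by (auto simp: component_single mult_single)
    finally show ?thesis by simp
  qed
  have p: "p = (\<Sum>a\<in>keys p. ?P a)" and q: "q = (\<Sum>b\<in>keys q. ?Q b)"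
    by (auto intro: poly_mapping_sum_single)
  have "component k (p * q) = component k ((\<Sum>a\<in>keys p. ?P a) * (\<Sum>b\<in>keys q. ?Q b))"
    using p q by simp
  also have "\<dots> = (\<Sum>a\<in>keys p. \<Sum>b\<in>keys q. \<Sum>i\<le>k. component i (?P a) * component (k - i) (?Q b))"
    by (simp only: sum_product component_sum single)
  also have "\<dots> = (\<Sum>i\<le>k. \<Sum>a\<in>keys p. \<Sum>b\<in>keys q. component i (?P a) * component (k - i) (?Q b))"
    by (subst (2) sum.swap, subst sum.swap) simp
  also have "\<dots> = (\<Sum>i\<le>k. component i (\<Sum>a\<in>keys p. ?P a) * component (k - i) (\<Sum>b\<in>keys q. ?Q b))"
    by (simp only: sum_product component_sum)
  also have "\<dots> = (\<Sum>i\<le>k. component i p * component (k - i) q)"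
    using p q by simp
  finally show ?thesis .
qed

definition in_degree :: "nat \<Rightarrow> ('m \<Rightarrow>\<^sub>0 'k::comm_monoid_add) \<Rightarrow> (nat \<times> 'm \<Rightarrow>\<^sub>0 'k)" where
  "in_degree k q = (\<Sum>t\<in>keys q. single (k, t) (lookup q t))"

lemma component_in_degree: "component j (in_degree k q) = (if j = k then q else 0)"
  unfolding in_degree_def component_sum component_single
  using poly_mapping_sum_single[of q "keys q"] by auto

lemma keys_in_degree: "keys (in_degree k q) \<subseteq> Pair k ` keys q"
  unfolding in_degree_def by (rule keys_sum_subset) (auto split: if_splits)

text \<open>
  The monoid of exponents of the toric ring. The number \<open>k\<close> of summands has to be recorded, since \<open>w\<close>
  does not determine it when \<open>S = {0}\<close>, that is, for a graph without edges.
\<close>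
definition power_monoid :: "'m::comm_monoid_add set \<Rightarrow> (nat \<times> 'm) set" where
  "power_monoid S = {(k, w). w \<in> fold_sums S k}"

lemma submonoid_power_monoid: "submonoid (power_monoid S)"
  by (auto simp: submonoid_def power_monoid_def zero_prod_def fold_sums_add)

lemma keys_component_power_monoid:
  "keys p \<subseteq> power_monoid S \<Longrightarrow> keys (component k p) \<subseteq> fold_sums S k"
  by (auto simp: keys_component power_monoid_def)

lemma a_minus_mpoly_ring:
  assumes "y \<in> carrier (mpoly_ring X)"
  shows "x \<ominus>\<^bsub>mpoly_ring X\<^esub> y = x - y"
  using a_inv_mpoly_ring[OF assms] by (simp add: a_minus_def)

lemma coset_eq_iff:
  assumes J: "ideal J (mpoly_ring X)" and a: "a \<in> carrier (mpoly_ring X)" and b: "b \<in> carrier (mpoly_ring X)"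
  shows "J +>\<^bsub>mpoly_ring X\<^esub> a = J +>\<^bsub>mpoly_ring X\<^esub> b \<longleftrightarrow> a - b \<in> J"
proof -
  interpret cring "mpoly_ring X" by (rule cring_mpoly_ring)
  show ?thesis
    using quotient_eq_iff_same_a_r_cos[OF J a b] a_minus_mpoly_ring[OF b] by simp
qed

lemma mem_coset_iff:
  "x \<in> J +>\<^bsub>mpoly_ring X\<^esub> a \<longleftrightarrow> (\<exists>j\<in>J. x = j + a)"
  by (auto simp: a_r_coset_def r_coset_def)

text \<open>
  In the fiber cone the two factors are cosets modulo different ideals, and their product is taken
  modulo a third one.
\<close>
lemma rcoset_mult_cosets:
  assumes K: "ideal K (mpoly_ring X)"
    and A: "ideal A (mpoly_ring X)" and B: "ideal B (mpoly_ring X)"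
    and a: "a \<in> carrier (mpoly_ring X)" and b: "b \<in> carrier (mpoly_ring X)"
    and AB: "\<And>x y. x \<in> A \<Longrightarrow> y \<in> B \<Longrightarrow> x * b \<in> K \<and> a * y \<in> K \<and> x * y \<in> K"
  shows "rcoset_mult (mpoly_ring X) K (A +>\<^bsub>mpoly_ring X\<^esub> a) (B +>\<^bsub>mpoly_ring X\<^esub> b)
    = K +>\<^bsub>mpoly_ring X\<^esub> (a * b)"
proof -
  interpret cring "mpoly_ring X" by (rule cring_mpoly_ring)
  interpret K: ideal K "mpoly_ring X" by (rule K)
  interpret A: ideal A "mpoly_ring X" by (rule A)
  interpret B: ideal B "mpoly_ring X" by (rule B)
  have *: "K +>\<^bsub>mpoly_ring X\<^esub> (a' * b') = K +>\<^bsub>mpoly_ring X\<^esub> (a * b)"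
    if a': "a' \<in> A +>\<^bsub>mpoly_ring X\<^esub> a" and b': "b' \<in> B +>\<^bsub>mpoly_ring X\<^esub> b" for a' b'
  proof -
    obtain x where x: "x \<in> A" "a' = x + a" using a' by (auto simp: mem_coset_iff)
    obtain y where y: "y \<in> B" "b' = y + b" using b' by (auto simp: mem_coset_iff)
    have "a' * b' - a * b = (x * y + x * b) + a * y" using x y by (simp add: algebra_simps)
    moreover have "(x * y + x * b) + a * y \<in> K"
      using AB[OF x(1) y(1)] additive_subgroup.a_closed[OF K.is_additive_subgroup] by simp
    moreover have "a' \<in> carrier (mpoly_ring X)" "b' \<in> carrier (mpoly_ring X)"
      using a_closed[OF A.Icarr[OF x(1)] a] a_closed[OF B.Icarr[OF y(1)] b] x y by simp_all
    ultimately show ?thesis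
      using m_closed[of a' b'] m_closed[OF a b] by (subst coset_eq_iff[OF K]) auto
  qed
  have "a \<in> A +>\<^bsub>mpoly_ring X\<^esub> a" "b \<in> B +>\<^bsub>mpoly_ring X\<^esub> b"
    using A.a_rcos_self[OF a] B.a_rcos_self[OF b] by auto
  then show ?thesis
    unfolding rcoset_mult_def monoid.simps mpoly_ring_simps using * by (intro equalityI) blast+
qed

lemma finsum_mpoly_ring:
  assumes "\<And>i. i \<in> A \<Longrightarrow> f i \<in> carrier (mpoly_ring X)" "finite A"
  shows "finsum (mpoly_ring X) f A = sum f A"
proof -
  interpret cring "mpoly_ring X" by (rule cring_mpoly_ring)
  show ?thesis using assms(2,1)
  proof (induction A rule: finite_induct)
    case empty then show ?case by simp
  next
    case (insert x F)
    then have "f \<in> F \<rightarrow> carrier (mpoly_ring X)" "f x \<in> carrier (mpoly_ring X)" by blast+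
    then have "finsum (mpoly_ring X) f (insert x F) = f x + finsum (mpoly_ring X) f F"
      using insert.hyps by (subst finsum_insert) auto
    moreover have "finsum (mpoly_ring X) f F = sum f F" by (rule insert.IH) (use insert.prems in blast)
    ultimately show ?case using insert.hyps by simp
  qed
qed

lemma finsum_cosets:
  assumes K: "ideal K (mpoly_ring X)" and "\<And>i. i \<in> A \<Longrightarrow> f i \<in> carrier (mpoly_ring X)" "finite A"
  shows "finsum (mpoly_ring X Quot K) (\<lambda>i. K +>\<^bsub>mpoly_ring X\<^esub> f i) A = K +>\<^bsub>mpoly_ring X\<^esub> sum f A"
proof -
  interpret H: ring_hom_cring "mpoly_ring X" "mpoly_ring X Quot K" "(+>\<^bsub>mpoly_ring X\<^esub>) K"
    by (rule ideal.rcos_ring_hom_cring[OF K cring_mpoly_ring])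
  have "f \<in> A \<rightarrow> carrier (mpoly_ring X)" using assms by blast
  from H.hom_finsum[OF this] show ?thesis
    using finsum_mpoly_ring[of A f X] assms by (simp add: o_def)
qed

type_synonym ('x, 'k) graded_mpoly = "nat \<times> ('x \<Rightarrow>\<^sub>0 nat) \<Rightarrow>\<^sub>0 'k"

locale equigenerated =
  fixes X :: "'x set" and S :: "('x \<Rightarrow>\<^sub>0 nat) set" and d :: nat
  assumes finite_X: "finite X" and finite_S: "finite S" and S_vars: "S \<subseteq> {t. keys t \<subseteq> X}"
    and weight_S: "\<And>s. s \<in> S \<Longrightarrow> weight X s = d"
begin

abbreviation power_ideal :: "nat \<Rightarrow> ('x, 'k::field) mpoly set" where
  "power_ideal k \<equiv> ideal_power (mpoly_ring X) (monomial_ideal X S) k"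

abbreviation m_power_ideal :: "nat \<Rightarrow> ('x, 'k::field) mpoly set" where
  "m_power_ideal k \<equiv> mI_power (mpoly_ring X) (var_ideal X) (monomial_ideal X S) k"

lemma power_ideal_eq: "power_ideal k = monomial_ideal X (fold_sums S k)"
  by (rule ideal_power_monomial_ideal[OF S_vars])

lemma m_power_ideal_eq:
  "m_power_ideal k = monomial_ideal X {a + w | a w. a \<in> (\<lambda>x. single x 1) ` X \<and> w \<in> fold_sums S k}"
  unfolding mI_power_def var_ideal_eq power_ideal_eq
  by (rule ideal_prod_monomial_ideal) (use fold_sums_vars[OF S_vars] in auto)

lemma mem_power_ideal:
  "a \<in> power_ideal k \<longleftrightarrow> (\<forall>t\<in>keys a. keys t \<subseteq> X \<and> (\<exists>w\<in>fold_sums S k. \<exists>u. t = w + u))"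
  unfolding power_ideal_eq unfolding monomial_ideal_def by simp

lemma mem_m_power_ideal:
  "a \<in> m_power_ideal k \<longleftrightarrow> (\<forall>t\<in>keys a. keys t \<subseteq> X \<and>
     (\<exists>x\<in>X. \<exists>w\<in>fold_sums S k. \<exists>u. t = single x 1 + w + u))"
proof -
  have "(\<exists>v\<in>{a + w | a w. a \<in> (\<lambda>x. single x 1) ` X \<and> w \<in> fold_sums S k}. \<exists>u. t = v + u) \<longleftrightarrow>
      (\<exists>x\<in>X. \<exists>w\<in>fold_sums S k. \<exists>u. t = single x 1 + w + u)" (is "?l \<longleftrightarrow> ?r") for t
  proof
    assume ?l then show ?r by clarify metis
  next
    assume ?r
    then obtain x w u where "x \<in> X" "w \<in> fold_sums S k" "t = single x 1 + w + u" by blast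
    then show ?l by (intro bexI[of _ "single x 1 + w"]) auto
  qed
  then show ?thesis unfolding m_power_ideal_eq unfolding monomial_ideal_def by simp
qed

lemma ideal_m_power_ideal: "ideal (m_power_ideal k) (mpoly_ring X)"
  unfolding m_power_ideal_eq by (rule ideal_monomial_ideal)

lemma power_ideal_carrier: "a \<in> power_ideal k \<Longrightarrow> a \<in> carrier (mpoly_ring X)"
  by (auto simp: mem_power_ideal)

lemma power_ideal_if_keys: "keys p \<subseteq> fold_sums S k \<Longrightarrow> p \<in> power_ideal k"
  unfolding mem_power_ideal
proof
  fix t assume "keys p \<subseteq> fold_sums S k" "t \<in> keys p"
  then have "t \<in> fold_sums S k" "t = t + 0" by auto
  then show "keys t \<subseteq> X \<and> (\<exists>w\<in>fold_sums S k. \<exists>u. t = w + u)"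
    using fold_sums_vars[OF S_vars, of k] by blast
qed

text \<open>
  Together with \<open>power_ideal_mod\<close> below, this says that \<open>I\<^sup>k\<close> is the direct sum of \<open>\<mm>I\<^sup>k\<close> and the span
  of the monomials of \<open>fold_sums S k\<close>. The sum is direct because those monomials have degree \<open>kd\<close>, and
  the ones of \<open>\<mm>I\<^sup>k\<close> have a larger degree.
\<close>
lemma m_power_ideal_0: "keys q \<subseteq> fold_sums S k \<Longrightarrow> q \<in> m_power_ideal k \<Longrightarrow> q = 0"
proof (rule ccontr)
  assume q: "keys q \<subseteq> fold_sums S k" "q \<in> m_power_ideal k" "q \<noteq> 0"
  then obtain t where t: "t \<in> keys q" by (metis keys_eq_empty ex_in_conv)
  then have "weight X t = k * d" using q(1) weight_fold_sums[OF weight_S] by blast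
  moreover obtain x w u where x: "x \<in> X" "w \<in> fold_sums S k" "t = single x 1 + w + u"
    using q(2) t by (force simp: mem_m_power_ideal)
  ultimately show False
    using weight_fold_sums[OF weight_S x(2)] by (simp add: weight_add weight_single[OF finite_X])
qed

lemma power_ideal_mod:
  assumes a: "a \<in> power_ideal k"
  shows "\<exists>b. keys b \<subseteq> fold_sums S k \<and> a - b \<in> m_power_ideal k"
proof -
  obtain b where b: "keys b \<subseteq> keys a \<inter> fold_sums S k" "keys (a - b) \<subseteq> keys a - fold_sums S k"
    using poly_mapping_split[of a "fold_sums S k"] by (elim exE conjE)
  have "a - b \<in> m_power_ideal k"
    unfolding mem_m_power_ideal
  proof
    fix t assume t: "t \<in> keys (a - b)"
    then obtain w u where w: "w \<in> fold_sums S k" "t = w + u" "keys t \<subseteq> X"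
      using a b(2) unfolding mem_power_ideal by blast
    have "u \<noteq> 0" using t b(2) w by auto
    then obtain x where x: "x \<in> keys u" by (metis keys_eq_empty ex_in_conv)
    have "u = single x 1 + (u - single x 1)" by (rule split_off_variable[OF x])
    then have "t = single x 1 + w + (u - single x 1)" using w by (metis add.assoc add.commute)
    moreover have "x \<in> X" using w x by (auto simp: keys_nat_add)
    ultimately show "keys t \<subseteq> X \<and> (\<exists>x\<in>X. \<exists>w\<in>fold_sums S k. \<exists>u. t = single x 1 + w + u)"
      using w by blast
  qed
  then show ?thesis using b(1) by blast
qed

definition to_fiber :: "(nat \<times> ('x \<Rightarrow>\<^sub>0 nat) \<Rightarrow>\<^sub>0 'k::field) \<Rightarrow> nat \<Rightarrow> ('x, 'k) mpoly set" where
  "to_fiber p = (\<lambda>k. m_power_ideal k +>\<^bsub>mpoly_ring X\<^esub> component k p)"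

lemma coset_0: "m_power_ideal k +>\<^bsub>mpoly_ring X\<^esub> 0 = m_power_ideal k"
proof -
  interpret cring "mpoly_ring X" by (rule cring_mpoly_ring)
  have "0 \<in> m_power_ideal k" by (simp add: mem_m_power_ideal)
  then show ?thesis by (rule a_rcos_zero[OF ideal_m_power_ideal])
qed

lemma power_ideal_mult:
  assumes "i + j = k"
  shows "a \<in> m_power_ideal i \<Longrightarrow> b \<in> power_ideal j \<Longrightarrow> a * b \<in> m_power_ideal k"
proof -
  assume a: "a \<in> m_power_ideal i" and b: "b \<in> power_ideal j"
  show ?thesis
    unfolding mem_m_power_ideal
  proof (clarify)
    fix t assume "t \<in> keys (a * b)"
    then obtain v w where t: "t = v + w" "v \<in> keys a" "w \<in> keys b" using keys_mult[of a b] by blast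
    obtain x v' u where v: "x \<in> X" "v' \<in> fold_sums S i" "v = single x 1 + v' + u" "keys v \<subseteq> X"
      using a t by (force simp: mem_m_power_ideal)
    obtain w' u' where w: "w' \<in> fold_sums S j" "w = w' + u'" "keys w \<subseteq> X"
      using b t by (force simp: mem_power_ideal)
    have "t = (single x 1 + (v' + w')) + (u + u')" using t v w by (simp add: add_ac)
    moreover have "v' + w' \<in> fold_sums S k" using v w assms fold_sums_add by blast
    moreover have "keys t \<subseteq> X" using t v w by (simp add: keys_nat_add)
    ultimately show "keys t \<subseteq> X \<and> (\<exists>x\<in>X. \<exists>w\<in>fold_sums S k. \<exists>u. t = single x 1 + w + u)"
      using v(1) by blast
  qed
qed

lemma m_power_ideal_subset: "m_power_ideal k \<subseteq> power_ideal k"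
proof
  fix a assume a: "a \<in> m_power_ideal k"
  show "a \<in> power_ideal k"
    unfolding mem_power_ideal
  proof clarify
    fix t assume "t \<in> keys a"
    then obtain x v' u where v: "v' \<in> fold_sums S k" "t = single x 1 + v' + u" "keys t \<subseteq> X"
      using a by (force simp: mem_m_power_ideal)
    have "t = v' + (single x 1 + u)" using v by (simp add: add_ac)
    then show "keys t \<subseteq> X \<and> (\<exists>a\<in>fold_sums S k. \<exists>u. t = a + u)" using v by blast
  qed
qed

lemma fiber_mult:
  fixes p q :: "nat \<times> ('x \<Rightarrow>\<^sub>0 nat) \<Rightarrow>\<^sub>0 'k::field"
  assumes "keys p \<subseteq> power_monoid S" "keys q \<subseteq> power_monoid S"
  shows "finsum (mpoly_ring X Quot m_power_ideal k)
      (\<lambda>i. rcoset_mult (mpoly_ring X) (m_power_ideal k) (to_fiber p i) (to_fiber q (k - i))) {..k}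
    = to_fiber (p * q) k"
proof -
  have p: "component i p \<in> power_ideal i" and q: "component i q \<in> power_ideal i" for i
    using assms by (auto intro: power_ideal_if_keys dest: keys_component_power_monoid)
  have carr: "component i p * component j q \<in> carrier (mpoly_ring X)" for i j
    using ring.ring_simprules(5)[OF cring.axioms(1)[OF cring_mpoly_ring] power_ideal_carrier[OF p] power_ideal_carrier[OF q]] by simp
  have *: "rcoset_mult (mpoly_ring X) (m_power_ideal k) (to_fiber p i) (to_fiber q (k - i))
      = m_power_ideal k +>\<^bsub>mpoly_ring X\<^esub> (component i p * component (k - i) q)" if "i \<in> {..k}" for i
    unfolding to_fiber_def
  proof (rule rcoset_mult_cosets)
    fix x y :: "('x, 'k) mpoly" assume xy: "x \<in> m_power_ideal i" "y \<in> m_power_ideal (k - i)"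
    have ik: "i + (k - i) = k" "(k - i) + i = k" using that by auto
    show "x * component (k - i) q \<in> m_power_ideal k \<and> component i p * y \<in> m_power_ideal k \<and> x * y \<in> m_power_ideal k"
      using power_ideal_mult[OF ik(1) xy(1) q] power_ideal_mult[OF ik(2) xy(2) p]
        power_ideal_mult[OF ik(1) xy(1) subsetD[OF m_power_ideal_subset xy(2)]] by (auto simp: mult.commute)
  qed (use ideal_m_power_ideal power_ideal_carrier p q in blast)+
  have "finsum (mpoly_ring X Quot m_power_ideal k)
      (\<lambda>i. rcoset_mult (mpoly_ring X) (m_power_ideal k) (to_fiber p i) (to_fiber q (k - i))) {..k}
     = finsum (mpoly_ring X Quot m_power_ideal k)
      (\<lambda>i. m_power_ideal k +>\<^bsub>mpoly_ring X\<^esub> (component i p * component (k - i) q)) {..k}"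
  proof -
    interpret Q: cring "mpoly_ring X Quot (m_power_ideal k :: ('x, 'k) mpoly set)"
      by (rule ideal.quotient_is_cring[OF ideal_m_power_ideal cring_mpoly_ring])
    interpret H: ring_hom_cring "mpoly_ring X" "mpoly_ring X Quot (m_power_ideal k :: ('x, 'k) mpoly set)"
        "(+>\<^bsub>mpoly_ring X\<^esub>) (m_power_ideal k)"
      by (rule ideal.rcos_ring_hom_cring[OF ideal_m_power_ideal cring_mpoly_ring])
    show ?thesis
      by (rule Q.finsum_cong'[OF refl _ *]) (use carr H.hom_closed in blast)+
  qed
  also have "\<dots> = to_fiber (p * q) k"
    unfolding to_fiber_def component_mult using carr by (intro finsum_cosets ideal_m_power_ideal) auto
  finally show ?thesis .
qed

theorem to_fiber_iso:
  "to_fiber \<in> ring_iso (monoid_ring (power_monoid S) :: ('x, 'k::field) graded_mpoly ring)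
     (poly_fiber_cone X (monomial_ideal X S))"
proof -
  let ?F = "poly_fiber_cone X (monomial_ideal X S :: ('x, 'k) mpoly set)"
  let ?T = "monoid_ring (power_monoid S) :: ('x, 'k) graded_mpoly ring"
  have comp: "component k p \<in> power_ideal k" if "p \<in> carrier ?T" for k and p :: "nat \<times> ('x \<Rightarrow>\<^sub>0 nat) \<Rightarrow>\<^sub>0 'k"
    using that by (auto intro: power_ideal_if_keys dest: keys_component_power_monoid)
  have F: "to_fiber p \<in> carrier ?F" if p: "p \<in> carrier ?T" for p
  proof -
    have "{k. to_fiber p k \<noteq> m_power_ideal k} \<subseteq> fst ` keys p"
    proof
      fix k assume "k \<in> {k. to_fiber p k \<noteq> m_power_ideal k}"
      then have "component k p \<noteq> 0" by (auto simp: coset_0 to_fiber_def)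
      then obtain t where "t \<in> keys (component k p)" by (metis keys_eq_empty ex_in_conv)
      then show "k \<in> fst ` keys p" by (force simp: keys_component)
    qed
    then have "finite {k. to_fiber p k \<noteq> m_power_ideal k}" by (rule finite_subset) simp
    then show ?thesis using comp[OF p] by (auto simp: poly_fiber_cone_def fiber_cone_def to_fiber_def)
  qed
  have hom: "to_fiber \<in> ring_hom ?T ?F"
  proof (rule ring_hom_memI)
    fix p q assume pq: "p \<in> carrier ?T" "q \<in> carrier ?T"
    show "to_fiber p \<in> carrier ?F" by (rule F[OF pq(1)])
    show "to_fiber (p \<otimes>\<^bsub>?T\<^esub> q) = to_fiber p \<otimes>\<^bsub>?F\<^esub> to_fiber q"
      using fiber_mult[of p q] pq by (auto simp: poly_fiber_cone_def fiber_cone_def)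
    have "m_power_ideal k +>\<^bsub>mpoly_ring X\<^esub> (component k p + component k q) =
      (m_power_ideal k +>\<^bsub>mpoly_ring X\<^esub> component k p) <+>\<^bsub>mpoly_ring X\<^esub> (m_power_ideal k +>\<^bsub>mpoly_ring X\<^esub> component k q)" for k
      using ideal.a_rcos_sum[OF ideal_m_power_ideal power_ideal_carrier[OF comp[OF pq(1)]] power_ideal_carrier[OF comp[OF pq(2)]]]
      by simp
    then show "to_fiber (p \<oplus>\<^bsub>?T\<^esub> q) = to_fiber p \<oplus>\<^bsub>?F\<^esub> to_fiber q"
      by (auto simp: poly_fiber_cone_def fiber_cone_def to_fiber_def component_add FactRing_def)
  next
    have "component k (1 :: nat \<times> ('x \<Rightarrow>\<^sub>0 nat) \<Rightarrow>\<^sub>0 'k) = (if k = 0 then 1 else 0)" for k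
      using component_single[of k 0 "1::'k"] by (cases "k = 0") simp_all
    then show "to_fiber \<one>\<^bsub>?T\<^esub> = \<one>\<^bsub>?F\<^esub>"
      by (auto simp: coset_0 poly_fiber_cone_def fiber_cone_def to_fiber_def fun_eq_iff)
  qed
  have inj: "inj_on to_fiber (carrier ?T)"
  proof (rule inj_onI)
    fix p q assume pq: "p \<in> carrier ?T" "q \<in> carrier ?T" "to_fiber p = to_fiber q"
    show "p = q"
    proof (rule component_eqI)
      fix k
      have "component k p - component k q \<in> m_power_ideal k"
        using fun_cong[OF pq(3), of k] coset_eq_iff[OF ideal_m_power_ideal power_ideal_carrier[OF comp[OF pq(1)]] power_ideal_carrier[OF comp[OF pq(2)]]]
        by (simp add: to_fiber_def)
      then show "component k p = component k q"
        using m_power_ideal_0[of "component k p - component k q" k] keys_component_power_monoid[of p S k]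
          keys_component_power_monoid[of q S k] pq
          keys_diff_subset[of "component k p" "fold_sums S k" "component k q"] by simp
    qed
  qed
  have "f \<in> to_fiber ` carrier ?T" if f: "f \<in> carrier ?F" for f
  proof -
    define K where "K = {k. f k \<noteq> m_power_ideal k}"
    have K: "finite K" and "\<And>k. \<exists>a\<in>power_ideal k. f k = m_power_ideal k +>\<^bsub>mpoly_ring X\<^esub> a"
      using f by (auto simp: K_def poly_fiber_cone_def fiber_cone_def)
    then obtain a where a: "\<And>k. a k \<in> power_ideal k" "\<And>k. f k = m_power_ideal k +>\<^bsub>mpoly_ring X\<^esub> a k"
      by metis
    obtain b where b: "\<And>k. keys (b k) \<subseteq> fold_sums S k" "\<And>k. a k - b k \<in> m_power_ideal k"
      using power_ideal_mod[OF a(1)] by metis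
    define p where "p = (\<Sum>k\<in>K. in_degree k (b k))"
    have comp_p: "component k p = (if k \<in> K then b k else 0)" for k
      using K by (simp add: p_def component_sum component_in_degree)
    have "keys p \<subseteq> power_monoid S"
      unfolding p_def
    proof (rule keys_sum_subset)
      fix k show "keys (in_degree k (b k)) \<subseteq> power_monoid S"
        using keys_in_degree[of k "b k"] b(1)[of k] by (auto simp: power_monoid_def)
    qed
    moreover have "to_fiber p = f"
    proof
      fix k
      have "m_power_ideal k +>\<^bsub>mpoly_ring X\<^esub> a k = m_power_ideal k +>\<^bsub>mpoly_ring X\<^esub> b k"
        using coset_eq_iff[OF ideal_m_power_ideal power_ideal_carrier[OF a(1)] power_ideal_carrier[OF power_ideal_if_keys[OF b(1)]]] b(2)
        by blast
      then show "to_fiber p k = f k"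
        using a(2)[of k] by (auto simp: coset_0 to_fiber_def comp_p K_def)
    qed
    ultimately show ?thesis by auto
  qed
  then show ?thesis
    unfolding ring_iso_def bij_betw_def using hom inj F by auto
qed

lemma to_fiber_const: "to_fiber (single 0 c) = fiber_const X (monomial_ideal X S) c"
  by (auto simp: coset_0 to_fiber_def fiber_const_def component_single poly_const_def fun_eq_iff)

lemma cring_fiber_cone: "cring (poly_fiber_cone X (monomial_ideal X S :: ('x, 'k::field) mpoly set))"
proof -
  let ?F = "poly_fiber_cone X (monomial_ideal X S :: ('x, 'k) mpoly set)"
  let ?T = "monoid_ring (power_monoid S) :: ('x, 'k) graded_mpoly ring"
  have "cring (?F\<lparr>zero := to_fiber \<zero>\<^bsub>?T\<^esub>\<rparr>)"
    by (rule cring.ring_iso_imp_img_cring[OF cring_monoid_ring[OF submonoid_power_monoid] to_fiber_iso])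
  moreover have "to_fiber \<zero>\<^bsub>?T\<^esub> = \<zero>\<^bsub>?F\<^esub>"
    by (auto simp: coset_0 poly_fiber_cone_def fiber_cone_def to_fiber_def)
  ultimately show ?thesis by simp
qed

end

section \<open>Counting sums of two exponent vectors\<close>

abbreviation pair_sums :: "'m::comm_monoid_add set \<Rightarrow> 'm set" where
  "pair_sums V \<equiv> fold_sums V 2"

definition rational_span :: "('x \<Rightarrow>\<^sub>0 nat) set \<Rightarrow> ('x \<Rightarrow>\<^sub>0 nat) set" where
  "rational_span B = {v. \<exists>c :: ('x \<Rightarrow>\<^sub>0 nat) \<Rightarrow> rat. \<forall>x.
     of_nat (lookup v x) = (\<Sum>b\<in>B. c b * of_nat (lookup b x))}"

lemma rational_span_base:
  assumes "finite B" "b \<in> B"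
  shows "b \<in> rational_span B"
  unfolding rational_span_def
  using assms by (auto simp: if_distrib[of "\<lambda>x. x * _"] cong: if_cong intro!: exI[of _ "\<lambda>a. if a = b then 1 else 0"])

lemma rational_span_mono:
  assumes "finite B'" "B \<subseteq> B'"
  shows "rational_span B \<subseteq> rational_span B'"
proof
  fix v assume "v \<in> rational_span B"
  then obtain c :: "_ \<Rightarrow> rat" where c: "\<And>x. of_nat (lookup v x) = (\<Sum>b\<in>B. c b * of_nat (lookup b x))"
    by (auto simp: rational_span_def)
  have "of_nat (lookup v x) = (\<Sum>b\<in>B'. (if b \<in> B then c b else 0) * of_nat (lookup b x))" for x
    unfolding c using assms by (intro sum.mono_neutral_cong_left) auto
  then show "v \<in> rational_span B'"
    unfolding rational_span_def by (intro CollectI exI[of _ "\<lambda>b. if b \<in> B then c b else 0"]) auto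
qed

lemma rational_span_combination:
  fixes k1 k2 k3 :: rat
  assumes "u1 \<in> rational_span B" "u2 \<in> rational_span B" "u3 \<in> rational_span B"
    and v: "\<And>x. of_nat (lookup v x) = k1 * of_nat (lookup u1 x) + k2 * of_nat (lookup u2 x) + k3 * of_nat (lookup u3 x)"
  shows "v \<in> rational_span B"
proof -
  obtain c1 c2 c3 :: "_ \<Rightarrow> rat" where
    "\<And>x. of_nat (lookup u1 x) = (\<Sum>b\<in>B. c1 b * of_nat (lookup b x))"
    "\<And>x. of_nat (lookup u2 x) = (\<Sum>b\<in>B. c2 b * of_nat (lookup b x))"
    "\<And>x. of_nat (lookup u3 x) = (\<Sum>b\<in>B. c3 b * of_nat (lookup b x))"
    using assms(1-3) by (auto simp: rational_span_def)
  then have "of_nat (lookup v x) = (\<Sum>b\<in>B. (k1 * c1 b + k2 * c2 b + k3 * c3 b) * of_nat (lookup b x))" for x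
    unfolding v by (simp add: sum_distrib_left sum.distrib distrib_right mult.assoc)
  then show ?thesis
    unfolding rational_span_def by (intro CollectI exI[of _ "\<lambda>b. k1 * c1 b + k2 * c2 b + k3 * c3 b"]) auto
qed

lemma rational_span_pair_sum:
  assumes "v + u = u1 + u2" "u \<in> rational_span B" "u1 \<in> rational_span B" "u2 \<in> rational_span B"
  shows "v \<in> rational_span B"
proof (rule rational_span_combination[of u1 B u2 u v 1 1 "- 1"])
  fix x
  have "lookup v x + lookup u x = lookup u1 x + lookup u2 x"
    using assms(1) by (metis lookup_add)
  then have "(of_nat (lookup v x) :: rat) + of_nat (lookup u x) = of_nat (lookup u1 x) + of_nat (lookup u2 x)"
    by (metis of_nat_add)
  then show "(of_nat (lookup v x) :: rat) = 1 * of_nat (lookup u1 x) + 1 * of_nat (lookup u2 x) + (- 1) * of_nat (lookup u x)"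
    by simp
qed (use assms in auto)

lemma rational_span_midpoint:
  assumes "v + v = u1 + u2" "u1 \<in> rational_span B" "u2 \<in> rational_span B"
  shows "v \<in> rational_span B"
proof (rule rational_span_combination[of u1 B u2 u1 v "1/2" "1/2" 0])
  fix x
  have "lookup v x + lookup v x = lookup u1 x + lookup u2 x"
    using assms(1) by (metis lookup_add)
  then have "(of_nat (lookup v x) :: rat) + of_nat (lookup v x) = of_nat (lookup u1 x) + of_nat (lookup u2 x)"
    by (metis of_nat_add)
  then show "(of_nat (lookup v x) :: rat) = 1/2 * of_nat (lookup u1 x) + 1/2 * of_nat (lookup u2 x) + 0 * of_nat (lookup u1 x)"
    by simp
qed (use assms in auto)

text \<open>
  A vector \<open>v\<close> of \<open>V\<close> at which some linear functional attains its maximum over \<open>V\<close>, and only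
  there, is a vertex of the convex hull.
\<close>
definition exposed :: "('x \<Rightarrow>\<^sub>0 nat) set \<Rightarrow> ('x \<Rightarrow>\<^sub>0 nat) \<Rightarrow> bool" where
  "exposed V v \<longleftrightarrow> (\<exists>f :: ('x \<Rightarrow>\<^sub>0 nat) \<Rightarrow> nat.
     (\<forall>a b. f (a + b) = f a + f b) \<and> (\<forall>u\<in>V - {v}. f u < f v))"

text \<open>
  With \<open>r = |B|\<close> and \<open>\<mu> = |V|\<close>, the inequality is \<open>|2V| > r\<mu> - r(r - 1)/2\<close>, multiplied by 2. When \<open>B\<close> is
  a basis of the span, Freiman's theorem gives this with \<open>\<ge>\<close>.
\<close>
definition surplus_spanned :: "('x \<Rightarrow>\<^sub>0 nat) set \<Rightarrow> ('x \<Rightarrow>\<^sub>0 nat) set \<Rightarrow> bool" where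
  "surplus_spanned V B \<longleftrightarrow> B \<subseteq> V \<and> V \<subseteq> rational_span B \<and>
     2 * int (card (pair_sums V)) > 2 * int (card B) * int (card V) - int (card B) * (int (card B) - 1)"

text \<open>
  If \<open>v\<close> is outside the span of \<open>B\<close>, all sums of \<open>v\<close> with elements of \<open>V \<union> {v}\<close> are new and different,
  so the left-hand side of the inequality grows by at least \<open>\<mu> + 1\<close>, and the right-hand side by exactly
  that much. Otherwise the new sums are at least \<open>v + v\<close> and
  \<open>v + u\<close> with \<open>u\<close> in the set \<open>Irr\<close> of those \<open>u\<close> for which \<open>u - v\<close> is not a sum of two such differences. In the
  cone of these differences, which is pointed since \<open>v\<close> is exposed, every difference is a sum of
  irreducible ones, so \<open>Irr \<union> {v}\<close> spans, too. The smaller one of the two spanning sets keeps the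
  inequality, whose right-hand side is increasing in \<open>r \<le> \<mu>\<close>.
\<close>
lemma surplus_spanned_insert:
  assumes V: "finite V" "v \<notin> V" and ex: "exposed V v" and B: "surplus_spanned V B"
  shows "\<exists>B'. surplus_spanned (insert v V) B'"
proof -
  let ?V' = "insert v V"
  have finB: "finite B" "B \<subseteq> V" "V \<subseteq> rational_span B"
    using B V by (auto simp: surplus_spanned_def intro: finite_subset)
  have cardV': "card ?V' = card V + 1" using V by simp
  have cardB: "card B \<le> card V" using V finB by (intro card_mono)
  have fin2: "finite (pair_sums ?V')" "finite (pair_sums V)" using V by (simp_all add: finite_fold_sums)
  have surplus: "2 * int (card (pair_sums V)) > 2 * int (card B) * int (card V) - int (card B) * (int (card B) - 1)"
    using B by (simp add: surplus_spanned_def)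
  show ?thesis
  proof (cases "v \<in> rational_span B")
    case False
    have disj: "pair_sums V \<inter> (+) v ` ?V' = {}"
    proof (rule ccontr)
      assume "pair_sums V \<inter> (+) v ` ?V' \<noteq> {}"
      then obtain u u1 u2 where u: "u \<in> ?V'" "u1 \<in> V" "u2 \<in> V" "v + u = u1 + u2"
        unfolding fold_sums_2 by auto
      then show False
        using rational_span_midpoint[of v u1 u2 B] rational_span_pair_sum[of v u u1 u2 B] finB False by auto
    qed
    have "card (pair_sums V) + card ((+) v ` ?V') \<le> card (pair_sums ?V')"
      using fin2 V disj by (subst card_Un_disjoint[symmetric]) (auto intro!: card_mono simp: fold_sums_2)
    moreover have "card ((+) v ` ?V') = card ?V'" by (rule card_image) (simp add: inj_on_def)
    then have "card ((+) v ` ?V') = card V + 1" using cardV' by (rule trans)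
    ultimately have "card (pair_sums V) + card V + 1 \<le> card (pair_sums ?V')" by simp
    moreover have "card (insert v B) = card B + 1" using V finB by (subst card_insert_disjoint) auto
    moreover have "?V' \<subseteq> rational_span (insert v B)"
      using finB rational_span_mono[of "insert v B" B] rational_span_base[of "insert v B" v] by auto
    ultimately have "surplus_spanned ?V' (insert v B)"
      unfolding surplus_spanned_def using finB surplus cardV' by (auto simp: algebra_simps)
    then show ?thesis ..
  next
    case True
    obtain f :: "('a \<Rightarrow>\<^sub>0 nat) \<Rightarrow> nat" where f: "\<And>a b. f (a + b) = f a + f b" "\<And>u. u \<in> V \<Longrightarrow> f u < f v"
      using ex V unfolding exposed_def by blast
    \<comment> \<open>the \<open>u\<close> such that \<open>u - v\<close> is irreducible in \<open>V - v\<close>\<close>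
    define Irr where "Irr = {u\<in>V. v + u \<notin> pair_sums V}"
    let ?B' = "insert v Irr"
    have Irr: "finite Irr" "Irr \<subseteq> V" "v \<notin> Irr" using V by (auto simp: Irr_def)
    have disj: "pair_sums V \<inter> (+) v ` ?B' = {}"
    proof (rule ccontr)
      assume "pair_sums V \<inter> (+) v ` ?B' \<noteq> {}"
      then obtain u1 u2 where "u1 \<in> V" "u2 \<in> V" "v + v = u1 + u2"
        unfolding Irr_def by (auto simp: fold_sums_2)
      then show False using f(1)[of v v] f(1)[of u1 u2] f(2)[of u1] f(2)[of u2] by simp
    qed
    have "card (pair_sums V) + card ((+) v ` ?B') \<le> card (pair_sums ?V')"
      using fin2 Irr disj by (subst card_Un_disjoint[symmetric]) (auto intro!: card_mono simp: fold_sums_2)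
    moreover have cardB': "card ?B' = card Irr + 1" using Irr by simp
    moreover have "card ((+) v ` ?B') = card ?B'" by (rule card_image) (simp add: inj_on_def)
    ultimately have count: "card (pair_sums V) + card Irr + 1 \<le> card (pair_sums ?V')" by simp
    have span: "u \<in> rational_span ?B'" if "u \<in> V" for u
      using that
    proof (induction "f v - f u" arbitrary: u rule: less_induct)
      case less
      show ?case
      proof (cases "u \<in> Irr")
        case True then show ?thesis using Irr by (intro rational_span_base) auto
      next
        case False
        then obtain u1 u2 where u: "u1 \<in> V" "u2 \<in> V" "v + u = u1 + u2"
          using less.prems by (auto simp: Irr_def fold_sums_2)
        have "f v + f u = f u1 + f u2" using f(1)[of v u] f(1)[of u1 u2] u(3) by simp
        then have "f v - f u1 < f v - f u" "f v - f u2 < f v - f u"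
          using f(2)[OF u(1)] f(2)[OF u(2)] f(2)[OF less.prems] by linarith+
        then have "u1 \<in> rational_span ?B'" "u2 \<in> rational_span ?B'" using less.hyps u by blast+
        moreover have "v \<in> rational_span ?B'" using Irr by (intro rational_span_base) auto
        moreover have "u + v = u1 + u2" using u(3) by (simp add: add.commute)
        ultimately show ?thesis using rational_span_pair_sum[of u v u1 u2 ?B'] by blast
      qed
    qed
    show ?thesis
    proof (cases "card Irr + 1 \<le> card B")
      case True
      have "2 * int (card ?B') * int (card V) - int (card ?B') * (int (card ?B') - 1)
         \<le> 2 * int (card B) * int (card V) - int (card B) * (int (card B) - 1)"
      proof -
        have "0 \<le> (int (card B) - int (card ?B')) * (2 * int (card V) + 1 - int (card B) - int (card ?B'))"
          using True cardB cardB' by (intro mult_nonneg_nonneg) auto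
        then show ?thesis by (simp add: algebra_simps)
      qed
      then have "2 * int (card ?B') * int (card V) - int (card ?B') * (int (card ?B') - 1)
         < 2 * int (card (pair_sums V))" using surplus by linarith
      moreover have "2 * int (card ?B') * int (card ?V') = 2 * int (card ?B') * int (card V) + 2 * int (card ?B')"
        using cardV' by (simp add: algebra_simps)
      moreover have "int (card (pair_sums V)) + int (card ?B') \<le> int (card (pair_sums ?V'))"
        using count cardB' by simp
      ultimately have "2 * int (card ?B') * int (card ?V') - int (card ?B') * (int (card ?B') - 1)
         < 2 * int (card (pair_sums ?V'))" by linarith
      moreover have "?V' \<subseteq> rational_span ?B'"
        using span rational_span_base[of ?B' v] Irr by auto
      ultimately have "surplus_spanned ?V' ?B'"
        unfolding surplus_spanned_def using Irr by auto
      then show ?thesis ..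
    next
      case False
      have "2 * int (card B) * int (card ?V') = 2 * int (card B) * int (card V) + 2 * int (card B)"
        using cardV' by (simp add: algebra_simps)
      moreover have "int (card (pair_sums V)) + int (card B) \<le> int (card (pair_sums ?V'))"
        using count False by simp
      ultimately have "2 * int (card B) * int (card ?V') - int (card B) * (int (card B) - 1)
         < 2 * int (card (pair_sums ?V'))" using surplus by linarith
      then have "surplus_spanned ?V' B"
        unfolding surplus_spanned_def using finB \<open>v \<in> rational_span B\<close> by auto
      then show ?thesis ..
    qed
  qed
qed

theorem surplus_spanned_superset:
  assumes V: "finite V" "W \<subseteq> V" and ex: "\<And>v. v \<in> V \<Longrightarrow> exposed V v" and W: "surplus_spanned W B"
  shows "\<exists>B'. surplus_spanned V B'"
proof -
  have "\<exists>B'. surplus_spanned (W \<union> D) B'" if "finite D" "D \<subseteq> V" for D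
    using that
  proof (induction D rule: finite_induct)
    case empty then show ?case using W by auto
  next
    case (insert v D)
    then obtain B' where B': "surplus_spanned (W \<union> D) B'" by auto
    show ?case
    proof (cases "v \<in> W \<union> D")
      case True
      then have "W \<union> insert v D = W \<union> D" by blast
      then show ?thesis using B' by metis
    next
      case False
      have "exposed (W \<union> D) v"
        using ex[of v] insert.prems V unfolding exposed_def by blast
      moreover have "finite (W \<union> D)" using V insert.hyps by (auto intro: finite_subset)
      ultimately have "\<exists>B'. surplus_spanned (insert v (W \<union> D)) B'"
        using False B' by (intro surplus_spanned_insert)
      then show ?thesis by simp
    qed
  qed
  from this[OF V(1)] show ?thesis using V by (simp add: Un_absorb1)
qed

lemma pair_sums_enumerate:
  fixes n :: nat
  assumes "bij_betw s {..<n} S"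
  shows "pair_sums S = (\<lambda>(i, j). s i + s j) ` {(i, j). i \<le> j \<and> j < n}"
proof
  show "pair_sums S \<subseteq> (\<lambda>(i, j). s i + s j) ` {(i, j). i \<le> j \<and> j < n}"
  proof
    fix w assume "w \<in> pair_sums S"
    then obtain a b where "a \<in> S" "b \<in> S" and w: "w = a + b" by (auto simp: fold_sums_2)
    then have "a \<in> s ` {..<n}" "b \<in> s ` {..<n}" using assms by (simp_all add: bij_betw_def)
    then obtain i j where "i < n" "j < n" "a = s i" "b = s j" by auto
    then show "w \<in> (\<lambda>(i, j). s i + s j) ` {(i, j). i \<le> j \<and> j < n}"
    proof (cases "i \<le> j")
      case True
      then show ?thesis using w \<open>j < n\<close> \<open>a = s i\<close> \<open>b = s j\<close> by (intro image_eqI[of _ _ "(i, j)"]) auto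
    next
      case False
      then show ?thesis
        using w \<open>i < n\<close> \<open>a = s i\<close> \<open>b = s j\<close>
        by (intro image_eqI[of _ _ "(j, i)"]) (simp_all add: add.commute)
    qed
  qed
  show "(\<lambda>(i, j). s i + s j) ` {(i, j). i \<le> j \<and> j < n} \<subseteq> pair_sums S"
  proof clarify
    fix i j assume "i \<le> j" "j < n"
    then have "s i \<in> S" "s j \<in> S" using assms by (auto simp: bij_betw_def)
    then show "s i + s j \<in> pair_sums S" unfolding fold_sums_2 by blast
  qed
qed

lemma card_ordered_pairs: "finite {(i, j). i \<le> j \<and> j < (n::nat)}" "2 * card {(i, j). i \<le> j \<and> j < (n::nat)} = n * (n + 1)"
proof -
  have eq: "{(i, j). i \<le> j \<and> j < n} = (\<lambda>(j, i). (i, j)) ` (SIGMA j:{..<n}. {..j})" for n :: nat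
    by (auto simp: image_iff)
  show "finite {(i, j). i \<le> j \<and> j < n}" unfolding eq by simp
  have "card {(i, j). i \<le> j \<and> j < n} = card (SIGMA j:{..<n}. {..j})"
    unfolding eq by (rule card_image) (auto simp: inj_on_def)
  also have "\<dots> = (\<Sum>j<n. j + 1)" by simp
  finally have "card {(i, j). i \<le> j \<and> j < n} = (\<Sum>j<n. j + 1)" .
  moreover have "2 * (\<Sum>j<n. j + 1) = n * (n + 1)" for n :: nat by (induction n) auto
  ultimately show "2 * card {(i, j). i \<le> j \<and> j < n} = n * (n + 1)" by simp
qed

lemma card_pair_sums_le:
  assumes "finite S"
  shows "2 * card (pair_sums S) \<le> card S * (card S + 1)"
proof -
  obtain s where s: "bij_betw s {..<card S} S"
    using ex_bij_betw_nat_finite[OF assms] by (auto simp: atLeast0LessThan)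
  have "card (pair_sums S) \<le> card {(i, j). i \<le> j \<and> j < card S}"
    unfolding pair_sums_enumerate[OF s] by (rule card_image_le[OF card_ordered_pairs(1)])
  then show ?thesis using card_ordered_pairs(2)[of "card S"] by simp
qed

text \<open>
  The incidence matrix between the six consecutive pairs of a closed sequence \<open>z\<^sub>0, \<dots>, z\<^sub>5\<close> and its
  members. The members are pairwise distinct, except that \<open>z\<^sub>0 = z\<^sub>3\<close> if \<open>t\<close> is true: the pairs form a
  hexagon, or two triangles that share a vertex.
\<close>
definition hexagon_incidence :: "bool \<Rightarrow> nat \<Rightarrow> nat \<Rightarrow> nat" where
  "hexagon_incidence t i m = (if m = i \<or> m = Suc i mod 6 \<or>
     t \<and> (m = 0 \<and> (i = 3 \<or> Suc i mod 6 = 3) \<or> m = 3 \<and> (i = 0 \<or> Suc i mod 6 = 0)) then 1 else 0)"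

definition hexagon_pairs :: "(nat \<times> nat) list" where
  "hexagon_pairs = concat (map (\<lambda>i. map (Pair i) [i..<6]) [0..<6])"

definition hexagon_row :: "bool \<Rightarrow> nat \<times> nat \<Rightarrow> nat list" where
  "hexagon_row t = (\<lambda>(i, j). map (\<lambda>m. hexagon_incidence t i m + hexagon_incidence t j m) [0..<6])"

lemma distinct_hexagon_rows: "distinct (map (hexagon_row t) hexagon_pairs)"
proof -
  have "distinct (map (hexagon_row True) hexagon_pairs)" "distinct (map (hexagon_row False) hexagon_pairs)"
    by code_simp+
  then show ?thesis by (cases t) simp_all
qed

lemma hexagon_pair_sums:
  fixes w :: "nat \<Rightarrow> 'x \<Rightarrow>\<^sub>0 nat" and z :: "nat \<Rightarrow> 'x"
  assumes h: "\<And>i. i < 6 \<Longrightarrow> w i + (single (z i) 1 + single (z (Suc i mod 6)) 1) = h"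
    and z: "\<And>i j. i < 6 \<Longrightarrow> j < 6 \<Longrightarrow> z i = z j \<longleftrightarrow> i = j \<or> t \<and> (i = 0 \<and> j = 3 \<or> i = 3 \<and> j = 0)"
    and ij: "i \<le> j" "j < 6" "i' \<le> j'" "j' < 6" and eq: "w i + w j = w i' + w j'"
  shows "i = i' \<and> j = j'"
proof -
  let ?e = "\<lambda>i. single (z i) (1::nat) + single (z (Suc i mod 6)) 1"
  have inc: "lookup (?e i) (z m) = hexagon_incidence t i m" if "i < 6" "m < 6" for i m
  proof -
    have "Suc i mod 6 < 6" "Suc i mod 6 \<noteq> i" using that by (auto simp: mod_Suc)
    moreover have "\<not> (i = 0 \<and> Suc i mod 6 = 3)" "\<not> (i = 3 \<and> Suc i mod 6 = 0)" by auto
    ultimately have "z i \<noteq> z (Suc i mod 6)" using z[of i "Suc i mod 6"] that by auto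
    then have "lookup (?e i) (z m) = (if z i = z m \<or> z (Suc i mod 6) = z m then 1 else 0)"
      by (auto simp: lookup_add lookup_single when_def)
    moreover have "z i = z m \<or> z (Suc i mod 6) = z m \<longleftrightarrow> m = i \<or> m = Suc i mod 6 \<or>
        t \<and> (m = 0 \<and> (i = 3 \<or> Suc i mod 6 = 3) \<or> m = 3 \<and> (i = 0 \<or> Suc i mod 6 = 0))"
      unfolding z[OF that] z[OF \<open>Suc i mod 6 < 6\<close> that(2)] by auto
    ultimately show ?thesis by (simp only: hexagon_incidence_def)
  qed
  have "w i + w j + (?e i + ?e j) = (w i + ?e i) + (w j + ?e j)" by (simp add: algebra_simps)
  also have "\<dots> = (w i' + ?e i') + (w j' + ?e j')" using h ij by simp
  also have "\<dots> = w i + w j + (?e i' + ?e j')" unfolding eq by (simp add: algebra_simps)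
  finally have "?e i + ?e j = ?e i' + ?e j'" by (rule add_left_imp_eq)
  then have star: "lookup (?e i) (z m) + lookup (?e j) (z m) = lookup (?e i') (z m) + lookup (?e j') (z m)" for m
    by (metis lookup_add)
  have "hexagon_incidence t i m + hexagon_incidence t j m = hexagon_incidence t i' m + hexagon_incidence t j' m"
    if "m < 6" for m
  proof -
    have "i < 6" "i' < 6" using ij by auto
    then show ?thesis
      using star[of m] unfolding inc[OF \<open>i < 6\<close> that] inc[OF ij(2) that] inc[OF \<open>i' < 6\<close> that] inc[OF ij(4) that]
      by blast
  qed
  then have "hexagon_row t (i, j) = hexagon_row t (i', j')"
    unfolding hexagon_row_def by simp
  moreover have pairs: "(a, b) \<in> set hexagon_pairs" if "a \<le> b" "b < 6" for a b
    using that by (auto simp: hexagon_pairs_def intro!: bexI[of _ a])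
  have "(i, j) \<in> set hexagon_pairs" "(i', j') \<in> set hexagon_pairs"
    using pairs ij by blast+
  moreover have "inj_on (hexagon_row t) (set hexagon_pairs)"
    using distinct_hexagon_rows by (simp add: distinct_map)
  ultimately show ?thesis by (auto dest: inj_onD)
qed

text \<open>
  The only linear relation between the six vectors is \<open>w\<^sub>0 + w\<^sub>2 + w\<^sub>4 = w\<^sub>1 + w\<^sub>3 + w\<^sub>5\<close>. Five of them
  span, and as the relation has degree 3, all 21 sums of two of them are distinct; this
  exceeds \<open>5 \<cdot> 6 - 10 = 20\<close>.
\<close>
lemma hexagon_surplus:
  fixes w :: "nat \<Rightarrow> 'x \<Rightarrow>\<^sub>0 nat" and z :: "nat \<Rightarrow> 'x"
  assumes h: "\<And>i. i < 6 \<Longrightarrow> w i + (single (z i) 1 + single (z (Suc i mod 6)) 1) = h"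
    and z: "\<And>i j. i < 6 \<Longrightarrow> j < 6 \<Longrightarrow> z i = z j \<longleftrightarrow> i = j \<or> t \<and> (i = 0 \<and> j = 3 \<or> i = 3 \<and> j = 0)"
  shows "surplus_spanned (w ` {..<6}) (w ` {..<5})"
proof -
  have sums: "i = i' \<and> j = j'"
    if "i \<le> j" "j < 6" "i' \<le> j'" "j' < 6" "w i + w j = w i' + w j'" for i j i' j'
    using hexagon_pair_sums[OF h z that] by blast
  have inj: "inj_on w {..<6}"
  proof (rule inj_onI)
    fix i j assume "i \<in> {..<6}" "j \<in> {..<6}" "w i = w j"
    then show "i = j" using sums[of i i j j] by simp
  qed
  then have bij: "bij_betw w {..<6} (w ` {..<6})" by (simp add: bij_betw_def)
  have "card (pair_sums (w ` {..<6})) = card {(i, j). i \<le> j \<and> j < (6::nat)}"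
    unfolding pair_sums_enumerate[OF bij] using sums by (intro card_image) (auto simp: inj_on_def)
  then have card2: "card (pair_sums (w ` {..<6})) = 21"
    using card_ordered_pairs(2)[of 6] by simp
  have card6: "card (w ` {..<6}) = 6" "card (w ` {..<5}) = 5"
    using card_image[OF inj] card_image[OF inj_on_subset[OF inj, of "{..<5}"]] by auto
  have fin: "finite (w ` {..<5})" by simp
  have base: "w i \<in> rational_span (w ` {..<5})" if "i < 5" for i
    using that by (intro rational_span_base) auto
  have "w 5 \<in> rational_span (w ` {..<5})"
  proof -
    let ?r = "\<lambda>i x. rat_of_nat (lookup (w i) x)" and ?s = "\<lambda>i x. rat_of_nat (lookup (single (z i) 1) x)"
    let ?h = "\<lambda>x. rat_of_nat (lookup h x)"
    have r: "?r i x + (?s i x + ?s j x) = ?h x" if "i < 6" "j = Suc i mod 6" for i j x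
      using arg_cong[OF h[OF that(1)], of "\<lambda>v. rat_of_nat (lookup v x)"] that(2) by (simp add: lookup_add)
    have "?r 5 x = ?r 0 x + ?r 2 x + ?r 4 x - ?r 1 x - ?r 3 x" for x
    proof -
      have "?r 0 x + (?s 0 x + ?s 1 x) = ?h x" "?r 1 x + (?s 1 x + ?s 2 x) = ?h x"
        "?r 2 x + (?s 2 x + ?s 3 x) = ?h x" "?r 3 x + (?s 3 x + ?s 4 x) = ?h x"
        "?r 4 x + (?s 4 x + ?s 5 x) = ?h x" "?r 5 x + (?s 5 x + ?s 0 x) = ?h x"
        by (rule r; simp)+
      then show ?thesis by linarith
    qed
    moreover define c where "c = (\<lambda>i::nat. if even i then 1 else (-1::rat))"
    have "(\<Sum>b\<in>w ` {..<5}. c (inv_into {..<6} w b) * rat_of_nat (lookup b x))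
       = (\<Sum>i<5. c i * ?r i x)" for x
    proof -
      have "inj_on w {..<5}" by (rule inj_on_subset[OF inj]) auto
      moreover have "inv_into {..<6} w (w i) = i" if "i < 5" for i
        using that by (intro inv_into_f_f[OF inj]) simp
      ultimately show ?thesis by (simp add: sum.reindex)
    qed
    moreover have "(\<Sum>i<5. c i * ?r i x) = ?r 0 x + ?r 2 x + ?r 4 x - ?r 1 x - ?r 3 x" for x
      by (simp add: c_def lessThan_nat_numeral lessThan_Suc)
    ultimately have "\<forall>x. ?r 5 x = (\<Sum>b\<in>w ` {..<5}. c (inv_into {..<6} w b) * rat_of_nat (lookup b x))" by simp
    then show ?thesis unfolding rational_span_def by (intro CollectI exI)
  qed
  moreover have "i < 5 \<or> i = 5" if "i < 6" for i :: nat using that by auto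
  ultimately have "w ` {..<6} \<subseteq> rational_span (w ` {..<5})" using base by auto
  then show ?thesis
    unfolding surplus_spanned_def card2 card6 by auto
qed

section \<open>Polynomial rings and toric rings\<close>

lemma card_bounded_exponents:
  "finite {t \<in> {t :: nat \<Rightarrow>\<^sub>0 nat. keys t \<subseteq> {..<n}}. weight {..<n} t \<le> L}"
  "card {t \<in> {t :: nat \<Rightarrow>\<^sub>0 nat. keys t \<subseteq> {..<n}}. weight {..<n} t \<le> L} \<le> (1 * (L + 1)) ^ n"
proof -
  let ?A = "{t \<in> {t :: nat \<Rightarrow>\<^sub>0 nat. keys t \<subseteq> {..<n}}. weight {..<n} t \<le> L}"
  let ?g = "\<lambda>t :: nat \<Rightarrow>\<^sub>0 nat. restrict (lookup t) {..<n}"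
  let ?P = "PiE {..<n} (\<lambda>_. {..L})"
  have inj: "inj_on ?g ?A"
  proof (rule inj_onI)
    fix s t :: "nat \<Rightarrow>\<^sub>0 nat" assume st: "s \<in> ?A" "t \<in> ?A" "?g s = ?g t"
    show "s = t"
    proof (rule poly_mapping_eqI)
      fix i
      show "lookup s i = lookup t i"
      proof (cases "i < n")
        case True then show ?thesis using fun_cong[OF st(3), of i] by simp
      next
        case False then have "i \<notin> keys s" "i \<notin> keys t" using st by auto
        then show ?thesis by (simp add: in_keys_iff)
      qed
    qed
  qed
  have sub: "?g ` ?A \<subseteq> ?P"
  proof (clarsimp)
    fix t :: "nat \<Rightarrow>\<^sub>0 nat" and i assume "weight {..<n} t \<le> L" "i < n"
    then show "lookup t i \<le> L"
      using member_le_sum[of i "{..<n}" "lookup t"] by (auto simp: weight_def)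
  qed
  have P: "finite ?P" "card ?P = (L + 1) ^ n" by (simp_all add: finite_PiE card_PiE)
  show "finite ?A" by (rule inj_on_finite[OF inj sub P(1)])
  show "card ?A \<le> (1 * (L + 1)) ^ n" using card_inj_on_le[OF inj sub P(1)] P(2) by simp
qed

lemma krull_dim_mpoly_ring_le:
  "krull_dim (mpoly_ring {..<n} :: (nat, 'k::field) mpoly ring) \<le> enat n"
  unfolding mpoly_ring_eq_monoid_ring
  by (rule krull_dim_le_of_growth[OF submonoid_vars weight_0 weight_add card_bounded_exponents])

lemma mem_first_vars_ideal:
  fixes n :: nat
  assumes "i \<le> n"
  shows "p \<in> monomial_ideal {..<n} ((\<lambda>j. single j 1) ` {..<i}) \<longleftrightarrow>
    (\<forall>t\<in>keys p. keys t \<subseteq> {..<n} \<and> keys t \<inter> {..<i} \<noteq> {})"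
proof -
  have "(\<exists>a\<in>(\<lambda>j. single j (1::nat)) ` {..<i}. \<exists>u. t = a + u) \<longleftrightarrow> keys t \<inter> {..<i} \<noteq> {}" for t :: "nat \<Rightarrow>\<^sub>0 nat"
  proof
    assume "\<exists>a\<in>(\<lambda>j. single j (1::nat)) ` {..<i}. \<exists>u. t = a + u"
    then obtain j u where "j < i" "t = single j 1 + u" by auto
    then show "keys t \<inter> {..<i} \<noteq> {}" by (auto simp: keys_nat_add)
  next
    assume "keys t \<inter> {..<i} \<noteq> {}"
    then obtain j where j: "j \<in> keys t" "j < i" by auto
    have "t = single j 1 + (t - single j 1)" by (rule split_off_variable[OF j(1)])
    then show "\<exists>a\<in>(\<lambda>j. single j (1::nat)) ` {..<i}. \<exists>u. t = a + u" using j by blast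
  qed
  then show ?thesis by (simp add: monomial_ideal_def)
qed

text \<open>
  Modulo the ideal, each factor may be replaced by its part that does not involve the first \<open>i\<close>
  variables. The product of these parts does not involve them either, and vanishes if it is in the
  ideal; the ring is a domain.
\<close>
lemma primeideal_first_vars:
  fixes n :: nat
  assumes i: "i \<le> n"
  shows "primeideal (monomial_ideal {..<n} ((\<lambda>j. single j 1) ` {..<i}) :: (nat, 'k::field) mpoly set) (mpoly_ring {..<n})"
    (is "primeideal ?P ?R")
proof (rule primeidealI[OF ideal_monomial_ideal cring_mpoly_ring])
  interpret I: ideal ?P ?R by (rule ideal_monomial_ideal)
  have "1 \<notin> ?P" unfolding mem_first_vars_ideal[OF i] by simp
  then show "carrier ?R \<noteq> ?P" by auto
  have split: "\<exists>a0. a - a0 \<in> ?P \<and> (\<forall>t\<in>keys a0. keys t \<subseteq> {..<n} \<and> keys t \<inter> {..<i} = {})"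
    if a: "a \<in> carrier ?R" for a
  proof -
    obtain a0 where a0: "keys a0 \<subseteq> keys a \<inter> {t. keys t \<inter> {..<i} = {}}"
      "keys (a - a0) \<subseteq> keys a - {t. keys t \<inter> {..<i} = {}}"
      using poly_mapping_split[of a "{t. keys t \<inter> {..<i} = {}}"] by (elim exE conjE)
    have "\<forall>t\<in>keys a. keys t \<subseteq> {..<n}" using a by simp
    then have "a - a0 \<in> ?P" "\<forall>t\<in>keys a0. keys t \<subseteq> {..<n} \<and> keys t \<inter> {..<i} = {}"
      using a0 unfolding mem_first_vars_ideal[OF i] by blast+
    then show ?thesis by blast
  qed
  fix a b assume a: "a \<in> carrier ?R" and b: "b \<in> carrier ?R" and ab: "a \<otimes>\<^bsub>?R\<^esub> b \<in> ?P"
  obtain a0 where a0: "a - a0 \<in> ?P" "\<forall>t\<in>keys a0. keys t \<subseteq> {..<n} \<and> keys t \<inter> {..<i} = {}"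
    using split[OF a] by blast
  obtain b0 where b0: "b - b0 \<in> ?P" "\<forall>t\<in>keys b0. keys t \<subseteq> {..<n} \<and> keys t \<inter> {..<i} = {}"
    using split[OF b] by blast
  have add: "x + y \<in> ?P" if "x \<in> ?P" "y \<in> ?P" for x y
    using additive_subgroup.a_closed[OF I.is_additive_subgroup that] by simp
  have "a * (b - b0) \<in> ?P" "b0 * (a - a0) \<in> ?P"
    using I.I_l_closed[OF b0(1) a] I.I_l_closed[OF a0(1), of b0] b0(2) by auto
  then have "a * (b - b0) + b0 * (a - a0) \<in> ?P" by (rule add)
  moreover have "single 0 (- 1) * (a * (b - b0) + b0 * (a - a0)) \<in> ?P"
    using I.I_l_closed[OF calculation, of "single 0 (- 1)"] by simp
  ultimately have "a * b + single 0 (- 1) * (a * (b - b0) + b0 * (a - a0)) \<in> ?P" using add ab by auto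
  then have P: "a0 * b0 \<in> ?P" by (simp add: single_uminus algebra_simps)
  have "a0 * b0 = 0"
  proof (rule ccontr)
    assume "a0 * b0 \<noteq> 0"
    then obtain t where t: "t \<in> keys (a0 * b0)" by (metis keys_eq_empty ex_in_conv)
    then obtain v w where "t = v + w" "v \<in> keys a0" "w \<in> keys b0" using keys_mult[of a0 b0] by blast
    then have "keys t \<inter> {..<i} = {}" using a0(2) b0(2) by (auto simp: keys_nat_add)
    then show False using P t unfolding mem_first_vars_ideal[OF i] by blast
  qed
  then have "a0 = 0 \<or> b0 = 0" by simp
  then show "a \<in> ?P \<or> b \<in> ?P" using a0(1) b0(1) by auto
qed

theorem krull_dim_mpoly_ring: "krull_dim (mpoly_ring {..<n} :: (nat, 'k::field) mpoly ring) = enat n"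
proof (rule antisym[OF krull_dim_mpoly_ring_le krull_dim_ge_chain])
  let ?P = "\<lambda>i. monomial_ideal {..<n} ((\<lambda>j. single j 1) ` {..<i}) :: (nat, 'k) mpoly set"
  show "primeideal (?P i) (mpoly_ring {..<n})" if "i \<le> n" for i
    using primeideal_first_vars[OF that] .
  show "?P i \<subset> ?P (Suc i)" if "i < n" for i
  proof (rule psubsetI)
    show "?P i \<subseteq> ?P (Suc i)" unfolding monomial_ideal_def by force
    have "single (single i 1) 1 \<in> ?P (Suc i)" "single (single i 1) 1 \<notin> ?P i"
      using that by (subst mem_first_vars_ideal; auto)+
    then show "?P i \<noteq> ?P (Suc i)" by blast
  qed
qed

text \<open>
  The linear map induced by a map of exponents; for an isomorphism of monoids it is an isomorphism
  of monoid rings.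
\<close>
definition pushforward :: "('m \<Rightarrow> 'n) \<Rightarrow> ('m \<Rightarrow>\<^sub>0 'k::comm_monoid_add) \<Rightarrow> ('n \<Rightarrow>\<^sub>0 'k)" where
  "pushforward f p = (\<Sum>t\<in>keys p. single (f t) (lookup p t))"

lemma pushforward_superset: "finite A \<Longrightarrow> keys p \<subseteq> A \<Longrightarrow> pushforward f p = (\<Sum>t\<in>A. single (f t) (lookup p t))"
  unfolding pushforward_def by (rule sum.mono_neutral_left) (auto simp: in_keys_iff)

lemma pushforward_add: "pushforward f (p + q) = pushforward f p + pushforward f q"
  using keys_add[of p q]
  by (simp add: pushforward_superset[of "keys p \<union> keys q"] lookup_add single_add sum.distrib)

lemma pushforward_0 [simp]: "pushforward f 0 = 0"
  by (simp add: pushforward_def)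

lemma pushforward_single [simp]: "pushforward f (single t c) = single (f t) c"
  by (simp add: pushforward_def)

lemma pushforward_sum: "pushforward f (sum g A) = (\<Sum>a\<in>A. pushforward f (g a))"
  by (induction A rule: infinite_finite_induct) (simp_all add: pushforward_add)

lemma pushforward_mult:
  fixes p q :: "'m::comm_monoid_add \<Rightarrow>\<^sub>0 'k::comm_semiring_1"
  assumes "\<And>a b. f (a + b) = f a + f b"
  shows "pushforward f (p * q) = pushforward f p * pushforward f q"
proof -
  let ?P = "\<lambda>a. single a (lookup p a)" and ?Q = "\<lambda>b. single b (lookup q b)"
  have p: "p = (\<Sum>a\<in>keys p. ?P a)" and q: "q = (\<Sum>b\<in>keys q. ?Q b)"
    by (auto intro: poly_mapping_sum_single)
  have "pushforward f (p * q) = pushforward f ((\<Sum>a\<in>keys p. ?P a) * (\<Sum>b\<in>keys q. ?Q b))" using p q by simp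
  also have "\<dots> = (\<Sum>a\<in>keys p. \<Sum>b\<in>keys q. pushforward f (?P a) * pushforward f (?Q b))"
    by (simp add: sum_product pushforward_sum mult_single assms)
  also have "\<dots> = pushforward f (\<Sum>a\<in>keys p. ?P a) * pushforward f (\<Sum>b\<in>keys q. ?Q b)"
    by (simp only: sum_product pushforward_sum)
  also have "\<dots> = pushforward f p * pushforward f q" using p q by simp
  finally show ?thesis .
qed

lemma keys_pushforward: "keys (pushforward f p) \<subseteq> f ` keys p"
  unfolding pushforward_def by (rule keys_sum_subset) (auto split: if_splits)

lemma pushforward_inverse:
  assumes "\<And>t. t \<in> keys p \<Longrightarrow> g (f t) = t"
  shows "pushforward g (pushforward f p) = p"
proof -
  have "pushforward g (pushforward f p) = (\<Sum>t\<in>keys p. single (g (f t)) (lookup p t))"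
    by (simp add: pushforward_def[of f] pushforward_sum)
  also have "\<dots> = p" using poly_mapping_sum_single[of p "keys p"] assms by simp
  finally show ?thesis .
qed

lemma pushforward_ring_iso:
  fixes f :: "'m::comm_monoid_add \<Rightarrow> 'n::comm_monoid_add"
  assumes f: "f 0 = 0" "\<And>a b. f (a + b) = f a + f b" and bij: "bij_betw f \<Gamma> \<Delta>"
  shows "pushforward f \<in> ring_iso (monoid_ring \<Gamma> :: ('m \<Rightarrow>\<^sub>0 'k::field) ring) (monoid_ring \<Delta>)"
proof -
  let ?R = "monoid_ring \<Gamma> :: ('m \<Rightarrow>\<^sub>0 'k) ring" and ?S = "monoid_ring \<Delta> :: ('n \<Rightarrow>\<^sub>0 'k) ring"
  let ?g = "inv_into \<Gamma> f"
  have g: "?g (f t) = t" if "t \<in> \<Gamma>" for t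
    using that bij by (simp add: bij_betw_def inv_into_f_f)
  have f': "f (?g u) = u" "?g u \<in> \<Gamma>" if "u \<in> \<Delta>" for u
    using that bij by (auto simp: bij_betw_def f_inv_into_f inv_into_into)
  have closed: "pushforward f p \<in> carrier ?S" if "p \<in> carrier ?R" for p
  proof -
    have "f ` keys p \<subseteq> \<Delta>" using that bij by (auto simp: bij_betw_def)
    then show ?thesis using keys_pushforward[of f p] by (simp add: subset_trans)
  qed
  have hom: "pushforward f \<in> ring_hom ?R ?S"
    using closed f pushforward_single[of f 0 "1::'k"]
    by (intro ring_hom_memI) (simp_all add: pushforward_add pushforward_mult)
  have "bij_betw (pushforward f) (carrier ?R) (carrier ?S)"
  proof (rule bij_betw_byWitness[of _ "pushforward ?g"])
    show "\<forall>p\<in>carrier ?R. pushforward ?g (pushforward f p) = p"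
      using g by (auto intro!: pushforward_inverse)
    show "\<forall>q\<in>carrier ?S. pushforward f (pushforward ?g q) = q"
      using f' by (auto intro!: pushforward_inverse)
    show "pushforward f ` carrier ?R \<subseteq> carrier ?S" using closed by blast
    show "pushforward ?g ` carrier ?S \<subseteq> carrier ?R"
      using keys_pushforward[of ?g] f' by fastforce
  qed
  then show ?thesis using hom by (simp add: ring_iso_def)
qed

text \<open>
  The exponent of the monomial obtained from \<open>t\<close> when the \<open>i\<close>-th variable is replaced by the
  monomial with exponent \<open>s i\<close>.
\<close>
definition exponent_sum :: "(nat \<Rightarrow> 'x \<Rightarrow>\<^sub>0 nat) \<Rightarrow> nat \<Rightarrow> (nat \<Rightarrow>\<^sub>0 nat) \<Rightarrow> 'x \<Rightarrow>\<^sub>0 nat" where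
  "exponent_sum s n t = (\<Sum>i<n. Poly_Mapping.map ((*) (lookup t i)) (s i))"

lemma lookup_exponent_sum: "lookup (exponent_sum s n t) x = (\<Sum>i<n. lookup t i * lookup (s i) x)"
  by (simp add: exponent_sum_def lookup_sum Poly_Mapping.map.rep_eq when_def)
    (intro sum.cong; simp)

lemma exponent_sum_0 [simp]: "exponent_sum s n 0 = 0"
  by (rule poly_mapping_eqI) (simp add: lookup_exponent_sum)

lemma exponent_sum_add: "exponent_sum s n (t + u) = exponent_sum s n t + exponent_sum s n u"
  by (rule poly_mapping_eqI) (simp add: lookup_exponent_sum lookup_add distrib_right sum.distrib)

lemma exponent_sum_single: "i < n \<Longrightarrow> exponent_sum s n (single i 1) = s i"
  by (rule poly_mapping_eqI)
    (simp add: lookup_exponent_sum lookup_single when_def if_distrib[of "\<lambda>x. x * _"] cong: if_cong)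

lemma power_monoid_param:
  assumes s: "bij_betw s {..<n} S"
  shows "(\<lambda>t. (weight {..<n} t, exponent_sum s n t)) ` {t. keys t \<subseteq> {..<n}} = power_monoid S"
proof (intro equalityI subsetI)
  fix y assume "y \<in> (\<lambda>t. (weight {..<n} t, exponent_sum s n t)) ` {t. keys t \<subseteq> {..<n}}"
  then obtain t where t: "keys t \<subseteq> {..<n}" "y = (weight {..<n} t, exponent_sum s n t)" by auto
  have "exponent_sum s n t \<in> fold_sums S (weight {..<n} t)"
    using t(1)
  proof (induction "weight {..<n} t" arbitrary: t)
    case 0
    then show ?case using weight_eq_0[of "{..<n}" t] by simp
  next
    case (Suc k)
    then have "t \<noteq> 0" by (metis nat.distinct(1) weight_0)
    then obtain j where j: "j \<in> keys t" by (metis keys_eq_empty ex_in_conv)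
    define u where "u = t - single j 1"
    have t: "t = u + single j 1" using split_off_variable[OF j] by (simp add: u_def add.commute)
    have jn: "j < n" "keys u \<subseteq> {..<n}" using j Suc.prems unfolding t by (auto simp: keys_nat_add)
    have "weight {..<n} t = Suc (weight {..<n} u)"
      using jn by (simp add: t weight_add weight_single)
    then have "exponent_sum s n u \<in> fold_sums S k" "Suc k = weight {..<n} t"
      using Suc.hyps jn by auto
    moreover have "s j \<in> S" using s jn by (auto simp: bij_betw_def)
    ultimately show ?case
      using jn \<open>weight {..<n} t = Suc (weight {..<n} u)\<close> exponent_sum_single[OF jn(1), of s]
      by (auto simp: t exponent_sum_add)
  qed
  then show "y \<in> power_monoid S" using t by (simp add: power_monoid_def)
next
  fix y assume "y \<in> power_monoid S"
  then obtain k w where y: "y = (k, w)" "w \<in> fold_sums S k" by (auto simp: power_monoid_def)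
  have "\<exists>t. keys t \<subseteq> {..<n} \<and> weight {..<n} t = k \<and> exponent_sum s n t = w"
    using y(2)
  proof (induction k arbitrary: w)
    case 0 then show ?case by (intro exI[of _ 0]) simp
  next
    case (Suc k)
    then obtain w' a where w: "w = w' + a" "w' \<in> fold_sums S k" "a \<in> S" by auto
    obtain t where t: "keys t \<subseteq> {..<n}" "weight {..<n} t = k" "exponent_sum s n t = w'"
      using Suc.IH[OF w(2)] by blast
    have "a \<in> s ` {..<n}" using w(3) s by (simp add: bij_betw_def)
    then obtain i where i: "i < n" "a = s i" by auto
    then show ?case
      using t w i exponent_sum_single[OF i(1), of s]
      by (intro exI[of _ "t + single i 1"])
        (auto simp: keys_nat_add weight_add weight_single exponent_sum_add)
  qed
  then show "y \<in> (\<lambda>t. (weight {..<n} t, exponent_sum s n t)) ` {t. keys t \<subseteq> {..<n}}" using y by force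
qed

theorem free_power_monoid_ring:
  assumes s: "bij_betw s {..<n} S"
    and inj: "inj_on (\<lambda>t. (weight {..<n} t, exponent_sum s n t)) {t. keys t \<subseteq> {..<n}}"
  shows "\<exists>h \<in> ring_iso (mpoly_ring {..<n} :: (nat, 'k::field) mpoly ring) (monoid_ring (power_monoid S)).
     \<forall>c. h (poly_const c) = single 0 c"
proof
  let ?f = "\<lambda>t. (weight {..<n} t, exponent_sum s n t)"
  show "pushforward ?f \<in> ring_iso (mpoly_ring {..<n} :: (nat, 'k) mpoly ring) (monoid_ring (power_monoid S))"
    unfolding mpoly_ring_eq_monoid_ring
    by (rule pushforward_ring_iso) (use inj power_monoid_param[OF s] in \<open>auto simp: weight_add exponent_sum_add bij_betw_def zero_prod_def\<close>)
  show "\<forall>c. pushforward ?f (poly_const c) = single 0 c"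
    by (simp add: poly_const_def zero_prod_def)
qed

text \<open>
  The degree-1 coefficients \<open>D p\<close> of \<open>h p\<close> satisfy the Leibniz rule
  \<open>D (pq) = h(p)\<^sub>0 D q + h(q)\<^sub>0 D p\<close>, with constant terms as scalars. So the image of \<open>D\<close> is spanned by the \<open>n\<close>
  values on the variables. As \<open>h\<close> is onto, the image has dimension \<open>|S|\<close>.
\<close>
theorem card_le_of_polynomial:
  assumes S: "finite S"
    and h: "h \<in> ring_iso (mpoly_ring {..<n} :: (nat, 'k::field) mpoly ring) (monoid_ring (power_monoid S))"
    and const: "\<And>c. h (poly_const c) = single 0 c"
  shows "card S \<le> n"
proof (rule ccontr)
  assume "\<not> card S \<le> n"
  let ?R = "mpoly_ring {..<n} :: (nat, 'k) mpoly ring"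
  have hom: "h \<in> ring_hom ?R (monoid_ring (power_monoid S))"
    and bij: "bij_betw h (carrier ?R) (carrier (monoid_ring (power_monoid S)))"
    using h by (auto simp: ring_iso_def)
  let ?D = "\<lambda>p s. lookup (h p) (1, s)"
  have h_mult: "h (p * q) = h p * h q" "h (p + q) = h p + h q" if "p \<in> carrier ?R" "q \<in> carrier ?R" for p q
    using ring_hom_mult[OF hom that] ring_hom_add[OF hom that] by simp_all
  have leibniz: "?D (p * q) s = lookup (h p) 0 * ?D q s + ?D p s * lookup (h q) 0"
    if pq: "p \<in> carrier ?R" "q \<in> carrier ?R" for p q s
  proof -
    have comp0: "component 0 (h r) = single 0 (lookup (h r) 0)" if "r \<in> carrier ?R" for r
    proof -
      have "h r \<in> carrier (monoid_ring (power_monoid S))" using that bij by (auto simp: bij_betw_def)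
      then have "keys (component 0 (h r)) \<subseteq> {0}" using keys_component_power_monoid[of "h r" S 0] by simp
      from poly_mapping_sum_single[OF this] show ?thesis by (simp add: zero_prod_def)
    qed
    have "component 1 (h (p * q)) = component 0 (h p) * component 1 (h q) + component 1 (h p) * component 0 (h q)"
      by (simp add: h_mult[OF pq] component_mult)
    then have "lookup (component 1 (h (p * q))) s =
       lookup (single 0 (lookup (h p) 0) * component 1 (h q) + single 0 (lookup (h q) 0) * component 1 (h p)) s"
      by (simp only: comp0[OF pq(1)] comp0[OF pq(2)] mult.commute)
    then show ?thesis unfolding lookup_add lookup_single_0_mult lookup_component by (simp only: mult.commute)
  qed
  \<comment> \<open>the polynomials with \<open>D p\<close> in the span of the values of \<open>D\<close> on the variables\<close>
  define U where "U = {p \<in> carrier ?R. \<exists>M. \<forall>s. ?D p s = (\<Sum>i<n. M i * ?D (poly_var i) s)}"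
  have U_add: "p + q \<in> U" if pq: "p \<in> U" "q \<in> U" for p q
  proof -
    obtain M N where "\<And>s. ?D p s = (\<Sum>i<n. M i * ?D (poly_var i) s)" "\<And>s. ?D q s = (\<Sum>i<n. N i * ?D (poly_var i) s)"
      using pq by (auto simp: U_def)
    moreover have carr: "p \<in> carrier ?R" "q \<in> carrier ?R" using pq by (auto simp: U_def)
    ultimately have "\<forall>s. ?D (p + q) s = (\<Sum>i<n. (M i + N i) * ?D (poly_var i) s)"
      by (simp add: h_mult[OF carr] lookup_add distrib_right sum.distrib)
    then have "\<exists>M. \<forall>s. ?D (p + q) s = (\<Sum>i<n. M i * ?D (poly_var i) s)"
      by (intro exI[of _ "\<lambda>i. M i + N i"])
    moreover have "p + q \<in> carrier ?R" using carr keys_add[of p q] by auto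
    ultimately show ?thesis by (simp add: U_def)
  qed
  have U_mult: "p * q \<in> U" if pq: "p \<in> U" "q \<in> U" for p q
  proof -
    obtain M N where "\<And>s. ?D p s = (\<Sum>i<n. M i * ?D (poly_var i) s)" "\<And>s. ?D q s = (\<Sum>i<n. N i * ?D (poly_var i) s)"
      using pq by (auto simp: U_def)
    moreover have carr: "p \<in> carrier ?R" "q \<in> carrier ?R" using pq by (auto simp: U_def)
    ultimately have "\<forall>s. ?D (p * q) s =
        (\<Sum>i<n. (lookup (h p) 0 * N i + M i * lookup (h q) 0) * ?D (poly_var i) s)"
      by (simp add: leibniz[OF carr] sum.distrib sum_distrib_left sum_distrib_right algebra_simps
          del: One_nat_def)
    then have "\<exists>M. \<forall>s. ?D (p * q) s = (\<Sum>i<n. M i * ?D (poly_var i) s)"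
      by (intro exI[of _ "\<lambda>i. lookup (h p) 0 * N i + M i * lookup (h q) 0"])
    moreover have "p * q \<in> carrier ?R" using keys_mult_submonoid[OF submonoid_vars, of p "{..<n}" q] carr by auto
    ultimately show ?thesis by (simp add: U_def)
  qed
  have U_const: "single 0 c \<in> U" for c
    using const[of c] unfolding U_def poly_const_def
    by (auto simp: lookup_single when_def zero_prod_def intro!: exI[of _ "\<lambda>_. 0"])
  have U_var: "poly_var j \<in> U" if "j < n" for j
    using that unfolding U_def
    by (auto simp: poly_var_def if_distrib[of "\<lambda>x. x * _"] cong: if_cong intro!: exI[of _ "\<lambda>i. if i = j then 1 else 0"])
  have U_monomial: "single t c \<in> U" if "keys t \<subseteq> {..<n}" for t c
    using that
  proof (induction "weight {..<n} t" arbitrary: t)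
    case 0
    then show ?case using weight_eq_0[of "{..<n}" t] U_const by simp
  next
    case (Suc k)
    then have "t \<noteq> 0" by (metis nat.distinct(1) weight_0)
    then obtain j where j: "j \<in> keys t" by (metis keys_eq_empty ex_in_conv)
    define u where "u = t - single j 1"
    have t: "t = single j 1 + u" using split_off_variable[OF j] by (simp add: u_def)
    have jn: "j < n" "keys u \<subseteq> {..<n}" using j Suc.prems unfolding t by (auto simp: keys_nat_add)
    have "k = weight {..<n} u" using jn Suc.hyps(2) by (simp add: t weight_add weight_single)
    then have "poly_var j * single u c \<in> U" using U_mult U_var Suc.hyps(1) jn by blast
    then show ?case by (simp add: t poly_var_def mult_single)
  qed
  have U_all: "p \<in> U" if p: "p \<in> carrier ?R" for p
  proof -
    have "(\<Sum>t\<in>A. single t (lookup p t)) \<in> U" if "finite A" "A \<subseteq> keys p" for A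
      using that
    proof (induction A rule: finite_induct)
      case empty then show ?case using U_const[of 0] by simp
    next
      case (insert t A) then show ?case using p by (auto intro!: U_add U_monomial)
    qed
    then show ?thesis using poly_mapping_sum_single[of p "keys p"] by (metis finite_keys order_refl)
  qed
  have "\<exists>M. \<forall>s. lookup (single (1, s0) (1::'k)) (1::nat, s) = (\<Sum>i<n. M i * ?D (poly_var i) s)" if "s0 \<in> S" for s0
  proof -
    have "single (1, s0) (1::'k) \<in> carrier (monoid_ring (power_monoid S))"
      using that by (simp add: power_monoid_def)
    then have "single (1, s0) (1::'k) \<in> h ` carrier ?R" using bij by (simp add: bij_betw_def)
    then obtain p where p: "p \<in> carrier ?R" "h p = single (1, s0) 1" by (metis imageE)
    then show ?thesis using U_all[OF p(1)] by (simp add: U_def)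
  qed
  then obtain M where M: "\<And>s0 s. s0 \<in> S \<Longrightarrow>
      lookup (single (1, s0) (1::'k)) (1::nat, s) = (\<Sum>i<n. M s0 i * ?D (poly_var i) s)" by metis
  obtain e where e: "\<exists>a\<in>S. e a \<noteq> 0" "\<forall>i\<in>{..<n}. (\<Sum>a\<in>S. e a * M a i) = 0"
    using underdetermined_system[of "{..<n}" S M] S \<open>\<not> card S \<le> n\<close> by auto
  then obtain s where s: "s \<in> S" "e s \<noteq> 0" by blast
  have "e s = (\<Sum>a\<in>S. e a * lookup (single (1, a) (1::'k)) (1::nat, s))"
    using s S by (simp add: lookup_single when_def if_distrib[of "\<lambda>x. _ * x"] cong: if_cong)
  also have "\<dots> = (\<Sum>a\<in>S. \<Sum>i<n. e a * M a i * ?D (poly_var i) s)"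
    using M by (simp add: sum_distrib_left mult.assoc)
  also have "\<dots> = (\<Sum>i<n. (\<Sum>a\<in>S. e a * M a i) * ?D (poly_var i) s)"
    by (subst sum.swap) (simp add: sum_distrib_right)
  also have "\<dots> = 0" using e by simp
  finally show False using s by simp
qed

lemma common_denominator:
  assumes "finite C"
  shows "\<exists>N::nat. N > 0 \<and> (\<forall>c\<in>C. \<exists>m::int. of_nat N * c = (of_int m :: rat))"
  using assms
proof (induction C rule: finite_induct)
  case empty then show ?case by (intro exI[of _ 1]) simp
next
  case (insert c C)
  then obtain N where N: "N > 0" "\<forall>c\<in>C. \<exists>m::int. of_nat N * c = (of_int m :: rat)" by blast
  obtain a b where ab: "quotient_of c = (a, b)" by fastforce
  have b: "b > 0" "c = of_int a / of_int b" using quotient_of_denom_pos[OF ab] quotient_of_div[OF ab] by auto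
  have "of_nat (N * nat b) * c = of_int (int N * a)" using b by simp
  then have "\<exists>m::int. of_nat (N * nat b) * c = of_int m" by blast
  moreover have "\<exists>m::int. of_nat (N * nat b) * x = (of_int m :: rat)" if x: "x \<in> C" for x
  proof -
    obtain m where "of_nat N * x = of_int m" using N x by blast
    then have "of_nat (N * nat b) * x = of_int (m * b)" using b by (simp add: mult_ac)
    then show ?thesis by blast
  qed
  ultimately show ?case using N b by (intro exI[of _ "N * nat b"] conjI ballI) (auto simp del: of_nat_mult)
qed

text \<open>
  A \<open>k\<close>-fold sum of \<open>S\<close> has coordinates with respect to \<open>B\<close> that have a fixed denominator \<open>N\<close> and are
  of size \<open>O(k)\<close>, so there are only \<open>O(L\<^bsup>|B|\<^esup>)\<close> elements with \<open>k \<le> L\<close>. Since \<open>d > 0\<close>, the vector determines \<open>k\<close>.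
\<close>
theorem krull_dim_power_monoid_le:
  assumes fin: "finite X" "finite S" "S \<subseteq> {t. keys t \<subseteq> X}" and d: "\<And>s. s \<in> S \<Longrightarrow> weight X s = d" "0 < d"
    and B: "B \<subseteq> S" "S \<subseteq> rational_span B"
  shows "krull_dim (monoid_ring (power_monoid S) :: ('x, 'k::field) graded_mpoly ring) \<le> enat (card B)"
proof -
  have finB: "finite B" using B fin finite_subset by blast
  have "\<exists>c :: _ \<Rightarrow> rat. \<forall>x. of_nat (lookup s x) = (\<Sum>b\<in>B. c b * of_nat (lookup b x))" if "s \<in> S" for s
    using that B by (auto simp: rational_span_def)
  then obtain c :: "_ \<Rightarrow> _ \<Rightarrow> rat" where c: "\<And>s x. s \<in> S \<Longrightarrow> of_nat (lookup s x) = (\<Sum>b\<in>B. c s b * of_nat (lookup b x))"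
    by metis
  obtain N where N: "N > 0" "\<forall>r\<in>(\<lambda>(s, b). c s b) ` (S \<times> B). \<exists>m::int. of_nat N * r = of_int m"
    using common_denominator[of "(\<lambda>(s, b). c s b) ` (S \<times> B)"] fin finB by auto
  then have "\<exists>m::int. of_nat N * c s b = of_int m" if "s \<in> S" "b \<in> B" for s b using that by force
  then obtain m :: "_ \<Rightarrow> _ \<Rightarrow> int" where m: "\<And>s b. s \<in> S \<Longrightarrow> b \<in> B \<Longrightarrow> of_nat N * c s b = of_int (m s b)"
    by metis
  have gen: "int N * int (lookup s x) = (\<Sum>b\<in>B. m s b * int (lookup b x))" if "s \<in> S" for s x
  proof -
    have "of_int (int N * int (lookup s x)) = (of_int (\<Sum>b\<in>B. m s b * int (lookup b x)) :: rat)"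
      using c[OF that, of x] m[OF that] by (simp add: sum_distrib_left mult.assoc[symmetric])
    then show ?thesis by (simp only: of_int_eq_iff)
  qed
  have "finite ((\<lambda>(s, b). nat \<bar>m s b\<bar>) ` (S \<times> B))" using fin finB by auto
  then obtain M where M: "\<forall>k\<in>(\<lambda>(s, b). nat \<bar>m s b\<bar>) ` (S \<times> B). k \<le> M"
    using finite_nat_set_iff_bounded_le by auto
  then have M: "\<bar>m s b\<bar> \<le> int M" if "s \<in> S" "b \<in> B" for s b using that by force
  have coord: "\<exists>g::_ \<Rightarrow> int. (\<forall>b\<in>B. \<bar>g b\<bar> \<le> int (k * M)) \<and> (\<forall>x. int N * int (lookup w x) = (\<Sum>b\<in>B. g b * int (lookup b x)))"
    if "w \<in> fold_sums S k" for k w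
    using that
  proof (induction k arbitrary: w)
    case 0 then show ?case by (intro exI[of _ "\<lambda>_. 0"]) simp
  next
    case (Suc k)
    then obtain v s where w: "w = v + s" "v \<in> fold_sums S k" "s \<in> S" by auto
    obtain g where g: "\<forall>b\<in>B. \<bar>g b\<bar> \<le> int (k * M)" "\<forall>x. int N * int (lookup v x) = (\<Sum>b\<in>B. g b * int (lookup b x))"
      using Suc.IH[OF w(2)] by blast
    have "\<bar>g b + m s b\<bar> \<le> int (Suc k * M)" if "b \<in> B" for b
      using g(1) M[OF w(3) that] that by fastforce
    moreover have "int N * int (lookup w x) = (\<Sum>b\<in>B. (g b + m s b) * int (lookup b x))" for x
      using g(2) gen[OF w(3), of x] by (simp add: w lookup_add distrib_left distrib_right sum.distrib)
    ultimately show ?case by (intro exI[of _ "\<lambda>b. g b + m s b"]) blast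
  qed
  define g :: "nat \<Rightarrow> ('x \<Rightarrow>\<^sub>0 nat) \<Rightarrow> ('x \<Rightarrow>\<^sub>0 nat) \<Rightarrow> int" where
    "g k w = (SOME g. (\<forall>b\<in>B. \<bar>g b\<bar> \<le> int (k * M)) \<and> (\<forall>x. int N * int (lookup w x) = (\<Sum>b\<in>B. g b * int (lookup b x))))" for k w
  have "(\<forall>b\<in>B. \<bar>g k w b\<bar> \<le> int (k * M)) \<and> (\<forall>x. int N * int (lookup w x) = (\<Sum>b\<in>B. g k w b * int (lookup b x)))"
    if "w \<in> fold_sums S k" for k w
    unfolding g_def by (rule someI_ex[OF coord[OF that]])
  then have g: "\<And>k w b. w \<in> fold_sums S k \<Longrightarrow> b \<in> B \<Longrightarrow> \<bar>g k w b\<bar> \<le> int (k * M)"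
      "\<And>k w x. w \<in> fold_sums S k \<Longrightarrow> int N * int (lookup w x) = (\<Sum>b\<in>B. g k w b * int (lookup b x))"
    by blast+
  have growth: "finite {t \<in> power_monoid S. fst t \<le> L} \<and>
      card {t \<in> power_monoid S. fst t \<le> L} \<le> ((2 * M + 1) * (L + 1)) ^ card B" for L
  proof -
    let ?A = "{t \<in> power_monoid S. fst t \<le> L}" and ?P = "PiE B (\<lambda>_. {- int (L * M)..int (L * M)})"
    let ?g = "\<lambda>(k, w). restrict (g k w) B"
    have inj: "inj_on ?g ?A"
    proof (rule inj_onI)
      fix p q assume pq: "p \<in> ?A" "q \<in> ?A" "?g p = ?g q"
      obtain k w where p: "p = (k, w)" "w \<in> fold_sums S k" using pq by (auto simp: power_monoid_def)
      obtain l v where q: "q = (l, v)" "v \<in> fold_sums S l" using pq by (auto simp: power_monoid_def)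
      have eq: "g k w b = g l v b" if "b \<in> B" for b
        using fun_cong[OF pq(3), of b] p q that by simp
      have "int N * int (lookup w x) = int N * int (lookup v x)" for x
        using g(2)[OF p(2), of x] g(2)[OF q(2), of x] eq by simp
      then have "w = v" using N by (intro poly_mapping_eqI) simp
      moreover have "k * d = l * d"
        using weight_fold_sums[OF d(1) p(2)] weight_fold_sums[OF d(1) q(2)] \<open>w = v\<close> by metis
      ultimately show "p = q" using p(1) q(1) d(2) by auto
    qed
    have sub: "?g ` ?A \<subseteq> ?P"
    proof (rule image_subsetI)
      fix p assume "p \<in> ?A"
      then obtain k w where p: "p = (k, w)" "w \<in> fold_sums S k" "k \<le> L" by (auto simp: power_monoid_def)
      have bound: "\<bar>g k w b\<bar> \<le> int (L * M)" if "b \<in> B" for b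
      proof -
        have "k * M \<le> L * M" using p by simp
        then show ?thesis using g(1)[OF p(2) that] by linarith
      qed
      then have "g k w b \<in> {- int (L * M)..int (L * M)}" if "b \<in> B" for b
        using bound[OF that] unfolding abs_le_iff atLeastAtMost_iff by linarith
      then show "?g p \<in> ?P" unfolding p(1) prod.case by (intro restrict_PiE_iff[THEN iffD2] ballI)
    qed
    have P: "finite ?P" "card ?P = (2 * (L * M) + 1) ^ card B"
      using finB by (simp_all add: finite_PiE card_PiE nat_add_distrib nat_mult_distrib)
    have "finite ?A" by (rule inj_on_finite[OF inj sub P(1)])
    moreover have "card ?A \<le> (2 * (L * M) + 1) ^ card B" using card_inj_on_le[OF inj sub P(1)] P(2) by simp
    moreover have "(2 * (L * M) + 1) ^ card B \<le> ((2 * M + 1) * (L + 1)) ^ card B"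
      by (rule power_mono) (simp_all add: algebra_simps)
    ultimately show ?thesis by linarith
  qed
  show ?thesis
    by (rule krull_dim_le_of_growth[OF submonoid_power_monoid, of fst _ "2 * M + 1"]) (use growth in auto)
qed

section \<open>Cycle matroids of graphs\<close>

text \<open>
  The boundary of a finite set of edges modulo 2. Under symmetric difference, the finite sets of edges
  are a vector space over the field with two elements, on which this map is linear.
\<close>
definition odd_vertices :: "'v set set \<Rightarrow> 'v set" where
  "odd_vertices A = {v. odd (card {e\<in>A. v \<in> e})}"

lemma odd_vertices_empty [simp]: "odd_vertices {} = {}"
  by (simp add: odd_vertices_def)

lemma odd_vertices_sym_diff:
  assumes "finite A" "finite B"
  shows "odd_vertices (sym_diff A B) = sym_diff (odd_vertices A) (odd_vertices B)"
proof -
  have "odd (card {e\<in>sym_diff A B. v \<in> e}) \<longleftrightarrow> odd (card {e\<in>A. v \<in> e}) \<noteq> odd (card {e\<in>B. v \<in> e})" for v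
  proof -
    let ?A = "{e\<in>A. v \<in> e}" and ?B = "{e\<in>B. v \<in> e}"
    have fin: "finite ?A" "finite ?B" using assms by auto
    have "{e\<in>sym_diff A B. v \<in> e} = (?A - ?B) \<union> (?B - ?A)" by auto
    then have "card {e\<in>sym_diff A B. v \<in> e} = card (?A - ?B) + card (?B - ?A)"
      using fin by (simp only:) (rule card_Un_disjoint; auto)
    moreover have "card ?A = card (?A - ?B) + card (?A \<inter> ?B)" "card ?B = card (?B - ?A) + card (?A \<inter> ?B)"
      using fin by (simp_all add: card_Diff_subset_Int Int_commute card_mono)
    ultimately show ?thesis by auto
  qed
  then show ?thesis by (auto simp: odd_vertices_def)
qed

text \<open>
  Linear independence modulo 2 of the boundaries of the edges of \<open>A\<close>. For a finite graph it agrees with the absence of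
  cycles by \<open>acyclic_graph_iff\<close>.
\<close>
definition acyclic_edges :: "'v set set \<Rightarrow> bool" where
  "acyclic_edges A \<longleftrightarrow> (\<forall>S\<subseteq>A. odd_vertices S = {} \<longrightarrow> S = {})"

definition edge_basis :: "'v set set \<Rightarrow> 'v set set \<Rightarrow> bool" where
  "edge_basis E A \<longleftrightarrow> A \<subseteq> E \<and> acyclic_edges A \<and> (\<forall>A'. A \<subseteq> A' \<and> A' \<subseteq> E \<and> acyclic_edges A' \<longrightarrow> A' = A)"

lemma sym_diff_cancel: "sym_diff A B = {} \<longleftrightarrow> A = B"
  by blast

lemma edge_basis_fundamental:
  assumes E: "finite E" and A: "edge_basis E A" and e: "e \<in> E" "e \<notin> A"
  shows "\<exists>S\<subseteq>insert e A. e \<in> S \<and> odd_vertices S = {}"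
proof -
  have "\<not> acyclic_edges (insert e A)" using A e unfolding edge_basis_def by blast
  then obtain S where S: "S \<subseteq> insert e A" "odd_vertices S = {}" "S \<noteq> {}" by (auto simp: acyclic_edges_def)
  have "e \<in> S"
  proof (rule ccontr)
    assume "e \<notin> S"
    then have "S \<subseteq> A" using S by blast
    then show False using A S by (auto simp: edge_basis_def acyclic_edges_def)
  qed
  then show ?thesis using S by blast
qed

lemma edge_basis_spans:
  assumes E: "finite E" and A: "edge_basis E A" and S: "S \<subseteq> E"
  shows "\<exists>T\<subseteq>A. odd_vertices T = odd_vertices S"
proof -
  have "finite S" using E S by (rule finite_subset[rotated])
  then show ?thesis using S
  proof (induction S rule: finite_induct)
    case empty then show ?case by blast
  next
    case (insert e S)
    then obtain T where T: "T \<subseteq> A" "odd_vertices T = odd_vertices S" by blast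
    have finA: "finite A" using A E by (auto simp: edge_basis_def intro: finite_subset)
    have fin: "finite T" "finite S" using T finA insert by (auto intro: finite_subset)
    have "\<exists>U\<subseteq>A. odd_vertices U = odd_vertices {e}"
    proof (cases "e \<in> A")
      case True then show ?thesis by blast
    next
      case False
      have "e \<in> E" using insert.prems by simp
      then obtain V where V: "V \<subseteq> insert e A" "e \<in> V" "odd_vertices V = {}"
        using edge_basis_fundamental[OF E A _ False] by metis
      have "finite V" using V finA by (auto intro: finite_subset)
      then have "odd_vertices (sym_diff V {e}) = odd_vertices {e}"
        using V by (subst odd_vertices_sym_diff) auto
      moreover have "sym_diff V {e} \<subseteq> A" using V by auto
      ultimately show ?thesis by blast
    qed
    then obtain U where U: "U \<subseteq> A" "odd_vertices U = odd_vertices {e}" by blast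
    have "finite U" using U finA by (auto intro: finite_subset)
    then have "odd_vertices (sym_diff T U) = odd_vertices (sym_diff S {e})"
      using fin T U by (simp add: odd_vertices_sym_diff)
    moreover have "sym_diff S {e} = insert e S" using insert.hyps by auto
    ultimately have "odd_vertices (sym_diff T U) = odd_vertices (insert e S)" by simp
    moreover have "sym_diff T U \<subseteq> A" using T U by auto
    ultimately show ?case by (intro exI[of _ "sym_diff T U"]) simp
  qed
qed

text \<open>
  Distinct subsets of an acyclic set have distinct boundaries, and each of these is the boundary of
  a subset of the basis \<open>A\<close>, so \<open>2\<^bsup>|B|\<^esup> \<le> 2\<^bsup>|A|\<^esup>\<close>.
\<close>
lemma card_acyclic_edges_le:
  assumes E: "finite E" and A: "edge_basis E A" and B: "B \<subseteq> E" "acyclic_edges B"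
  shows "card B \<le> card A"
proof -
  have fin: "finite A" "finite B" using A B E by (auto simp: edge_basis_def intro: finite_subset)
  have "\<forall>S\<in>Pow B. \<exists>T. T \<subseteq> A \<and> odd_vertices T = odd_vertices S"
    using edge_basis_spans[OF E A] B by auto
  then obtain g where g: "\<And>S. S \<in> Pow B \<Longrightarrow> g S \<subseteq> A \<and> odd_vertices (g S) = odd_vertices S" by metis
  have "inj_on g (Pow B)"
  proof (rule inj_onI)
    fix S T assume ST: "S \<in> Pow B" "T \<in> Pow B" "g S = g T"
    then have "finite S" "finite T" using fin by (auto intro: finite_subset)
    moreover have "odd_vertices S = odd_vertices T" using g ST by metis
    ultimately have "odd_vertices (sym_diff S T) = {}" by (simp add: odd_vertices_sym_diff)
    moreover have "sym_diff S T \<subseteq> B" using ST by auto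
    ultimately have "sym_diff S T = {}" using B(2) unfolding acyclic_edges_def by (elim allE[of _ "sym_diff S T"]) blast
    then show "S = T" by blast
  qed
  moreover have "g ` Pow B \<subseteq> Pow A" using g by auto
  ultimately have "card (Pow B) \<le> card (Pow A)" using fin by (intro card_inj_on_le) auto
  then show ?thesis using fin by (simp add: card_Pow)
qed

lemma edge_basis_if_card:
  assumes E: "finite E" and A: "edge_basis E A" and B: "B \<subseteq> E" "acyclic_edges B" "card B = card A"
  shows "edge_basis E B"
  unfolding edge_basis_def
proof (intro conjI allI impI)
  fix A' assume A': "B \<subseteq> A' \<and> A' \<subseteq> E \<and> acyclic_edges A'"
  then have "card A' \<le> card B" using card_acyclic_edges_le[OF E A] B by simp
  moreover have "finite A'" using A' E by (auto intro: finite_subset)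
  ultimately show "A' = B" using A' by (metis card_seteq)
qed (use B in auto)

lemma card_edge_basis_eq:
  "finite E \<Longrightarrow> edge_basis E A \<Longrightarrow> edge_basis E B \<Longrightarrow> card B = card A"
  by (meson card_acyclic_edges_le edge_basis_def le_antisym)

lemma finite_edge_bases:
  assumes "finite E"
  shows "finite {A. edge_basis E A}"
proof (rule finite_subset)
  show "{A. edge_basis E A} \<subseteq> Pow E" by (auto simp: edge_basis_def)
qed (use assms in simp)

lemma edge_basis_exists:
  assumes "finite E"
  shows "\<exists>A. edge_basis E A"
proof -
  have "\<exists>A. (A \<subseteq> E \<and> acyclic_edges A) \<and> (\<forall>B. B \<subseteq> E \<and> acyclic_edges B \<longrightarrow> card B \<le> card A)"
  proof (rule Lattices_Big.ex_has_greatest_nat)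
    show "{} \<subseteq> E \<and> acyclic_edges {}" by (simp add: acyclic_edges_def)
    show "\<forall>B. B \<subseteq> E \<and> acyclic_edges B \<longrightarrow> card B < Suc (card E)"
      using assms by (simp add: card_mono less_Suc_eq_le)
  qed
  then obtain A where "A \<subseteq> E" "acyclic_edges A" "\<And>B. B \<subseteq> E \<Longrightarrow> acyclic_edges B \<Longrightarrow> card B \<le> card A"
    by blast
  then have "edge_basis E A"
    unfolding edge_basis_def using assms by (metis card_seteq finite_subset)
  then show ?thesis ..
qed

lemma cycle_edges_even:
  assumes vs: "distinct vs" "3 \<le> length vs"
  defines "C \<equiv> {{vs ! i, vs ! (Suc i mod length vs)} | i. i < length vs}"
  shows "odd_vertices C = {}" "C \<noteq> {}" "finite C" "\<Union> C = set vs"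
proof -
  define n where "n = length vs"
  let ?e = "\<lambda>i. {vs ! i, vs ! (Suc i mod n)}"
  have n: "3 \<le> n" "0 < n" using vs by (auto simp: n_def)
  have C: "C = ?e ` {..<n}" by (auto simp: C_def n_def)
  have nth: "vs ! i = vs ! j \<longleftrightarrow> i = j" if "i < n" "j < n" for i j
    using that vs by (simp add: n_def nth_eq_iff_index_eq)
  have suc: "Suc i mod n < n" for i using n by simp
  have inj: "inj_on ?e {..<n}"
  proof (rule inj_onI)
    fix i j assume ij: "i \<in> {..<n}" "j \<in> {..<n}" "?e i = ?e j"
    show "i = j"
    proof (rule ccontr)
      assume "i \<noteq> j"
      then have "vs ! i \<noteq> vs ! j" using ij nth by simp
      then have "vs ! i = vs ! (Suc j mod n)" "vs ! j = vs ! (Suc i mod n)"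
        using ij(3) by (auto simp: doubleton_eq_iff)
      then have "i = Suc j mod n" "j = Suc i mod n" using nth suc ij by auto
      moreover have "Suc i mod n = (if Suc i = n then 0 else Suc i)" "Suc j mod n = (if Suc j = n then 0 else Suc j)"
        using ij by auto
      ultimately have "Suc i = n \<and> j = 0 \<or> j = Suc i" "Suc j = n \<and> i = 0 \<or> i = Suc j"
        by metis+
      then show False using n by arith
    qed
  qed
  show "finite C" "C \<noteq> {}" using n by (auto simp: C lessThan_empty_iff)
  show "\<Union> C = set vs"
    using suc by (auto simp: C set_conv_nth n_def[symmetric])
  have "even (card {e\<in>C. v \<in> e})" for v
  proof (cases "v \<in> set vs")
    case False
    then have "{e\<in>C. v \<in> e} = {}" using \<open>\<Union> C = set vs\<close> by blast
    then show ?thesis by (simp only: card.empty even_zero)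
  next
    case True
    then obtain j where j: "j < n" "v = vs ! j" by (auto simp: in_set_conv_nth n_def)
    define j' where "j' = (if j = 0 then n - 1 else j - 1)"
    have j': "j' < n" "j' \<noteq> j" "Suc j' mod n = j" using j n by (auto simp: j'_def)
    have pred: "i = j'" if "i < n" "Suc i mod n = j" for i
      using that j n by (auto simp: j'_def mod_Suc split: if_splits)
    have mem: "v \<in> ?e i \<longleftrightarrow> i = j \<or> i = j'" if "i < n" for i
      unfolding j(2) insert_iff empty_iff nth[OF j(1) that] nth[OF j(1) suc[of i]]
      using pred[OF that] j'(3) by metis
    have "{e\<in>C. v \<in> e} = ?e ` {i\<in>{..<n}. v \<in> ?e i}" unfolding C by blast
    also have "{i\<in>{..<n}. v \<in> ?e i} = {j, j'}" using mem j(1) j'(1) by blast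
    finally have "{e\<in>C. v \<in> e} = ?e ` {j, j'}" .
    moreover have "card (?e ` {j, j'}) = 2"
    proof -
      have "inj_on ?e {j, j'}" by (rule inj_on_subset[OF inj]) (use j(1) j'(1) in auto)
      then have "card (?e ` {j, j'}) = card {j, j'}" by (rule card_image)
      also have "\<dots> = 2" using j'(2) by simp
      finally show ?thesis .
    qed
    ultimately show ?thesis by simp
  qed
  then show "odd_vertices C = {}" by (simp add: odd_vertices_def)
qed

lemma cycle_graph_even:
  assumes "cycle_graph C"
  shows "odd_vertices (edges C) = {}" "edges C \<noteq> {}" "finite (edges C)" "verts C = \<Union> (edges C)"
proof -
  obtain vs where "distinct vs" "3 \<le> length vs" and *: "verts C = set vs"
      "edges C = {{vs ! i, vs ! (Suc i mod length vs)} | i. i < length vs}"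
    using assms by (auto simp: cycle_graph_def)
  from cycle_edges_even[OF this(1,2)] *
  show "odd_vertices (edges C) = {}" "edges C \<noteq> {}" "finite (edges C)" "verts C = \<Union> (edges C)" by auto
qed

text \<open>
  The first vertex of a longest path has a second edge, because its degree is even. This edge ends on
  the path and closes a cycle.
\<close>
lemma even_edges_contain_cycle:
  assumes S: "finite S" "S \<noteq> {}" "\<And>e. e \<in> S \<Longrightarrow> card e = 2" and even: "odd_vertices S = {}"
  shows "\<exists>C. cycle_graph C \<and> edges C \<subseteq> S"
proof -
  define is_path where "is_path vs \<longleftrightarrow> distinct vs \<and> 2 \<le> length vs \<and>
     (\<forall>i. Suc i < length vs \<longrightarrow> {vs ! i, vs ! Suc i} \<in> S)" for vs
  have finV: "finite (\<Union> S)" using S card_ge_0_finite by (metis finite_Union zero_less_numeral)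
  have len: "length vs \<le> card (\<Union> S)" if "is_path vs" for vs
  proof -
    have "vs ! i \<in> \<Union> S" if i: "i < length vs" for i
    proof (cases "Suc i < length vs")
      case True
      then have "{vs ! i, vs ! Suc i} \<in> S" using \<open>is_path vs\<close> by (simp add: is_path_def)
      then show ?thesis by blast
    next
      case False
      then obtain k where k: "i = Suc k" "Suc k < length vs"
        using i \<open>is_path vs\<close> by (cases i) (auto simp: is_path_def)
      then have "{vs ! k, vs ! Suc k} \<in> S" using \<open>is_path vs\<close> by (simp add: is_path_def)
      then show ?thesis using k by blast
    qed
    then have "set vs \<subseteq> \<Union> S" by (metis in_set_conv_nth subsetI)
    then have "card (set vs) \<le> card (\<Union> S)" using finV by (intro card_mono)
    then show ?thesis using that by (simp add: is_path_def distinct_card)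
  qed
  obtain e where e: "e \<in> S" using S by blast
  then obtain x y where "e = {x, y}" "x \<noteq> y" using S(3) by (meson card_2_iff)
  then have "is_path [x, y]" using e by (simp add: is_path_def)
  then have "\<exists>vs. is_path vs \<and> (\<forall>us. is_path us \<longrightarrow> length us \<le> length vs)"
    using len by (intro Lattices_Big.ex_has_greatest_nat[of is_path _ length "Suc (card (\<Union> S))"]) (auto simp: less_Suc_eq_le)
  then obtain vs where vs: "is_path vs" "\<And>us. is_path us \<Longrightarrow> length us \<le> length vs" by blast
  have vs': "distinct vs" "2 \<le> length vs" "\<And>i. Suc i < length vs \<Longrightarrow> {vs ! i, vs ! Suc i} \<in> S"
    using vs(1) by (auto simp: is_path_def)
  let ?a = "vs ! 0" and ?b = "vs ! 1"
  have ab: "{?a, ?b} \<in> {e\<in>S. ?a \<in> e}" using vs'(3)[of 0] vs'(2) by simp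
  have "even (card {e\<in>S. ?a \<in> e})" using even by (auto simp: odd_vertices_def)
  moreover have "card {e\<in>S. ?a \<in> e} \<noteq> 0" using ab S(1) by auto
  ultimately have "{e\<in>S. ?a \<in> e} \<noteq> {{?a, ?b}}" by (metis One_nat_def card_1_singleton_iff odd_one)
  then obtain f where f: "f \<in> S" "?a \<in> f" "f \<noteq> {?a, ?b}" using ab by blast
  then obtain c where c: "f = {?a, c}" "c \<noteq> ?a" using S(3)[OF f(1)] by (metis card_2_iff doubleton_eq_iff insertE singletonD)
  have "c \<noteq> ?b" using f c by auto
  have "c \<in> set vs"
  proof (rule ccontr)
    assume "c \<notin> set vs"
    have "is_path (c # vs)"
      unfolding is_path_def
    proof (intro conjI allI impI)
      fix i assume "Suc i < length (c # vs)"
      then show "{(c # vs) ! i, (c # vs) ! Suc i} \<in> S"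
        using f c vs'(3)[of "i - 1"] by (cases i) (auto simp: insert_commute)
    qed (use \<open>c \<notin> set vs\<close> vs' in auto)
    then show False using vs(2)[of "c # vs"] by simp
  qed
  then obtain j where j: "j < length vs" "c = vs ! j" by (metis in_set_conv_nth)
  have j2: "2 \<le> j"
    using j c \<open>c \<noteq> ?b\<close> by (metis One_nat_def less_2_cases not_less)
  define us where "us = take (Suc j) vs"
  have us: "distinct us" "length us = Suc j" "\<And>i. i \<le> j \<Longrightarrow> us ! i = vs ! i"
    using vs' j by (auto simp: us_def)
  define C where "C = (set us, {{us ! i, us ! (Suc i mod length us)} | i. i < length us})"
  have "cycle_graph C" unfolding cycle_graph_def C_def using us j2 by (intro exI[of _ us]) auto
  moreover have "edges C \<subseteq> S"
  proof
    fix e assume "e \<in> edges C"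
    then obtain i where i: "i < Suc j" "e = {us ! i, us ! (Suc i mod Suc j)}" by (auto simp: C_def us)
    show "e \<in> S"
    proof (cases "i = j")
      case True
      then have "e = {c, ?a}" using i us(3) j by simp
      then show ?thesis using f c by (simp add: insert_commute)
    next
      case False
      then have "e = {vs ! i, vs ! Suc i}" using i us(3) by simp
      then show ?thesis using vs'(3)[of i] i False j by simp
    qed
  qed
  ultimately show ?thesis by blast
qed

lemma acyclic_graph_iff:
  assumes F: "simple_graph F" "finite (edges F)"
  shows "acyclic_graph F \<longleftrightarrow> acyclic_edges (edges F)"
proof
  assume acyc: "acyclic_graph F"
  show "acyclic_edges (edges F)"
    unfolding acyclic_edges_def
  proof (intro allI impI, rule ccontr)
    fix S assume S: "S \<subseteq> edges F" "odd_vertices S = {}" "S \<noteq> {}"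
    have fin: "finite S" using S F(2) by (auto intro: finite_subset)
    have "card e = 2" if "e \<in> S" for e using that S F by (auto simp: simple_graph_def)
    then obtain C where C: "cycle_graph C" "edges C \<subseteq> S" using even_edges_contain_cycle[OF fin S(3) _ S(2)] by blast
    have "edges C \<subseteq> edges F" using C S by blast
    moreover have "verts C \<subseteq> verts F"
      using cycle_graph_even(4)[OF C(1)] \<open>edges C \<subseteq> edges F\<close> F by (auto simp: simple_graph_def)
    moreover have "simple_graph C"
      using cycle_graph_even(4)[OF C(1)] \<open>edges C \<subseteq> edges F\<close> F by (auto simp: simple_graph_def)
    ultimately show False using acyc C by (auto simp: acyclic_graph_def cycle_in_def subgraph_def)
  qed
next
  assume "acyclic_edges (edges F)"
  then have "\<not> (cycle_graph C \<and> edges C \<subseteq> edges F)" for C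
    using cycle_graph_even(1,2)[of C] by (auto simp: acyclic_edges_def)
  then show "acyclic_graph F"
    by (auto simp: acyclic_graph_def cycle_in_def subgraph_def)
qed

lemma finite_edges:
  assumes "finite_simple_graph G"
  shows "finite (edges G)"
proof -
  have "edges G \<subseteq> Pow (verts G)" "finite (verts G)"
    using assms by (auto simp: finite_simple_graph_def simple_graph_def)
  then show ?thesis by (metis finite_Pow_iff finite_subset)
qed

lemma bases_cycle_matroid:
  assumes G: "finite_simple_graph G"
  shows "snd (cycle_matroid G) = {A. edge_basis (edges G) A}"
proof -
  have finE: "finite (edges G)" by (rule finite_edges[OF G])
  have sub: "simple_graph (verts G, A)" "subgraph (verts G, A) G" if "A \<subseteq> edges G" for A
    using that G by (auto simp: subgraph_def simple_graph_def finite_simple_graph_def)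
  have acyc: "acyclic_graph H \<longleftrightarrow> acyclic_edges (edges H)" if "subgraph H G" for H
    using that finE by (intro acyclic_graph_iff) (auto simp: subgraph_def intro: finite_subset)
  show ?thesis
  proof (intro equalityI subsetI)
    fix A assume "A \<in> snd (cycle_matroid G)"
    then obtain F where F: "A = edges F" "spanning_forest F G" by (auto simp: cycle_matroid_def)
    have FG: "subgraph F G" "acyclic_edges A"
      using F acyc[of F] by (auto simp: spanning_forest_def)
    then have "A \<subseteq> edges G" using F by (simp add: subgraph_def)
    moreover have "A' = A" if A': "A \<subseteq> A'" "A' \<subseteq> edges G" "acyclic_edges A'" for A'
    proof -
      have "acyclic_graph (verts G, A')" using acyc[OF sub(2)[OF A'(2)]] A' by simp
      moreover have "subgraph F (verts G, A')" using FG F A' by (auto simp: subgraph_def)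
      ultimately have "(verts G, A') = F" using F(2) sub(2)[OF A'(2)] unfolding spanning_forest_def by blast
      then show ?thesis using F by auto
    qed
    ultimately show "A \<in> {A. edge_basis (edges G) A}" using FG by (auto simp: edge_basis_def)
  next
    fix A assume "A \<in> {A. edge_basis (edges G) A}"
    then have A: "A \<subseteq> edges G" "acyclic_edges A"
      "\<And>A'. A \<subseteq> A' \<Longrightarrow> A' \<subseteq> edges G \<Longrightarrow> acyclic_edges A' \<Longrightarrow> A' = A" by (auto simp: edge_basis_def)
    have "spanning_forest (verts G, A) G"
      unfolding spanning_forest_def
    proof (intro conjI allI impI)
      show "subgraph (verts G, A) G" "acyclic_graph (verts G, A)"
        using sub[OF A(1)] acyc[OF sub(2)[OF A(1)]] A by auto
      fix H assume H: "subgraph H G \<and> acyclic_graph H \<and> subgraph (verts G, A) H"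
      then have "acyclic_edges (edges H)" using acyc by blast
      then have "edges H = A" using A(3)[of "edges H"] H by (auto simp: subgraph_def)
      moreover have "verts H = verts G" using H by (auto simp: subgraph_def)
      ultimately show "H = (verts G, A)" by (metis prod.collapse)
    qed
    then show "A \<in> snd (cycle_matroid G)" by (force simp: cycle_matroid_def)
  qed
qed

lemma edge_bases_if_no_cycle:
  assumes G: "finite_simple_graph G" and no: "\<nexists>C. cycle_in C G"
  shows "{A. edge_basis (edges G) A} = {edges G}"
proof -
  have "acyclic_edges (edges G)"
    using no G finite_edges[OF G] acyclic_graph_iff[of G]
    by (auto simp: acyclic_graph_def finite_simple_graph_def)
  then show ?thesis by (auto simp: edge_basis_def)
qed

lemma edge_bases_if_unique_cycle:
  assumes G: "finite_simple_graph G" and C: "cycle_in C G" and unique: "\<And>D. cycle_in D G \<Longrightarrow> D = C"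
  shows "{A. edge_basis (edges G) A} = (\<lambda>e. edges G - {e}) ` edges C" "edges C \<subseteq> edges G"
proof -
  have CG: "edges C \<subseteq> edges G" "edges C \<noteq> {}" "odd_vertices (edges C) = {}"
    using C cycle_graph_even[of C] by (auto simp: cycle_in_def subgraph_def)
  then show "edges C \<subseteq> edges G" by blast
  have ind: "acyclic_edges (edges G - {e})" if "e \<in> edges C" for e
  proof -
    let ?F = "(verts G, edges G - {e})"
    have F: "simple_graph ?F" "finite (edges ?F)"
      using G finite_edges[OF G] by (auto simp: finite_simple_graph_def simple_graph_def)
    have "acyclic_graph ?F"
      unfolding acyclic_graph_def
    proof
      assume "\<exists>D. cycle_in D ?F"
      then obtain D where D: "cycle_in D ?F" by blast
      then have "cycle_in D G" by (auto simp: cycle_in_def subgraph_def)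
      then have "D = C" by (rule unique)
      then show False using D that by (auto simp: cycle_in_def subgraph_def)
    qed
    then show ?thesis using acyclic_graph_iff[OF F] by simp
  qed
  have dep: "\<not> acyclic_edges A" if "edges C \<subseteq> A" for A
    using that CG(2,3) unfolding acyclic_edges_def by blast
  show "{A. edge_basis (edges G) A} = (\<lambda>e. edges G - {e}) ` edges C"
  proof (intro equalityI subsetI)
    fix A assume "A \<in> {A. edge_basis (edges G) A}"
    then have A: "A \<subseteq> edges G" "acyclic_edges A"
      "\<And>A'. A \<subseteq> A' \<Longrightarrow> A' \<subseteq> edges G \<Longrightarrow> acyclic_edges A' \<Longrightarrow> A' = A" by (auto simp: edge_basis_def)
    then obtain e where e: "e \<in> edges C" "e \<notin> A" using dep[of A] by blast
    have "A \<subseteq> edges G - {e}" using A(1) e(2) by blast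
    from A(3)[OF this Diff_subset ind[OF e(1)]] have "edges G - {e} = A" .
    then show "A \<in> (\<lambda>e. edges G - {e}) ` edges C" using e by blast
  next
    fix A assume "A \<in> (\<lambda>e. edges G - {e}) ` edges C"
    then obtain e where e: "e \<in> edges C" "A = edges G - {e}" by blast
    have "A' = A" if A': "A \<subseteq> A'" "A' \<subseteq> edges G" "acyclic_edges A'" for A'
    proof (rule ccontr)
      assume "A' \<noteq> A"
      then have "e \<in> A'" using A'(1,2) unfolding e(2) by blast
      then have "edges G \<subseteq> A'" using A'(1) unfolding e(2) by blast
      then show False using A'(3) dep[of A'] CG(1) by blast
    qed
    then show "A \<in> {A. edge_basis (edges G) A}" using e ind by (auto simp: edge_basis_def)
  qed
qed

text \<open>
  A given edge meets another edge at each of its two ends, and these two are distinct, because an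
  edge is determined by its ends.
\<close>
lemma card_even_ge_3:
  assumes S: "finite S" "S \<noteq> {}" "\<And>e. e \<in> S \<Longrightarrow> card e = 2" and even: "odd_vertices S = {}"
  shows "3 \<le> card S"
proof -
  obtain e where e: "e \<in> S" using S by blast
  then obtain x y where xy: "e = {x, y}" "x \<noteq> y" using S(3) by (meson card_2_iff)
  have ex: "\<exists>f\<in>S. v \<in> f \<and> f \<noteq> e" if "v \<in> e" for v
  proof (rule ccontr)
    assume "\<not> (\<exists>f\<in>S. v \<in> f \<and> f \<noteq> e)"
    then have "{f\<in>S. v \<in> f} = {e}" using e that by blast
    then have "v \<in> odd_vertices S" by (simp add: odd_vertices_def)
    then show False using even by simp
  qed
  obtain f where f: "f \<in> S" "x \<in> f" "f \<noteq> e" using ex xy by blast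
  obtain g where g: "g \<in> S" "y \<in> g" "g \<noteq> e" using ex xy by blast
  have "f \<noteq> g"
  proof
    assume "f = g"
    then have "{x, y} \<subseteq> f" using f g by blast
    moreover have "card f = card {x, y}" "finite f" using S(3)[OF f(1)] xy by (auto intro: card_ge_0_finite)
    ultimately have "{x, y} = f" by (intro card_subset_eq) auto
    then show False using f xy by simp
  qed
  then have "card {e, f, g} = 3" using f g by auto
  moreover have "{e, f, g} \<subseteq> S" using e f g by blast
  ultimately show ?thesis using S(1) card_mono by metis
qed

lemma two_in_set:
  assumes "2 \<le> card A"
  shows "\<exists>a b. a \<in> A \<and> b \<in> A \<and> a \<noteq> b"
proof -
  obtain T where "T \<subseteq> A" "card T = 2" using obtain_subset_with_card_n[OF assms] by blast
  then show ?thesis unfolding card_2_iff by blast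
qed

lemma three_in_set:
  assumes "3 \<le> card A"
  shows "\<exists>a b c. a \<in> A \<and> b \<in> A \<and> c \<in> A \<and> a \<noteq> b \<and> a \<noteq> c \<and> b \<noteq> c"
proof -
  obtain T where T: "T \<subseteq> A" "card T = 3" using obtain_subset_with_card_n[OF assms] by blast
  then obtain a b c where "T = {a, b, c}" "a \<noteq> b" "b \<noteq> c" "a \<noteq> c" unfolding card_3_iff by blast
  then show ?thesis using T by (intro exI[of _ a] exI[of _ b] exI[of _ c]) simp
qed

text \<open>
  With a basis \<open>A\<close> and two more edges \<open>x\<close> and \<open>y\<close>, the nonempty even subsets of \<open>H = A \<union> {x, y}\<close> are the
  fundamental cycles \<open>Sx\<close> and \<open>Sy\<close> and their symmetric difference. So \<open>H\<close> without two of its edges is a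
  basis when the two edges lie in different ones of the classes \<open>Sx - Sy\<close>, \<open>Sy - Sx\<close> and \<open>Sx \<inter> Sy\<close>.
  The union of any two of these classes is a nonempty even set, and has at least three edges because
  the graph is simple. If \<open>Sx \<inter> Sy\<close> is empty, the other two classes have three edges each, and the
  hexagon alternates between them. Otherwise two classes have at least two
  edges, and an edge of the third class is the common vertex of two triangles.
\<close>
theorem hexagon_of_two_cycles:
  assumes G: "finite_simple_graph G" and two: "\<not> (\<exists>\<^sub>\<le>\<^sub>1 C. cycle_in C G)"
  shows "\<exists>H z t. H \<subseteq> edges G \<and> (\<forall>i<6. z i \<in> H \<and> edge_basis (edges G) (H - {z i, z (Suc i mod 6)})) \<and>
    (\<forall>i<6. \<forall>j<6. z i = z j \<longleftrightarrow> i = j \<or> t \<and> (i = 0 \<and> j = 3 \<or> i = 3 \<and> j = (0::nat)))"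
proof -
  let ?E = "edges G"
  have finE: "finite ?E" by (rule finite_edges[OF G])
  have card2: "card e = 2" if "e \<in> ?E" for e
    using that G by (auto simp: finite_simple_graph_def simple_graph_def)
  obtain C1 C2 where C: "cycle_in C1 G" "cycle_in C2 G" "C1 \<noteq> C2"
    using two unfolding Uniq_def by blast
  let ?S1 = "edges C1" and ?S2 = "edges C2"
  have cyc: "cycle_graph C1" "cycle_graph C2" "?S1 \<subseteq> ?E" "?S2 \<subseteq> ?E"
    using C by (auto simp: cycle_in_def subgraph_def)
  note even1 = cycle_graph_even[OF cyc(1)] and even2 = cycle_graph_even[OF cyc(2)]
  have neq: "?S1 \<noteq> ?S2"
    using C(3) even1(4) even2(4) by (metis prod.collapse)
  obtain A where A: "edge_basis ?E A" using edge_basis_exists[OF finE] by blast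
  have AE: "A \<subseteq> ?E" "acyclic_edges A" "finite A" using A finE by (auto simp: edge_basis_def intro: finite_subset)
  have not_sub: "\<not> S \<subseteq> A" if "odd_vertices S = {}" "S \<noteq> {}" for S
    using AE that by (auto simp: acyclic_edges_def)
  obtain x where x: "x \<in> ?S1" "x \<notin> A" using not_sub[OF even1(1,2)] by blast
  \<comment> \<open>otherwise the two cycles differ by an even subset of \<open>A\<close>\<close>
  have "\<exists>y\<in>?S1 \<union> ?S2. y \<notin> A \<and> y \<noteq> x"
  proof (rule ccontr)
    assume *: "\<not> ?thesis"
    then have "x \<in> ?S2" using not_sub[OF even2(1,2)] by blast
    then have "sym_diff ?S1 ?S2 \<subseteq> A" using * x by blast
    moreover have "odd_vertices (sym_diff ?S1 ?S2) = {}"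
      using even1 even2 by (simp add: odd_vertices_sym_diff)
    moreover have "sym_diff ?S1 ?S2 \<noteq> {}" using neq by blast
    ultimately show False using not_sub by blast
  qed
  then obtain y where y: "y \<in> ?S1 \<union> ?S2" "y \<notin> A" "y \<noteq> x" by blast
  have xyE: "x \<in> ?E" "y \<in> ?E" using x y cyc by auto
  obtain Sx where Sx: "Sx \<subseteq> insert x A" "x \<in> Sx" "odd_vertices Sx = {}"
    using edge_basis_fundamental[OF finE A xyE(1) x(2)] by metis
  obtain Sy where Sy: "Sy \<subseteq> insert y A" "y \<in> Sy" "odd_vertices Sy = {}"
    using edge_basis_fundamental[OF finE A xyE(2) y(2)] by metis
  define H where "H = insert x (insert y A)"
  have HE: "H \<subseteq> ?E" "finite H" using xyE AE by (auto simp: H_def)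
  have cardH: "card H = card A + 2" using x y AE by (simp add: H_def)
  have fin: "finite Sx" "finite Sy" using Sx Sy AE by (auto intro: finite_subset)
  have evenD: "odd_vertices (sym_diff Sx Sy) = {}"
    using Sx Sy fin by (simp add: odd_vertices_sym_diff)
  have even_cases: "S = {} \<or> S = Sx \<or> S = Sy \<or> S = sym_diff Sx Sy"
    if S: "S \<subseteq> H" "odd_vertices S = {}" for S
  proof -
    have finS: "finite S" using S HE by (auto intro: finite_subset)
    define U where "U = (if x \<in> S then Sx else {})"
    define V where "V = (if y \<in> S then Sy else {})"
    have UV: "odd_vertices U = {}" "odd_vertices V = {}" "finite U" "finite V"
      using Sx Sy fin by (auto simp: U_def V_def)
    have "odd_vertices (sym_diff S (sym_diff U V)) = {}"
      using UV finS S by (simp add: odd_vertices_sym_diff)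
    moreover have "sym_diff S (sym_diff U V) \<subseteq> A"
      using S Sx Sy x y by (auto simp: U_def V_def H_def)
    ultimately have "sym_diff S (sym_diff U V) = {}" using not_sub by blast
    then have SUV: "S = sym_diff U V" by (simp only: sym_diff_cancel)
    have "U = {} \<or> U = Sx" "V = {} \<or> V = Sy" by (simp_all add: U_def V_def)
    then show ?thesis unfolding SUV by (elim disjE) simp_all
  qed
  define P1 where "P1 = Sx - Sy"
  define P2 where "P2 = Sy - Sx"
  define P3 where "P3 = Sx \<inter> Sy"
  have PH: "P1 \<subseteq> H" "P2 \<subseteq> H" "P3 \<subseteq> H" using Sx Sy by (auto simp: P1_def P2_def P3_def H_def)
  define sep where "sep e f \<longleftrightarrow> e \<in> H \<and> f \<in> H \<and> e \<noteq> f \<and> edge_basis ?E (H - {e, f})" for e f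
  have sepI: "sep e f" if ef: "e \<in> H" "f \<in> H" "e \<noteq> f" and "e \<in> Sx \<or> f \<in> Sx" "e \<in> Sy \<or> f \<in> Sy"
      "e \<in> sym_diff Sx Sy \<or> f \<in> sym_diff Sx Sy" for e f
  proof -
    have "acyclic_edges (H - {e, f})"
      unfolding acyclic_edges_def using even_cases that by blast
    moreover have "card (H - {e, f}) = card A"
      using ef HE cardH by (simp add: card_Diff_subset)
    ultimately have "edge_basis ?E (H - {e, f})"
      using HE by (intro edge_basis_if_card[OF finE A]) auto
    then show ?thesis using ef by (simp add: sep_def)
  qed
  have sep12: "sep e f" if "e \<in> P1" "f \<in> P2" for e f
    using that PH by (intro sepI) (auto simp: P1_def P2_def)
  have sep13: "sep e f" if "e \<in> P1" "f \<in> P3" for e f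
    using that PH by (intro sepI) (auto simp: P1_def P3_def)
  have sep23: "sep e f" if "e \<in> P2" "f \<in> P3" for e f
    using that PH by (intro sepI) (auto simp: P2_def P3_def)
  have sep_sym: "sep e f \<Longrightarrow> sep f e" for e f by (auto simp: sep_def insert_commute)
  have finP: "finite P1" "finite P2" "finite P3" using fin by (auto simp: P1_def P2_def P3_def)
  have in_E: "card e = 2" if "e \<in> Sx \<union> Sy" for e
    using that Sx Sy AE xyE by (intro card2) auto
  have "3 \<le> card Sx" using fin Sx in_E by (intro card_even_ge_3) auto
  moreover have "Sx = P1 \<union> P3" "P1 \<inter> P3 = {}" by (auto simp: P1_def P3_def)
  ultimately have c13: "3 \<le> card P1 + card P3" using finP by (metis card_Un_disjoint)
  have "3 \<le> card Sy" using fin Sy in_E by (intro card_even_ge_3) auto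
  moreover have "Sy = P2 \<union> P3" "P2 \<inter> P3 = {}" by (auto simp: P2_def P3_def)
  ultimately have c23: "3 \<le> card P2 + card P3" using finP by (metis card_Un_disjoint)
  have x1: "x \<in> P1" "y \<in> P2" using Sx Sy x y by (auto simp: P1_def P2_def)
  have "3 \<le> card (sym_diff Sx Sy)"
    using fin evenD in_E x1 by (intro card_even_ge_3) (auto simp: P1_def)
  moreover have "sym_diff Sx Sy = P1 \<union> P2" "P1 \<inter> P2 = {}" by (auto simp: P1_def P2_def)
  ultimately have c12: "3 \<le> card P1 + card P2" using finP by (metis card_Un_disjoint)
  have six: ?thesis
    if "\<And>i. i < 6 \<Longrightarrow> sep (zs ! i) (zs ! (Suc i mod 6))"
      "\<And>i j. i < 6 \<Longrightarrow> j < 6 \<Longrightarrow> zs ! i = zs ! j \<longleftrightarrow> i = j \<or> t \<and> (i = 0 \<and> j = 3 \<or> i = 3 \<and> j = 0)" for zs t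
    using that HE(1) by (intro exI[of _ H] exI[of _ "(!) zs"] exI[of _ t]) (auto simp: sep_def)
  have six_cases: "i = 0 \<or> i = 1 \<or> i = 2 \<or> i = 3 \<or> i = 4 \<or> i = 5" if "i < 6" for i :: nat
    using that by auto
  \<comment> \<open>two triangles with the common vertex \<open>p\<close> in the class \<open>P\<close>\<close>
  have bowtie: ?thesis
    if p: "p \<in> P" and Q: "2 \<le> card Q" "2 \<le> card R" and dis: "P \<inter> Q = {}" "P \<inter> R = {}" "Q \<inter> R = {}"
      and sep: "\<And>e f. e \<in> P \<Longrightarrow> f \<in> Q \<Longrightarrow> sep e f" "\<And>e f. e \<in> Q \<Longrightarrow> f \<in> R \<Longrightarrow> sep e f"
        "\<And>e f. e \<in> R \<Longrightarrow> f \<in> P \<Longrightarrow> sep e f" for p P Q R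
  proof -
    obtain a b where a: "a \<in> Q" "b \<in> Q" "a \<noteq> b" using two_in_set[OF Q(1)] by blast
    obtain c d where c: "c \<in> R" "d \<in> R" "c \<noteq> d" using two_in_set[OF Q(2)] by blast
    have ne: "p \<noteq> a" "p \<noteq> b" "p \<noteq> c" "p \<noteq> d" "a \<noteq> c" "a \<noteq> d" "b \<noteq> c" "b \<noteq> d"
      using p a c dis by auto
    show ?thesis
    proof (rule six[of "[p, a, c, p, b, d]" True])
      fix i :: nat assume i: "i < 6"
      show "sep ([p, a, c, p, b, d] ! i) ([p, a, c, p, b, d] ! (Suc i mod 6))"
        using six_cases[OF i] sep p a c by (elim disjE) simp_all
      fix j :: nat assume j: "j < 6"
      show "[p, a, c, p, b, d] ! i = [p, a, c, p, b, d] ! j \<longleftrightarrow> i = j \<or> True \<and> (i = 0 \<and> j = 3 \<or> i = 3 \<and> j = 0)"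
        using six_cases[OF i] six_cases[OF j] a c ne by (elim disjE) simp_all
    qed
  qed
  show ?thesis
  proof (cases "P3 = {}")
    case True
    then have "3 \<le> card P1" "3 \<le> card P2" using c13 c23 by simp_all
    then obtain a b c d e f where a: "a \<in> P1" "b \<in> P1" "c \<in> P1" "a \<noteq> b" "a \<noteq> c" "b \<noteq> c"
      and d: "d \<in> P2" "e \<in> P2" "f \<in> P2" "d \<noteq> e" "d \<noteq> f" "e \<noteq> f"
      using three_in_set by metis
    have "P1 \<inter> P2 = {}" by (auto simp: P1_def P2_def)
    then have ne: "u \<noteq> v" if "u \<in> P1" "v \<in> P2" for u v using that by blast
    show ?thesis
    proof (rule six[of "[a, e, c, d, b, f]" False])
      fix i :: nat assume i: "i < 6"
      show "sep ([a, e, c, d, b, f] ! i) ([a, e, c, d, b, f] ! (Suc i mod 6))"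
        using six_cases[OF i] sep12 sep_sym a d by (elim disjE) simp_all
      fix j :: nat assume j: "j < 6"
      have "distinct [a, e, c, d, b, f]" using a d ne by auto
      then show "[a, e, c, d, b, f] ! i = [a, e, c, d, b, f] ! j \<longleftrightarrow> i = j \<or> False \<and> (i = 0 \<and> j = 3 \<or> i = 3 \<and> j = 0)"
        using i j by (subst nth_eq_iff_index_eq) auto
    qed
  next
    case False
    then obtain p3 where p3: "p3 \<in> P3" by blast
    have dis: "P1 \<inter> P2 = {}" "P1 \<inter> P3 = {}" "P2 \<inter> P3 = {}" by (auto simp: P1_def P2_def P3_def)
    consider "2 \<le> card P1" "2 \<le> card P2" | "2 \<le> card P2" "2 \<le> card P3" | "2 \<le> card P1" "2 \<le> card P3"
      using c12 c13 c23 by linarith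
    then show ?thesis
    proof cases
      case 1
      then show ?thesis using dis sep12 sep13 sep23 sep_sym by (intro bowtie[OF p3, of P1 P2]) auto
    next
      case 2
      then show ?thesis using dis sep12 sep13 sep23 sep_sym by (intro bowtie[OF x1(1), of P2 P3]) auto
    next
      case 3
      then show ?thesis using dis sep12 sep13 sep23 sep_sym by (intro bowtie[OF x1(2), of P1 P3]) auto
    qed
  qed
qed

section \<open>Freiman matroids of graphs\<close>

context equigenerated
begin

lemma analytic_spread_eq:
  "analytic_spread X (monomial_ideal X S :: ('x, 'k::field) mpoly set)
    = krull_dim (monoid_ring (power_monoid S) :: ('x, 'k) graded_mpoly ring)"
  unfolding analytic_spread_def
  by (rule krull_dim_iso[OF to_fiber_iso cring_monoid_ring[OF submonoid_power_monoid] cring_fiber_cone])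

lemma min_gens_power:
  "min_gens (mpoly_ring X) (ideal_power (mpoly_ring X) (monomial_ideal X S :: ('x, 'k::field) mpoly set) k)
    = card (fold_sums S k)"
  unfolding power_ideal_eq
  by (rule min_gens_monomial_ideal[OF finite_X finite_fold_sums[OF finite_S] fold_sums_vars[OF S_vars]
        weight_fold_sums[OF weight_S]])

lemma freiman_ideal_iff:
  "freiman_ideal X (monomial_ideal X S :: ('x, 'k::field) mpoly set) \<longleftrightarrow>
   (\<exists>l. krull_dim (monoid_ring (power_monoid S) :: ('x, 'k) graded_mpoly ring) = enat l \<and>
      2 * int (card (pair_sums S)) = 2 * int l * int (card S) - int l * (int l - 1))"
proof -
  have "min_gens (mpoly_ring X) (monomial_ideal X S :: ('x, 'k) mpoly set) = card S"
    by (rule min_gens_monomial_ideal[OF finite_X finite_S S_vars weight_S])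
  moreover have "int c = int l * m - int (l choose 2) \<longleftrightarrow> 2 * int c = 2 * int l * m - int l * (int l - 1)" for c l m
  proof -
    have "2 * (l choose 2) = l * (l - 1)" unfolding choose_two by (cases l) simp_all
    then have "int (2 * (l choose 2)) = int (l * (l - 1))" by (rule arg_cong)
    then have "2 * int (l choose 2) = int l * (int l - 1)" by (cases l) (simp_all add: algebra_simps)
    moreover have "2 * int l * m = 2 * (int l * m)" by simp
    ultimately show ?thesis by linarith
  qed
  ultimately show ?thesis
    by (simp only: freiman_ideal_def analytic_spread_eq min_gens_power)
qed

lemma polynomial_fiber_cone_iff:
  "is_polynomial_algebra (fiber_const X (monomial_ideal X S :: ('x, 'k::field) mpoly set))
     (poly_fiber_cone X (monomial_ideal X S)) \<longleftrightarrow>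
   (\<exists>n::nat. \<exists>h \<in> ring_iso (mpoly_ring {..<n} :: (nat, 'k) mpoly ring) (monoid_ring (power_monoid S)).
      \<forall>c. h (poly_const c) = single 0 c)"
    (is "?l \<longleftrightarrow> ?r")
proof -
  let ?T = "monoid_ring (power_monoid S) :: ('x, 'k) graded_mpoly ring"
  let ?g = "inv_into (carrier ?T) (to_fiber :: _ \<Rightarrow> nat \<Rightarrow> ('x, 'k) mpoly set)"
  have g: "?g \<in> ring_iso (poly_fiber_cone X (monomial_ideal X S)) ?T"
    by (rule ring_iso_set_sym[OF cring.axioms(1)[OF cring_monoid_ring[OF submonoid_power_monoid]] to_fiber_iso])
  have g_const: "?g (fiber_const X (monomial_ideal X S) c) = single 0 c" for c
  proof -
    have "inj_on to_fiber (carrier ?T)" using to_fiber_iso by (auto simp: ring_iso_def bij_betw_def)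
    moreover have "single 0 c \<in> carrier ?T"
      using submonoid_power_monoid[of S] by (auto simp: submonoid_def)
    ultimately show ?thesis unfolding to_fiber_const[symmetric] by (rule inv_into_f_f)
  qed
  show ?thesis
  proof
    assume ?l
    then obtain n h where h: "h \<in> ring_iso (mpoly_ring {..<n} :: (nat, 'k) mpoly ring) (poly_fiber_cone X (monomial_ideal X S))"
      "\<forall>c. h (poly_const c) = fiber_const X (monomial_ideal X S) c"
      unfolding is_polynomial_algebra_def by blast
    have "?g \<circ> h \<in> ring_iso (mpoly_ring {..<n}) ?T" by (rule ring_iso_set_trans[OF h(1) g])
    moreover have "\<forall>c. (?g \<circ> h) (poly_const c) = single 0 c" using h(2) g_const by simp
    ultimately show ?r by blast
  next
    assume ?r
    then obtain n h where h: "h \<in> ring_iso (mpoly_ring {..<n} :: (nat, 'k) mpoly ring) ?T"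
      "\<forall>c. h (poly_const c) = single 0 c" by blast
    have "to_fiber \<circ> h \<in> ring_iso (mpoly_ring {..<n}) (poly_fiber_cone X (monomial_ideal X S))"
      by (rule ring_iso_set_trans[OF h(1) to_fiber_iso])
    moreover have "\<forall>c. (to_fiber \<circ> h) (poly_const c) = fiber_const X (monomial_ideal X S) c"
      using h(2) by (simp add: to_fiber_const)
    ultimately show ?l unfolding is_polynomial_algebra_def by blast
  qed
qed

text \<open>
  Both conditions are refuted through \<open>dim T \<le> |B| \<le> |S|\<close>. The right-hand side of the Freiman equation
  is increasing in this range, and a polynomial ring would require equality.
\<close>
theorem surplus_imp_not_freiman_polynomial:
  assumes B: "surplus_spanned S B" and d: "0 < d"
  shows "\<not> freiman_ideal X (monomial_ideal X S :: ('x, 'k::field) mpoly set)" (is "\<not> ?freiman")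
    and "\<not> is_polynomial_algebra (fiber_const X (monomial_ideal X S :: ('x, 'k) mpoly set))
      (poly_fiber_cone X (monomial_ideal X S))" (is "\<not> ?polynomial")
proof -
  let ?T = "monoid_ring (power_monoid S) :: ('x, 'k) graded_mpoly ring"
  define \<mu> where "\<mu> = int (card S)"
  define r where "r = int (card B)"
  have BS: "B \<subseteq> S" "S \<subseteq> rational_span B" and surplus: "2 * int (card (pair_sums S)) > 2 * r * \<mu> - r * (r - 1)"
    using B by (auto simp: surplus_spanned_def r_def \<mu>_def)
  have krull: "krull_dim ?T \<le> enat (card B)"
    by (rule krull_dim_power_monoid_le[OF finite_X finite_S S_vars weight_S d BS])
  have r\<mu>: "r \<le> \<mu>" unfolding r_def \<mu>_def using card_mono[OF finite_S BS(1)] by simp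
  show "\<not> ?freiman"
  proof
    assume ?freiman
    then obtain l where l: "krull_dim ?T = enat l" "2 * int (card (pair_sums S)) = 2 * int l * \<mu> - int l * (int l - 1)"
      unfolding freiman_ideal_iff \<mu>_def by blast
    have lr: "int l \<le> r" using krull l(1) by (simp add: r_def)
    have "0 \<le> (r - int l) * (2 * \<mu> + 1 - r - int l)"
      using lr r\<mu> by (intro mult_nonneg_nonneg) auto
    then show False using surplus l(2) by (simp add: algebra_simps)
  qed
  show "\<not> ?polynomial"
  proof
    assume ?polynomial
    then obtain n h where h: "h \<in> ring_iso (mpoly_ring {..<n} :: (nat, 'k) mpoly ring) ?T"
      "\<And>c. h (poly_const c) = single 0 c" unfolding polynomial_fiber_cone_iff by blast
    have "krull_dim ?T = enat n"
      using krull_dim_iso[OF h(1) cring_mpoly_ring cring_monoid_ring[OF submonoid_power_monoid]]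
        krull_dim_mpoly_ring by simp
    then have "int n \<le> r" using krull by (simp add: r_def)
    moreover have "\<mu> \<le> int n" using card_le_of_polynomial[OF finite_S h] by (simp add: \<mu>_def)
    ultimately have "r = \<mu>" using r\<mu> by simp
    then have "2 * int (card (pair_sums S)) > \<mu> * (\<mu> + 1)" using surplus by (simp add: algebra_simps)
    moreover have "2 * int (card (pair_sums S)) \<le> \<mu> * (\<mu> + 1)"
    proof -
      have "int (2 * card (pair_sums S)) \<le> int (card S * (card S + 1))"
        using card_pair_sums_le[OF finite_S] by (simp only: of_nat_le_iff)
      then show ?thesis by (simp add: \<mu>_def algebra_simps)
    qed
    ultimately show False by simp
  qed
qed

text \<open>
  The hypothesis says that the monoid is free on the pairs \<open>(1, s i)\<close>.
\<close>
theorem free_imp_freiman_polynomial: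
  assumes s: "bij_betw s {..<n} S"
    and inj: "inj_on (\<lambda>t. (weight {..<n} t, exponent_sum s n t)) {t. keys t \<subseteq> {..<n}}"
  shows "freiman_ideal X (monomial_ideal X S :: ('x, 'k::field) mpoly set)" (is ?freiman)
    and "is_polynomial_algebra (fiber_const X (monomial_ideal X S :: ('x, 'k) mpoly set))
      (poly_fiber_cone X (monomial_ideal X S))" (is ?polynomial)
proof -
  let ?T = "monoid_ring (power_monoid S) :: ('x, 'k) graded_mpoly ring"
  obtain h where h: "h \<in> ring_iso (mpoly_ring {..<n} :: (nat, 'k) mpoly ring) ?T"
      "\<forall>c. h (poly_const c) = single 0 c" using free_power_monoid_ring[OF s inj] by blast
  then show ?polynomial
    unfolding polynomial_fiber_cone_iff by blast
  have krull: "krull_dim ?T = enat n"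
    using krull_dim_iso[OF h(1) cring_mpoly_ring cring_monoid_ring[OF submonoid_power_monoid]]
      krull_dim_mpoly_ring by simp
  have card: "card S = n" using bij_betw_same_card[OF s] by simp
  have "i = i' \<and> j = j'"
    if ij: "i \<le> j" "j < n" "i' \<le> j'" "j' < n" "s i + s j = s i' + s j'" for i j i' j'
  proof -
    let ?t = "single i (1::nat) + single j 1" and ?t' = "single i' (1::nat) + single j' 1"
    have "(weight {..<n} ?t, exponent_sum s n ?t) = (weight {..<n} ?t', exponent_sum s n ?t')"
    proof -
      have "exponent_sum s n ?t = exponent_sum s n ?t'"
        using ij exponent_sum_single[of i n s] exponent_sum_single[of j n s]
          exponent_sum_single[of i' n s] exponent_sum_single[of j' n s] by (simp add: exponent_sum_add)
      then show ?thesis using ij by (simp add: weight_add weight_single)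
    qed
    moreover have "?t \<in> {t. keys t \<subseteq> {..<n}}" "?t' \<in> {t. keys t \<subseteq> {..<n}}"
      using ij by (auto simp: keys_nat_add)
    ultimately have "?t = ?t'" using inj_onD[OF inj] by blast
    then have "keys ?t = keys ?t'" by simp
    then have "{i, j} = {i', j'}" by (simp add: keys_nat_add insert_commute)
    then show ?thesis using ij by (auto simp: doubleton_eq_iff)
  qed
  then have "card (pair_sums S) = card {(i, j). i \<le> j \<and> j < n}"
    unfolding pair_sums_enumerate[OF s] by (intro card_image) (auto simp: inj_on_def)
  then have "2 * card (pair_sums S) = n * (n + 1)" using card_ordered_pairs(2)[of n] by simp
  then have "2 * int (card (pair_sums S)) = int n * (int n + 1)"
    by (metis of_nat_1 of_nat_add of_nat_mult of_nat_numeral)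
  then show ?freiman
    unfolding freiman_ideal_iff using krull card by (intro exI[of _ n]) (simp add: algebra_simps)
qed

end

definition edge_monomial :: "'e set \<Rightarrow> 'e \<Rightarrow>\<^sub>0 nat" where
  "edge_monomial A = (\<Sum>e\<in>A. single e 1)"

lemma lookup_edge_monomial: "finite A \<Longrightarrow> lookup (edge_monomial A) e = (if e \<in> A then 1 else 0)"
  by (simp add: edge_monomial_def lookup_sum lookup_single when_def)

lemma keys_edge_monomial: "finite A \<Longrightarrow> keys (edge_monomial A) = A"
  by (auto simp: in_keys_iff lookup_edge_monomial split: if_splits)

lemma weight_edge_monomial:
  assumes "finite E" "A \<subseteq> E"
  shows "weight E (edge_monomial A) = card A"
proof -
  have "finite A" using assms finite_subset by blast
  then show ?thesis
    using assms by (simp add: weight_def lookup_edge_monomial sum.If_cases Int_absorb1)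
qed

lemma prod_poly_var: "finite A \<Longrightarrow> (\<Prod>e\<in>A. poly_var e) = single (edge_monomial A) 1"
  by (induction A rule: finite_induct) (simp_all add: edge_monomial_def poly_var_def mult_single)

lemma matroidal_ideal_cycle_matroid:
  fixes G :: "'v graph"
  assumes G: "finite_simple_graph G"
  shows "(matroidal_ideal (cycle_matroid G) :: ('v set, 'k::field) mpoly set) = monomial_ideal (edges G) (edge_monomial ` {A. edge_basis (edges G) A})"
proof -
  have fin: "finite A" if "edge_basis (edges G) A" for A
    using that finite_edges[OF G] by (auto simp: edge_basis_def intro: finite_subset)
  have "{\<Prod>e\<in>A. poly_var e :: ('v set, 'k) mpoly | A. A \<in> snd (cycle_matroid G)}
      = (\<lambda>a. single a 1) ` edge_monomial ` {A. edge_basis (edges G) A}"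
  proof -
    have "(\<Prod>e\<in>A. poly_var e :: ('v set, 'k) mpoly) = single (edge_monomial A) 1" if "edge_basis (edges G) A" for A
      by (rule prod_poly_var[OF fin[OF that]])
    then show ?thesis
      unfolding bases_cycle_matroid[OF G] image_image Setcompr_eq_image by (intro image_cong) simp_all
  qed
  moreover have "edge_monomial ` {A. edge_basis (edges G) A} \<subseteq> {t. keys t \<subseteq> edges G}"
    using fin by (auto simp: keys_edge_monomial edge_basis_def)
  moreover have "fst (cycle_matroid G) = edges G" by (simp add: cycle_matroid_def)
  ultimately show ?thesis
    unfolding matroidal_ideal_def by (simp only: genideal_monomials)
qed

text \<open>
  The functional counts the common edges with \<open>A\<close>.
\<close>
lemma exposed_edge_monomial:
  assumes E: "finite E" and A: "edge_basis E A"
  shows "exposed (edge_monomial ` {A. edge_basis E A}) (edge_monomial A)"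
  unfolding exposed_def
proof (intro exI[of _ "weight A"] conjI allI ballI)
  show "weight A (a + b) = weight A a + weight A b" for a b by (rule weight_add)
  have fin: "finite B" if "edge_basis E B" for B
    using that E by (auto simp: edge_basis_def intro: finite_subset)
  fix u assume "u \<in> edge_monomial ` {A. edge_basis E A} - {edge_monomial A}"
  then obtain B where B: "edge_basis E B" "u = edge_monomial B" "B \<noteq> A" by auto
  have "weight A u = card (A \<inter> B)"
    using fin[OF A] fin[OF B(1)] by (simp add: weight_def B lookup_edge_monomial sum.If_cases)
  moreover have "A \<inter> B \<subset> A"
  proof (rule psubsetI)
    show "A \<inter> B \<noteq> A"
    proof
      assume "A \<inter> B = A"
      then have "A \<subseteq> B" by blast
      then show False using A B by (auto simp: edge_basis_def)
    qed
  qed blast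
  then have "card (A \<inter> B) < card A" using fin[OF A] by (rule psubset_card_mono[rotated])
  ultimately show "weight A u < weight A (edge_monomial A)"
    using fin[OF A] by (simp add: weight_edge_monomial)
qed

lemma edge_monomial_remove_two:
  assumes "finite H" "a \<in> H" "b \<in> H" "a \<noteq> b"
  shows "edge_monomial (H - {a, b}) + (single a 1 + single b 1) = edge_monomial H"
  using assms by (intro poly_mapping_eqI) (auto simp: lookup_add lookup_edge_monomial lookup_single when_def)

theorem two_cycles_surplus:
  assumes G: "finite_simple_graph G" and two: "\<not> (\<exists>\<^sub>\<le>\<^sub>1 C. cycle_in C G)"
  shows "\<exists>B. surplus_spanned (edge_monomial ` {A. edge_basis (edges G) A}) B"
    and "\<exists>A. edge_basis (edges G) A \<and> A \<noteq> {}"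
proof -
  let ?S = "edge_monomial ` {A. edge_basis (edges G) A}"
  have finE: "finite (edges G)" by (rule finite_edges[OF G])
  have finS: "finite ?S" using finite_edge_bases[OF finE] by simp
  obtain H z t where H: "H \<subseteq> edges G"
    and z': "\<forall>i<6. z i \<in> H \<and> edge_basis (edges G) (H - {z i, z (Suc i mod 6)})"
    and eq': "\<forall>i<6. \<forall>j<6. z i = z j \<longleftrightarrow> i = j \<or> t \<and> (i = 0 \<and> j = 3 \<or> i = 3 \<and> j = (0::nat))"
    using hexagon_of_two_cycles[OF G two] by (elim exE conjE) (rule that)
  have z: "z i \<in> H" "edge_basis (edges G) (H - {z i, z (Suc i mod 6)})" if "i < 6" for i
    using z' that by auto
  have eq: "z i = z j \<longleftrightarrow> i = j \<or> t \<and> (i = 0 \<and> j = 3 \<or> i = 3 \<and> j = 0)" if "i < 6" "j < 6" for i j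
    using eq' that by auto
  have finH: "finite H" using H finE by (rule finite_subset)
  define w where "w i = edge_monomial (H - {z i, z (Suc i mod 6)})" for i
  have "w i + (single (z i) 1 + single (z (Suc i mod 6)) 1) = edge_monomial H" if i: "i < 6" for i
    unfolding w_def
  proof (rule edge_monomial_remove_two[OF finH z(1)[OF i]])
    have m: "Suc i mod 6 < 6" by simp
    show "z (Suc i mod 6) \<in> H" by (rule z(1)[OF m])
    have "Suc i mod 6 \<noteq> i" "\<not> (i = 0 \<and> Suc i mod 6 = 3)" "\<not> (i = 3 \<and> Suc i mod 6 = 0)"
      using i by (auto simp: mod_Suc)
    then show "z i \<noteq> z (Suc i mod 6)" using eq[OF i m] by auto
  qed
  then have "surplus_spanned (w ` {..<6}) (w ` {..<5})" using eq by (rule hexagon_surplus)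
  moreover have "w ` {..<6} \<subseteq> ?S" using z(2) by (auto simp: w_def)
  moreover have "exposed ?S v" if "v \<in> ?S" for v
    using that exposed_edge_monomial[OF finE] by auto
  ultimately show "\<exists>B. surplus_spanned ?S B" using finS by (intro surplus_spanned_superset)
  have "z 2 \<in> H - {z 0, z 1}" using z(1)[of 2] eq[of 2 0] eq[of 2 1] by auto
  then have "H - {z 0, z (Suc 0 mod 6)} \<noteq> {}" by auto
  then show "\<exists>A. edge_basis (edges G) A \<and> A \<noteq> {}" using z(2)[of 0] by auto
qed

theorem theorem2p5:
  fixes G :: "'v graph" and M :: "'v set matroid"
  assumes "finite_simple_graph G" and "M = cycle_matroid G"
  shows "(freiman_matroid TYPE('k::field) M \<longleftrightarrow> (\<exists>\<^sub>\<le>\<^sub>1 C. cycle_in C G)) \<and>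
         ((\<exists>\<^sub>\<le>\<^sub>1 C. cycle_in C G) \<longleftrightarrow> base_ring_polynomial TYPE('k) M)"
proof -
  let ?E = "edges G"
  let ?S = "edge_monomial ` {A. edge_basis ?E A}"
  have finE: "finite ?E" by (rule finite_edges[OF assms(1)])
  have fin: "finite A" if "edge_basis ?E A" for A
    using that finE by (auto simp: edge_basis_def intro: finite_subset)
  obtain A0 where A0: "edge_basis ?E A0" using edge_basis_exists[OF finE] by blast
  interpret equigenerated ?E ?S "card A0"
  proof
    show "finite ?E" by (rule finE)
    show "finite ?S" using finite_edge_bases[OF finE] by simp
    show "?S \<subseteq> {t. keys t \<subseteq> ?E}" using fin by (auto simp: keys_edge_monomial edge_basis_def)
    show "weight ?E s = card A0" if "s \<in> ?S" for s
      using that card_edge_basis_eq[OF finE A0] weight_edge_monomial[OF finE] by (auto simp: edge_basis_def)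
  qed
  let ?I = "monomial_ideal ?E ?S :: ('v set, 'k) mpoly set"
  have freiman: "freiman_matroid TYPE('k) M \<longleftrightarrow> freiman_ideal ?E ?I"
    and poly: "base_ring_polynomial TYPE('k) M \<longleftrightarrow> is_polynomial_algebra (fiber_const ?E ?I) (poly_fiber_cone ?E ?I)"
    unfolding freiman_matroid_def base_ring_polynomial_def assms(2) matroidal_ideal_cycle_matroid[OF assms(1)]
    by (simp_all add: cycle_matroid_def)
  show ?thesis
  proof (cases "\<exists>\<^sub>\<le>\<^sub>1 C. cycle_in C G")
    case False
    obtain B where B: "surplus_spanned ?S B" using two_cycles_surplus(1)[OF assms(1) False] by blast
    obtain A where A: "edge_basis ?E A" "A \<noteq> {}" using two_cycles_surplus(2)[OF assms(1) False] by blast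
    have "card A = card A0" by (rule card_edge_basis_eq[OF finE A0 A(1)])
    moreover have "card A \<noteq> 0" using A fin by simp
    ultimately have "0 < card A0" by simp
    then show ?thesis using False surplus_imp_not_freiman_polynomial[OF B, where ?'k = 'k] freiman poly by blast
  next
    case True
    have "\<exists>s n. bij_betw s {..<n} ?S \<and>
        inj_on (\<lambda>t. (weight {..<n} t, exponent_sum s n t)) {t. keys t \<subseteq> {..<n}}"
    proof (cases "\<exists>C. cycle_in C G")
      case False
      have S: "?S = {edge_monomial ?E}" using edge_bases_if_no_cycle[OF assms(1) False] by simp
      have "bij_betw (\<lambda>_. edge_monomial ?E) {..<1::nat} ?S" unfolding S by (auto simp: bij_betw_def inj_on_def)
      moreover have "inj_on (\<lambda>t. (weight {..<1} t, exponent_sum (\<lambda>_. edge_monomial ?E) 1 t)) {t. keys t \<subseteq> {..<1::nat}}"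
      proof (rule inj_onI, rule poly_mapping_eqI)
        fix t u :: "nat \<Rightarrow>\<^sub>0 nat" and i
        assume tu: "t \<in> {t. keys t \<subseteq> {..<1}}" "u \<in> {t. keys t \<subseteq> {..<1}}"
          "(weight {..<1} t, exponent_sum (\<lambda>_. edge_monomial ?E) 1 t) = (weight {..<1} u, exponent_sum (\<lambda>_. edge_monomial ?E) 1 u)"
        show "lookup t i = lookup u i"
        proof (cases "i = 0")
          case True then show ?thesis using tu(3) by (simp add: weight_def)
        next
          case False
          then have "i \<notin> keys t" "i \<notin> keys u" using tu by auto
          then show ?thesis by (simp add: in_keys_iff)
        qed
      qed
      ultimately show ?thesis by blast
    next
      case ex: True
      then obtain C where C: "cycle_in C G" by blast
      have unique: "D = C" if "cycle_in D G" for D using True C that unfolding Uniq_def by blast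
      note bases = edge_bases_if_unique_cycle[OF assms(1) C unique]
      have "finite (edges C)" using bases(2) finE by (rule finite_subset)
      then obtain c where c: "bij_betw c {..<card (edges C)} (edges C)"
        using ex_bij_betw_nat_finite by (metis atLeast0LessThan)
      define n where "n = card (edges C)"
      define s where "s i = edge_monomial (?E - {c i})" for i
      have cE: "c i \<in> ?E" if "i < n" for i using c that bases(2) by (auto simp: bij_betw_def n_def)
      have c_eq: "c i = c j \<longleftrightarrow> i = j" if "i < n" "j < n" for i j
        using c that by (auto simp: bij_betw_def n_def inj_on_eq_iff)
      have lookup_s: "lookup (s i) (c j) = (if i = j then 0 else 1)" if "i < n" "j < n" for i j
        using that finE cE[OF that(2)] c_eq[OF that] by (auto simp: s_def lookup_edge_monomial)
      have "?S = s ` {..<n}"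
      proof -
        have "?S = (\<lambda>e. edge_monomial (?E - {e})) ` edges C" by (simp only: bases(1) image_image)
        also have "edges C = c ` {..<n}" using c by (simp add: bij_betw_def n_def)
        finally show ?thesis by (simp add: s_def image_image)
      qed
      moreover have "inj_on s {..<n}"
      proof (rule inj_onI)
        fix i j assume "i \<in> {..<n}" "j \<in> {..<n}" "s i = s j"
        then show "i = j" using lookup_s[of i j] lookup_s[of j j] by (auto split: if_splits)
      qed
      ultimately have "bij_betw s {..<n} ?S" by (simp add: bij_betw_def)
      moreover have "inj_on (\<lambda>t. (weight {..<n} t, exponent_sum s n t)) {t. keys t \<subseteq> {..<n}}"
      proof (rule inj_onI, rule poly_mapping_eqI)
        fix t u :: "nat \<Rightarrow>\<^sub>0 nat" and j
        assume tu: "t \<in> {t. keys t \<subseteq> {..<n}}" "u \<in> {t. keys t \<subseteq> {..<n}}"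
          "(weight {..<n} t, exponent_sum s n t) = (weight {..<n} u, exponent_sum s n u)"
        show "lookup t j = lookup u j"
        proof (cases "j < n")
          case True
          \<comment> \<open>The edge \<open>c j\<close> lies in every basis but the \<open>j\<close>-th.\<close>
          have "lookup (exponent_sum s n v) (c j) + lookup v j = weight {..<n} v" for v
          proof -
            have "lookup (exponent_sum s n v) (c j) = (\<Sum>i<n. lookup v i * (if i = j then 0 else 1))"
              unfolding lookup_exponent_sum using True lookup_s by (intro sum.cong) auto
            also have "\<dots> + lookup v j = (\<Sum>i<n. lookup v i * (if i = j then 0 else 1) + (if i = j then lookup v i else 0))"
              using True by (simp add: sum.distrib)
            also have "\<dots> = weight {..<n} v" unfolding weight_def by (intro sum.cong) auto
            finally show ?thesis .
          qed
          from this[of t] this[of u] show ?thesis using tu(3) by simp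
        next
          case False
          then have "j \<notin> keys t" "j \<notin> keys u" using tu by auto
          then show ?thesis by (simp add: in_keys_iff)
        qed
      qed
      ultimately show ?thesis by blast
    qed
    then show ?thesis using True free_imp_freiman_polynomial[where ?'k = 'k] freiman poly by blast
  qed
qed

end
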